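(* For every clan $\mathcal{T}$, the category $\mathcal{T}\text{-}\mathsf{Mod}$ equipped with the extension–full weak factorization system is clan-algebraic.
   Context: A clan is a small category $\mathcal{T}$ with a distinguished class of arrows called display maps such that: (i) pullbacks of display maps along arbitrary maps exist and are display maps; (ii) isomorphisms and composites of display maps are display maps; (iii) $\mathcal{T}$ has a terminal object and all maps to it are display maps. A model of $\mathcal{T}$ is a functor $A:\mathcal{T}\to\mathsf{Set}$ preserving the terminal object and pullbacks of display maps; $\mathcal{T}\text{-}\mathsf{Mod}\subseteq[\mathcal{T},\mathsf{Set}]$ is the full subcategory on models (it is locally finitely presentable). Representables $H(\Gamma)=\mathcal{T}(\Gamma,-)$ are models. A map in $\mathcal{T}\text{-}\mathsf{Mod}$ is full if it has the right lifting property w.r.t. all $H(p)$, $p$ a display map; it is an extension if it has the left lifting property w.r.t. all full maps. Extensions and full maps form a weak factorization system (w.f.s.). An $(\mathsf{E},\mathsf{F})$-category is a locally finitely presentable category $\mathcal{L}$ with a w.f.s. $(\mathsf{E},\mathsf{F})$, whose left maps are called extensions and right maps full maps. A 0-extension is an object $A$ such that $0\to A$ is an extension; $\mathfrak{C}(\mathcal{L})\subseteq\mathcal{L}$ is the full subcategory on compact (= finitely presentable) 0-extensions. $\mathcal{L}$ is clan-algebraic if: (D) the inclusion $\mathfrak{C}(\mathcal{L})\hookrightarrow\mathcal{L}$ is dense; (CG) $(\mathsf{E},\mathsf{F})$ is cofibrantly generated by the extensions between objects of $\mathfrak{C}(\mathcal{L})$; (FQ) every equivalence relation $\langle p,q\rangle:R\rightarrowtail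 A\times A$ in $\mathcal{L}$ with $p,q$ full is effective (i.e. is the kernel pair of its coequalizer) and has full coequalizer. *)

theory Defs
  imports Main "HOL-Library.FuncSet"
begin

unbundle cardinal_syntax

text \<open>
  Size convention. ``Small'' is measured by a cardinal \<open>\<kappa> :: 'u rel\<close>, regular and uncountable:
  a set is small if its cardinality is less than \<open>\<kappa>\<close>, and the category of sets consists of the
  small subsets of the type \<open>'u\<close>. Since \<open>\<kappa>\<close> is a well-order on elements of \<open>'u\<close>, every small set
  (and every small category) has an isomorphic copy inside \<open>'u\<close>. If \<open>\<kappa>\<close> is strongly
  inaccessible these are the sets of a Grothendieck universe, up to equivalence. That case is
  included but not required: only regularity and uncountability are assumed.
\<close>

definition size_bound :: "'u rel \<Rightarrow> bool" where
  "size_bound \<kappa> \<longleftrightarrow> Card_order \<kappa> \<and> regularCard \<kappa> \<and> natLeq <o \<kappa>"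


section \<open>Categories, functors, natural transformations\<close>

record ('o, 'a) cat =
  Obj :: "'o set"
  Arr :: "'a set"
  src :: "'a \<Rightarrow> 'o"
  trg :: "'a \<Rightarrow> 'o"
  ident :: "'o \<Rightarrow> 'a"
  cmp :: "'a \<Rightarrow> 'a \<Rightarrow> 'a" (infixl "\<cdot>\<index>" 70)

definition hom :: "('o, 'a) cat \<Rightarrow> 'o \<Rightarrow> 'o \<Rightarrow> 'a set" where
  "hom C X Y = {f \<in> Arr C. src C f = X \<and> trg C f = Y}"

locale category =
  fixes C :: "('o, 'a) cat" (structure)
  assumes src_Obj: "f \<in> Arr C \<Longrightarrow> src C f \<in> Obj C"
    and trg_Obj: "f \<in> Arr C \<Longrightarrow> trg C f \<in> Obj C"
    and ident_hom: "X \<in> Obj C \<Longrightarrow> ident C X \<in> hom C X X"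
    and cmp_hom: "\<lbrakk>f \<in> hom C X Y; g \<in> hom C Y Z\<rbrakk> \<Longrightarrow> g \<cdot> f \<in> hom C X Z"
    and ident_left: "f \<in> hom C X Y \<Longrightarrow> ident C Y \<cdot> f = f"
    and ident_right: "f \<in> hom C X Y \<Longrightarrow> f \<cdot> ident C X = f"
    and cmp_assoc: "\<lbrakk>f \<in> hom C W X; g \<in> hom C X Y; h \<in> hom C Y Z\<rbrakk> \<Longrightarrow> h \<cdot> (g \<cdot> f) = (h \<cdot> g) \<cdot> f"

definition small_category :: "'u rel \<Rightarrow> ('o, 'a) cat \<Rightarrow> bool" where
  "small_category \<kappa> C \<longleftrightarrow> category C \<and> |Obj C| <o \<kappa> \<and> |Arr C| <o \<kappa>"

definition full_subcat :: "('o, 'a) cat \<Rightarrow> 'o set \<Rightarrow> ('o, 'a) cat" where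
  "full_subcat C S =
     C\<lparr>Obj := Obj C \<inter> S, Arr := {f \<in> Arr C. src C f \<in> S \<and> trg C f \<in> S}\<rparr>"

datatype ('o, 'a, 'p, 'b) fctr = Fctr (on_obj: "'o \<Rightarrow> 'p") (on_arr: "'a \<Rightarrow> 'b")

definition is_functor :: "('o, 'a) cat \<Rightarrow> ('p, 'b) cat \<Rightarrow> ('o, 'a, 'p, 'b) fctr \<Rightarrow> bool" where
  "is_functor C D F \<longleftrightarrow>
     (\<forall>X\<in>Obj C. on_obj F X \<in> Obj D) \<and>
     (\<forall>f\<in>Arr C. on_arr F f \<in> hom D (on_obj F (src C f)) (on_obj F (trg C f))) \<and>
     (\<forall>X\<in>Obj C. on_arr F (ident C X) = ident D (on_obj F X)) \<and>
     (\<forall>f\<in>Arr C. \<forall>g\<in>Arr C. src C g = trg C f \<longrightarrow>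
        on_arr F (g \<cdot>\<^bsub>C\<^esub> f) = on_arr F g \<cdot>\<^bsub>D\<^esub> on_arr F f)"

definition fctr_comp ::
  "('p, 'b, 'q, 'c) fctr \<Rightarrow> ('o, 'a, 'p, 'b) fctr \<Rightarrow> ('o, 'a, 'q, 'c) fctr" where
  "fctr_comp G F = Fctr (on_obj G \<circ> on_obj F) (on_arr G \<circ> on_arr F)"

datatype ('o, 'a, 'p, 'b) ntrans =
  NTrans (nsrc: "('o, 'a, 'p, 'b) fctr") (component: "'o \<Rightarrow> 'b") (ntrg: "('o, 'a, 'p, 'b) fctr")

definition is_natural :: "('o, 'a) cat \<Rightarrow> ('p, 'b) cat \<Rightarrow> ('o, 'a, 'p, 'b) ntrans \<Rightarrow> bool" where
  "is_natural C D \<eta> \<longleftrightarrow>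
     (\<forall>X\<in>Obj C. component \<eta> X \<in> hom D (on_obj (nsrc \<eta>) X) (on_obj (ntrg \<eta>) X)) \<and>
     (\<forall>f\<in>Arr C. component \<eta> (trg C f) \<cdot>\<^bsub>D\<^esub> on_arr (nsrc \<eta>) f
                = on_arr (ntrg \<eta>) f \<cdot>\<^bsub>D\<^esub> component \<eta> (src C f))"

text \<open>
  When functors and transformations serve as objects and arrows of a category they are required
  to be extensional (equal to \<^const>\<open>undefined\<close> off the domain), so that equality in the logic
  is equality of functors and transformations.
\<close>

definition functor_cat ::
  "('o, 'a) cat \<Rightarrow> ('p, 'b) cat \<Rightarrow> (('o, 'a, 'p, 'b) fctr, ('o, 'a, 'p, 'b) ntrans) cat" where
  "functor_cat C D = (let Fs = {F. is_functor C D F \<and>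
        on_obj F \<in> extensional (Obj C) \<and> on_arr F \<in> extensional (Arr C)} in
     \<lparr>Obj = Fs,
      Arr = {\<eta>. nsrc \<eta> \<in> Fs \<and> ntrg \<eta> \<in> Fs \<and> is_natural C D \<eta> \<and>
                 component \<eta> \<in> extensional (Obj C)},
      src = nsrc,
      trg = ntrg,
      ident = (\<lambda>F. NTrans F (\<lambda>X\<in>Obj C. ident D (on_obj F X)) F),
      cmp = (\<lambda>\<theta> \<eta>. NTrans (nsrc \<eta>)
               (\<lambda>X\<in>Obj C. component \<theta> X \<cdot>\<^bsub>D\<^esub> component \<eta> X) (ntrg \<theta>))\<rparr>)"


section \<open>Categories of sets and hom-functors\<close>

datatype 'x fn = Fn (fdom: "'x set") (fmap: "'x \<Rightarrow> 'x") (fcod: "'x set")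

text \<open>The category of all functions between the sets belonging to the family \<open>U\<close>.\<close>

definition set_cat :: "'x set set \<Rightarrow> ('x set, 'x fn) cat" where
  "set_cat U =
     \<lparr>Obj = U,
      Arr = {f. fdom f \<in> U \<and> fcod f \<in> U \<and> fmap f \<in> fdom f \<rightarrow>\<^sub>E fcod f},
      src = fdom,
      trg = fcod,
      ident = (\<lambda>A. Fn A (\<lambda>x\<in>A. x) A),
      cmp = (\<lambda>g f. Fn (fdom f) (\<lambda>x\<in>fdom f. fmap g (fmap f x)) (fcod g))\<rparr>"

definition small_sets :: "'u rel \<Rightarrow> ('u set, 'u fn) cat" where
  "small_sets \<kappa> = set_cat {A. |A| <o \<kappa>}"

text \<open>The covariant functor \<open>C(X,-)\<close>, and the map \<open>C(Y,-) \<rightarrow> C(X,-)\<close> induced by \<open>p : X \<rightarrow> Y\<close>.\<close>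

definition hom_functor :: "('o, 'a) cat \<Rightarrow> 'o \<Rightarrow> ('o, 'a, 'a set, 'a fn) fctr" where
  "hom_functor C X =
     Fctr (\<lambda>Y\<in>Obj C. hom C X Y)
          (\<lambda>f\<in>Arr C. Fn (hom C X (src C f)) (\<lambda>g\<in>hom C X (src C f). f \<cdot>\<^bsub>C\<^esub> g) (hom C X (trg C f)))"

definition hom_trans :: "('o, 'a) cat \<Rightarrow> 'a \<Rightarrow> ('o, 'a, 'a set, 'a fn) ntrans" where
  "hom_trans C p =
     NTrans (hom_functor C (trg C p))
       (\<lambda>Z\<in>Obj C. Fn (hom C (trg C p) Z) (\<lambda>g\<in>hom C (trg C p) Z. g \<cdot>\<^bsub>C\<^esub> p) (hom C (src C p) Z))
       (hom_functor C (src C p))"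


section \<open>Limits and colimits\<close>

definition terminal :: "('o, 'a) cat \<Rightarrow> 'o \<Rightarrow> bool" where
  "terminal C t \<longleftrightarrow> t \<in> Obj C \<and> (\<forall>X\<in>Obj C. \<exists>!f. f \<in> hom C X t)"

definition initial :: "('o, 'a) cat \<Rightarrow> 'o \<Rightarrow> bool" where
  "initial C z \<longleftrightarrow> z \<in> Obj C \<and> (\<forall>X\<in>Obj C. \<exists>!f. f \<in> hom C z X)"

definition is_iso :: "('o, 'a) cat \<Rightarrow> 'a \<Rightarrow> bool" where
  "is_iso C f \<longleftrightarrow> f \<in> Arr C \<and>
     (\<exists>g\<in>hom C (trg C f) (src C f).
        g \<cdot>\<^bsub>C\<^esub> f = ident C (src C f) \<and> f \<cdot>\<^bsub>C\<^esub> g = ident C (trg C f))"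

text \<open>\<open>is_pullback C f g p q\<close>: the square \<open>f \<cdot> p = g \<cdot> q\<close> is a pullback of \<open>f\<close> and \<open>g\<close>;
  thus \<open>p\<close> is a pullback of \<open>g\<close> along \<open>f\<close>.\<close>

definition is_pullback :: "('o, 'a) cat \<Rightarrow> 'a \<Rightarrow> 'a \<Rightarrow> 'a \<Rightarrow> 'a \<Rightarrow> bool" where
  "is_pullback C f g p q \<longleftrightarrow>
     {f, g, p, q} \<subseteq> Arr C \<and> trg C f = trg C g \<and> src C p = src C q \<and>
     trg C p = src C f \<and> trg C q = src C g \<and> f \<cdot>\<^bsub>C\<^esub> p = g \<cdot>\<^bsub>C\<^esub> q \<and>
     (\<forall>X. \<forall>x\<in>hom C X (src C f). \<forall>y\<in>hom C X (src C g). f \<cdot>\<^bsub>C\<^esub> x = g \<cdot>\<^bsub>C\<^esub> y \<longrightarrow>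
        (\<exists>!h. h \<in> hom C X (src C p) \<and> p \<cdot>\<^bsub>C\<^esub> h = x \<and> q \<cdot>\<^bsub>C\<^esub> h = y))"

definition is_coequalizer :: "('o, 'a) cat \<Rightarrow> 'a \<Rightarrow> 'a \<Rightarrow> 'a \<Rightarrow> bool" where
  "is_coequalizer C p q e \<longleftrightarrow>
     {p, q, e} \<subseteq> Arr C \<and> src C p = src C q \<and> trg C p = trg C q \<and> src C e = trg C p \<and>
     e \<cdot>\<^bsub>C\<^esub> p = e \<cdot>\<^bsub>C\<^esub> q \<and>
     (\<forall>X. \<forall>x\<in>hom C (trg C p) X. x \<cdot>\<^bsub>C\<^esub> p = x \<cdot>\<^bsub>C\<^esub> q \<longrightarrow>
        (\<exists>!h. h \<in> hom C (trg C e) X \<and> h \<cdot>\<^bsub>C\<^esub> e = x))"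

definition is_cocone ::
  "('j, 'i) cat \<Rightarrow> ('o, 'a) cat \<Rightarrow> ('j, 'i, 'o, 'a) fctr \<Rightarrow> 'o \<Rightarrow> ('j \<Rightarrow> 'a) \<Rightarrow> bool" where
  "is_cocone J C D x c \<longleftrightarrow>
     x \<in> Obj C \<and> (\<forall>j\<in>Obj J. c j \<in> hom C (on_obj D j) x) \<and>
     (\<forall>a\<in>Arr J. c (trg J a) \<cdot>\<^bsub>C\<^esub> on_arr D a = c (src J a))"

definition is_colimit ::
  "('j, 'i) cat \<Rightarrow> ('o, 'a) cat \<Rightarrow> ('j, 'i, 'o, 'a) fctr \<Rightarrow> 'o \<Rightarrow> ('j \<Rightarrow> 'a) \<Rightarrow> bool" where
  "is_colimit J C D x c \<longleftrightarrow>
     is_cocone J C D x c \<and>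
     (\<forall>y d. is_cocone J C D y d \<longrightarrow>
        (\<exists>!h. h \<in> hom C x y \<and> (\<forall>j\<in>Obj J. h \<cdot>\<^bsub>C\<^esub> c j = d j)))"


section \<open>Locally finitely presentable categories\<close>

text \<open>Small index categories are taken with objects and arrows in \<open>'u\<close>; by the size convention
  this is no restriction.\<close>

definition cocomplete :: "'u rel \<Rightarrow> ('o, 'a) cat \<Rightarrow> bool" where
  "cocomplete \<kappa> C \<longleftrightarrow>
     (\<forall>(J :: ('u, 'u) cat) D. small_category \<kappa> J \<and> is_functor J C D \<longrightarrow>
        (\<exists>x c. is_colimit J C D x c))"

definition filtered :: "('j, 'i) cat \<Rightarrow> bool" where
  "filtered J \<longleftrightarrow>
     category J \<and> Obj J \<noteq> {} \<and>
     (\<forall>i\<in>Obj J. \<forall>j\<in>Obj J. \<exists>k\<in>Obj J. hom J i k \<noteq> {} \<and> hom J j k \<noteq> {}) \<and>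
     (\<forall>a\<in>Arr J. \<forall>b\<in>Arr J. src J a = src J b \<and> trg J a = trg J b \<longrightarrow>
        (\<exists>d\<in>Arr J. src J d = trg J a \<and> d \<cdot>\<^bsub>J\<^esub> a = d \<cdot>\<^bsub>J\<^esub> b))"

text \<open>\<open>X\<close> is compact (finitely presentable) if \<open>C(X,-)\<close> preserves small filtered colimits. The
  hom-sets are sets of arrows, so they are considered in the category of all sets of arrows.\<close>

definition compact_obj :: "'u rel \<Rightarrow> ('o, 'a) cat \<Rightarrow> 'o \<Rightarrow> bool" where
  "compact_obj \<kappa> C X \<longleftrightarrow>
     X \<in> Obj C \<and>
     (\<forall>(J :: ('u, 'u) cat) D y c.
        small_category \<kappa> J \<and> filtered J \<and> is_functor J C D \<and> is_colimit J C D y c \<longrightarrow>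
        is_colimit J (set_cat UNIV) (fctr_comp (hom_functor C X) D)
          (on_obj (hom_functor C X) y) (\<lambda>j. on_arr (hom_functor C X) (c j)))"

text \<open>Smallness of the full subcategory on \<open>S\<close> bounds its hom-sets as well; for inaccessible \<open>\<kappa>\<close>
  this makes the whole category locally small.\<close>

definition locally_fin_presentable :: "'u rel \<Rightarrow> ('o, 'a) cat \<Rightarrow> bool" where
  "locally_fin_presentable \<kappa> C \<longleftrightarrow>
     category C \<and> cocomplete \<kappa> C \<and>
     (\<exists>S. (\<forall>X\<in>S. compact_obj \<kappa> C X) \<and> small_category \<kappa> (full_subcat C S) \<and>
        (\<forall>A\<in>Obj C. \<exists>(J :: ('u, 'u) cat) D c.
           small_category \<kappa> J \<and> filtered J \<and> is_functor J (full_subcat C S) D \<and>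
           is_colimit J C D A c))"


section \<open>Weak factorization systems\<close>

definition lifts_against :: "('o, 'a) cat \<Rightarrow> 'a \<Rightarrow> 'a \<Rightarrow> bool" where
  "lifts_against C l r \<longleftrightarrow>
     (\<forall>u\<in>hom C (src C l) (src C r). \<forall>v\<in>hom C (trg C l) (trg C r).
        r \<cdot>\<^bsub>C\<^esub> u = v \<cdot>\<^bsub>C\<^esub> l \<longrightarrow>
        (\<exists>d\<in>hom C (trg C l) (src C r). d \<cdot>\<^bsub>C\<^esub> l = u \<and> r \<cdot>\<^bsub>C\<^esub> d = v))"

definition rlp :: "('o, 'a) cat \<Rightarrow> 'a set \<Rightarrow> 'a set" where
  "rlp C I = {r \<in> Arr C. \<forall>l\<in>I. lifts_against C l r}"

definition llp :: "('o, 'a) cat \<Rightarrow> 'a set \<Rightarrow> 'a set" where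
  "llp C I = {l \<in> Arr C. \<forall>r\<in>I. lifts_against C l r}"

definition weak_factorization_system :: "('o, 'a) cat \<Rightarrow> 'a set \<Rightarrow> 'a set \<Rightarrow> bool" where
  "weak_factorization_system C E F \<longleftrightarrow>
     E = llp C F \<and> F = rlp C E \<and>
     (\<forall>f\<in>Arr C. \<exists>e\<in>E. \<exists>m\<in>F. trg C e = src C m \<and> f = m \<cdot>\<^bsub>C\<^esub> e)"


section \<open>Clan-algebraic categories\<close>

definition EF_category :: "'u rel \<Rightarrow> ('o, 'a) cat \<Rightarrow> 'a set \<Rightarrow> 'a set \<Rightarrow> bool" where
  "EF_category \<kappa> L E F \<longleftrightarrow>
     locally_fin_presentable \<kappa> L \<and> weak_factorization_system L E F"

definition zero_extension :: "('o, 'a) cat \<Rightarrow> 'a set \<Rightarrow> 'o \<Rightarrow> bool" where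
  "zero_extension L E A \<longleftrightarrow> A \<in> Obj L \<and> (\<exists>z f. initial L z \<and> f \<in> hom L z A \<and> f \<in> E)"

definition compact_zero_extensions :: "'u rel \<Rightarrow> ('o, 'a) cat \<Rightarrow> 'a set \<Rightarrow> 'o set" where
  "compact_zero_extensions \<kappa> L E = {A \<in> Obj L. compact_obj \<kappa> L A \<and> zero_extension L E A}"

text \<open>The comma category \<open>S \<down> A\<close> of the inclusion of the full subcategory on \<open>S\<close>: an object is an
  arrow \<open>f\<close> from an object of \<open>S\<close> to \<open>A\<close>; an arrow from \<open>f\<close> to \<open>g\<close> is a triple \<open>(f, h, g)\<close> with
  \<open>g \<cdot> h = f\<close>.\<close>

definition comma_over :: "('o, 'a) cat \<Rightarrow> 'o set \<Rightarrow> 'o \<Rightarrow> ('a, 'a \<times> 'a \<times> 'a) cat" where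
  "comma_over C S A = (let Fs = {f \<in> Arr C. src C f \<in> S \<and> trg C f = A} in
     \<lparr>Obj = Fs,
      Arr = {(f, h, g). f \<in> Fs \<and> g \<in> Fs \<and> h \<in> hom C (src C f) (src C g) \<and> g \<cdot>\<^bsub>C\<^esub> h = f},
      src = (\<lambda>(f, h, g). f),
      trg = (\<lambda>(f, h, g). g),
      ident = (\<lambda>f. (f, ident C (src C f), f)),
      cmp = (\<lambda>(g, k, l) (f, h, g'). (f, k \<cdot>\<^bsub>C\<^esub> h, l))\<rparr>)"

definition comma_proj :: "('o, 'a) cat \<Rightarrow> ('a, 'a \<times> 'a \<times> 'a, 'o, 'a) fctr" where
  "comma_proj C = Fctr (src C) (\<lambda>(f, h, g). h)"

definition dense_subcat :: "('o, 'a) cat \<Rightarrow> 'o set \<Rightarrow> bool" where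
  "dense_subcat C S \<longleftrightarrow>
     S \<subseteq> Obj C \<and> (\<forall>A\<in>Obj C. is_colimit (comma_over C S A) C (comma_proj C) A (\<lambda>f. f))"

text \<open>\<open>p, q : R \<rightarrow> A\<close> are jointly monic (that is, \<open>\<langle>p, q\<rangle> : R \<rightarrow> A \<times> A\<close> is monic) and for every
  \<open>X\<close> the resulting relation on \<open>C(X, A)\<close> is an equivalence relation.\<close>

definition equivalence_relation :: "('o, 'a) cat \<Rightarrow> 'a \<Rightarrow> 'a \<Rightarrow> bool" where
  "equivalence_relation C p q \<longleftrightarrow>
     p \<in> Arr C \<and> q \<in> Arr C \<and> src C p = src C q \<and> trg C p = trg C q \<and>
     (\<forall>X. \<forall>x\<in>hom C X (src C p). \<forall>y\<in>hom C X (src C p).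
        p \<cdot>\<^bsub>C\<^esub> x = p \<cdot>\<^bsub>C\<^esub> y \<and> q \<cdot>\<^bsub>C\<^esub> x = q \<cdot>\<^bsub>C\<^esub> y \<longrightarrow> x = y) \<and>
     (\<forall>X\<in>Obj C. equiv (hom C X (trg C p)) {(p \<cdot>\<^bsub>C\<^esub> x, q \<cdot>\<^bsub>C\<^esub> x) |x. x \<in> hom C X (src C p)})"

definition clan_algebraic :: "'u rel \<Rightarrow> ('o, 'a) cat \<Rightarrow> 'a set \<Rightarrow> 'a set \<Rightarrow> bool" where
  "clan_algebraic \<kappa> L E F \<longleftrightarrow>
     EF_category \<kappa> L E F \<and>
     \<comment> \<open>(D)\<close>
     dense_subcat L (compact_zero_extensions \<kappa> L E) \<and>
     \<comment> \<open>(CG)\<close>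
     F = rlp L {e \<in> E. src L e \<in> compact_zero_extensions \<kappa> L E \<and>
                       trg L e \<in> compact_zero_extensions \<kappa> L E} \<and>
     \<comment> \<open>(FQ)\<close>
     (\<forall>p\<in>F. \<forall>q\<in>F. equivalence_relation L p q \<longrightarrow>
        (\<exists>e. is_coequalizer L p q e \<and> is_pullback L e e p q \<and> e \<in> F))"


section \<open>Clans and their models\<close>

locale clan = category T for T :: "('o, 'a) cat" (structure) +
  fixes \<kappa> :: "'u rel" and Disp :: "'a set"
  assumes small: "small_category \<kappa> T"
    and Disp_Arr: "Disp \<subseteq> Arr T"
    and pullback_exists:
      "\<lbrakk>p \<in> Disp; f \<in> Arr T; trg T f = trg T p\<rbrakk> \<Longrightarrow> \<exists>p' f'. is_pullback T f p p' f'"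
    and pullback_Disp: "\<lbrakk>p \<in> Disp; is_pullback T f p p' f'\<rbrakk> \<Longrightarrow> p' \<in> Disp"
    and iso_Disp: "is_iso T f \<Longrightarrow> f \<in> Disp"
    and cmp_Disp: "\<lbrakk>p \<in> Disp; q \<in> Disp; src T q = trg T p\<rbrakk> \<Longrightarrow> q \<cdot> p \<in> Disp"
    and terminal_exists: "\<exists>t. terminal T t"
    and terminal_Disp: "\<lbrakk>terminal T t; f \<in> Arr T; trg T f = t\<rbrakk> \<Longrightarrow> f \<in> Disp"

definition preserves_clan_limits ::
  "'u rel \<Rightarrow> ('o, 'a) cat \<Rightarrow> 'a set \<Rightarrow> ('o, 'a, 'u set, 'u fn) fctr \<Rightarrow> bool" where
  "preserves_clan_limits \<kappa> T Disp A \<longleftrightarrow>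
     (\<forall>t. terminal T t \<longrightarrow> terminal (small_sets \<kappa>) (on_obj A t)) \<and>
     (\<forall>f p p' f'. p \<in> Disp \<and> is_pullback T f p p' f' \<longrightarrow>
        is_pullback (small_sets \<kappa>) (on_arr A f) (on_arr A p) (on_arr A p') (on_arr A f'))"

text \<open>The category of models, the full subcategory of \<open>[T, Set]\<close> on the functors preserving
  terminal objects and pullbacks of display maps.\<close>

definition Mod :: "'u rel \<Rightarrow> ('o, 'a) cat \<Rightarrow> 'a set \<Rightarrow>
    (('o, 'a, 'u set, 'u fn) fctr, ('o, 'a, 'u set, 'u fn) ntrans) cat" where
  "Mod \<kappa> T Disp =
     full_subcat (functor_cat T (small_sets \<kappa>)) {A. preserves_clan_limits \<kappa> T Disp A}"

text \<open>From here on the arrows of \<open>T\<close> are elements of \<open>'u\<close>, so that representables are set-valued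
  functors without transport along a bijection.\<close>

definition full_maps ::
  "'u rel \<Rightarrow> ('o, 'u) cat \<Rightarrow> 'u set \<Rightarrow> ('o, 'u, 'u set, 'u fn) ntrans set" where
  "full_maps \<kappa> T Disp = rlp (Mod \<kappa> T Disp) (hom_trans T ` Disp)"

definition extensions ::
  "'u rel \<Rightarrow> ('o, 'u) cat \<Rightarrow> 'u set \<Rightarrow> ('o, 'u, 'u set, 'u fn) ntrans set" where
  "extensions \<kappa> T Disp = llp (Mod \<kappa> T Disp) (full_maps \<kappa> T Disp)"

end

theory Submission
  imports Defs
begin

text \<open>
  Models are the algebras of an essentially algebraic theory whose only partial operations are the
  pairings into pullbacks of display maps. Hence a model can be built from terms modulo an
  inductively generated partial equivalence relation. A graph in the category of elements presents
  the colimit of a diagram of representables in this way; this gives all colimits, and finite graphs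
  give the finitely presentable models, because filtered colimits of models are computed pointwise.
  Adding to the terms a formal lift along display maps for every lifting problem against a map
  \<open>A \<rightarrow> B\<close> closes the small object argument in one step: the resulting model factors \<open>A \<rightarrow> B\<close> as an
  extension followed by a full map. Density, cofibrant generation and the role of \<open>H(p)\<close> follow from
  Yoneda. For an equivalence relation with full legs the pointwise quotient is already a model: the
  lifting property moves representatives into a strict pullback.
\<close>

section \<open>Small sets\<close>

text \<open>Two obstacles shape the development. A pairing into a pullback makes sense only when two
  composites are equal, so well-formed terms cannot be singled out before equality is known. Hence
  terms are raw, and one relation serves for both: its diagonal is well-formedness. For the
  factorization, the admissible lifting problems refer to values in \<open>B\<close>; these come
  from an evaluation that recurses on raw terms, so they can be stated before the relation exists,
  and since a formal lift is again a term, lifts of lifts are present from the start. The other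
  obstacle is size: \<kappa> is only regular and uncountable, so power sets and function sets of
  small sets may fail to be small. Small unions, products and sets of finite subsets are available,
  and uncountability pays for the countable union over term depths. Carriers must moreover be
  subsets of \<open>'u\<close>, which forces a coding of equivalence classes by chosen
  representatives.\<close>

locale small_sizes =
  fixes \<kappa> :: "'u rel"
  assumes size_bound: "size_bound \<kappa>"
begin

text \<open>Regularity is used in the form \<open>stable\<close>: fewer than \<kappa> sets of size
  below \<kappa> have a union below \<kappa>. The step from \<open>regularCard\<close> to
  \<open>stable\<close> wants an infinite cardinal, which \<open>natLeq <o \<kappa>\<close>
  provides.\<close>

lemma Card_order_bound: "Card_order \<kappa>"
  and stable_bound: "stable \<kappa>"
  and infinite_bound: "\<not> finite (Field \<kappa>)"
proof -
  show 1: "Card_order \<kappa>" using size_bound by (simp add: size_bound_def)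
  show 2: "\<not> finite (Field \<kappa>)"
  proof
    assume "finite (Field \<kappa>)"
    then have "|Field \<kappa>| <o natLeq" using finite_iff_ordLess_natLeq by blast
    then have "\<kappa> <o natLeq" using card_of_Field_ordIso[OF 1] ordIso_ordLess_trans ordIso_symmetric by blast
    then show False using size_bound ordLess_transitive[of \<kappa> natLeq \<kappa>] ordLess_irreflexive
      by (auto simp: size_bound_def)
  qed
  show "stable \<kappa>" using regularCard_stable[OF 1 2] size_bound by (simp add: size_bound_def)
qed

lemma small_UN: "|A| <o \<kappa> \<Longrightarrow> (\<And>a. a \<in> A \<Longrightarrow> |F a| <o \<kappa>) \<Longrightarrow> |\<Union>a\<in>A. F a| <o \<kappa>"
  by (rule stable_UNION[OF stable_bound])

lemma small_subset: "A \<subseteq> B \<Longrightarrow> |B| <o \<kappa> \<Longrightarrow> |A| <o \<kappa>"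
  using card_of_mono1 ordLeq_ordLess_trans by blast

lemma small_image: "|A| <o \<kappa> \<Longrightarrow> |f ` A| <o \<kappa>"
  using card_of_image ordLeq_ordLess_trans by blast

lemma small_countable: "|UNIV :: nat set| <o \<kappa>"
  using size_bound card_of_nat ordIso_ordLess_trans by (auto simp: size_bound_def)

lemma small_finite: assumes "finite A" shows "|A| <o \<kappa>"
proof -
  have "|A| <o natLeq" using finite_iff_ordLess_natLeq assms by blast
  then show ?thesis using size_bound ordLess_transitive by (auto simp: size_bound_def)
qed

lemma small_Un: "|A| <o \<kappa> \<Longrightarrow> |B| <o \<kappa> \<Longrightarrow> |A \<union> B| <o \<kappa>"
  using card_of_Un_ordLess_infinite_Field[OF infinite_bound Card_order_bound] .

lemma small_Sigma: assumes "|A| <o \<kappa>" "\<And>a. a \<in> A \<Longrightarrow> |F a| <o \<kappa>" shows "|Sigma A F| <o \<kappa>"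
proof -
  have "Sigma A F = (\<Union>a\<in>A. Pair a ` F a)" by auto
  then show ?thesis using small_UN[of A "\<lambda>a. Pair a ` F a"] assms small_image by metis
qed

lemma small_Times: "|A| <o \<kappa> \<Longrightarrow> |B| <o \<kappa> \<Longrightarrow> |A \<times> B| <o \<kappa>"
  by (rule small_Sigma)

lemma small_Fpow: assumes "|A| <o \<kappa>" shows "|{F. finite F \<and> F \<subseteq> A}| <o \<kappa>"
proof -
  \<comment> \<open>\<open>L n\<close> collects the sets reached by \<open>n\<close> insertions;
    repetitions are allowed, so these have at most \<open>n\<close> elements. The union over all
    \<open>n\<close> is countable, which is where uncountability of \<kappa> enters.\<close>
  define L where "L n = ((\<lambda>S. (\<Union>(x, F)\<in>A \<times> S. {insert x F})) ^^ n) {{}}" for n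
  have L: "|L n| <o \<kappa>" for n
    unfolding L_def
  proof (induction n)
    case 0 then show ?case by (simp add: small_finite)
  next
    case (Suc n)
    then show ?case unfolding funpow.simps comp_def
      by (intro small_UN small_Times assms) (auto intro: small_finite)
  qed
  have "\<exists>n. F \<in> L n" if "finite F" "F \<subseteq> A" for F
    using that
  proof (induction F)
    case empty then show ?case by (auto simp: L_def intro!: exI[of _ 0])
  next
    case (insert x F)
    then obtain n where "F \<in> L n" by auto
    then have "insert x F \<in> L (Suc n)" using insert.prems by (auto simp: L_def)
    then show ?case ..
  qed
  then have "{F. finite F \<and> F \<subseteq> A} \<subseteq> (\<Union>n. L n)" by auto
  then show ?thesis using small_subset small_UN[OF small_countable] L by blast
qed

text \<open>A small set injects into the field of \<kappa>, which lies in \<open>'u\<close>. This is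
  what lets sets of terms, germs or indices be replaced by subsets of \<open>'u\<close>, as models
  and index categories demand.\<close>

lemma small_embed: 
  assumes "|A| <o \<kappa>" obtains \<iota> :: "'b \<Rightarrow> 'u" where "inj_on \<iota> (A :: 'b set)"
proof -
  have "|A| <o |Field \<kappa>|"
    using assms Card_order_bound card_of_Field_ordIso ordIso_symmetric ordLess_ordIso_trans by blast
  then have "|A| \<le>o |Field \<kappa>|" by (rule ordLess_imp_ordLeq)
  then show thesis using that unfolding card_of_ordLeq[symmetric] by auto
qed

end

section \<open>Models as families of sets with an action\<close>

lemma homD: "f \<in> hom C X Y \<Longrightarrow> f \<in> Arr C" "f \<in> hom C X Y \<Longrightarrow> src C f = X"
    "f \<in> hom C X Y \<Longrightarrow> trg C f = Y"
  by (auto simp: hom_def)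

lemma pullbackD:
  assumes "is_pullback C f g p q"
  shows "f \<in> Arr C" "g \<in> Arr C" "p \<in> Arr C" "q \<in> Arr C" "trg C f = trg C g" "src C p = src C q"
     "trg C p = src C f" "trg C q = src C g" "f \<cdot>\<^bsub>C\<^esub> p = g \<cdot>\<^bsub>C\<^esub> q"
  using assms by (auto simp: is_pullback_def)

lemma pullback_univ:
  assumes "is_pullback C f g p q" "x \<in> hom C X (src C f)" "y \<in> hom C X (src C g)" "f \<cdot>\<^bsub>C\<^esub> x = g \<cdot>\<^bsub>C\<^esub> y"
  shows "\<exists>!h. h \<in> hom C X (src C p) \<and> p \<cdot>\<^bsub>C\<^esub> h = x \<and> q \<cdot>\<^bsub>C\<^esub> h = y"
  using assms unfolding is_pullback_def by blast

section \<open>The category of sets, read elementwise\<close>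

lemma set_cat_simps [simp]:
  "Obj (set_cat U) = U"
  "src (set_cat U) = fdom"
  "trg (set_cat U) = fcod"
  "ident (set_cat U) A = Fn A (\<lambda>x\<in>A. x) A"
  by (simp_all add: set_cat_def)

lemma set_cat_cmp: "g \<cdot>\<^bsub>set_cat U\<^esub> f = Fn (fdom f) (\<lambda>x\<in>fdom f. fmap g (fmap f x)) (fcod g)"
  by (simp add: set_cat_def)

lemma set_cat_Arr:
  "f \<in> Arr (set_cat U) \<longleftrightarrow> fdom f \<in> U \<and> fcod f \<in> U \<and> fmap f \<in> fdom f \<rightarrow>\<^sub>E fcod f"
  by (simp add: set_cat_def)

lemma set_cat_hom:
  "f \<in> hom (set_cat U) A B \<longleftrightarrow> fdom f = A \<and> fcod f = B \<and> A \<in> U \<and> B \<in> U \<and> fmap f \<in> A \<rightarrow>\<^sub>E B"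
  by (auto simp: hom_def set_cat_Arr)

lemma Fn_eqI:
  assumes "f \<in> hom (set_cat U) A B" "g \<in> hom (set_cat U) A B" "\<And>x. x \<in> A \<Longrightarrow> fmap f x = fmap g x"
  shows "f = g"
proof (rule fn.expand, intro conjI)
  show "fmap f = fmap g" using assms by (intro PiE_ext[of _ A "\<lambda>_. B"]) (auto simp: set_cat_hom)
qed (use assms in \<open>auto simp: set_cat_hom\<close>)

lemma Fn_hom: "A \<in> U \<Longrightarrow> B \<in> U \<Longrightarrow> (\<And>x. x \<in> A \<Longrightarrow> \<phi> x \<in> B) \<Longrightarrow> Fn A (restrict \<phi> A) B \<in> hom (set_cat U) A B"
  by (auto simp: set_cat_hom)

lemma set_cat_app_in: "f \<in> hom (set_cat U) A B \<Longrightarrow> x \<in> A \<Longrightarrow> fmap f x \<in> B"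
  by (auto simp: set_cat_hom)

lemma set_cat_app_cmp:
  "f \<in> hom (set_cat U) A B \<Longrightarrow> x \<in> A \<Longrightarrow> fmap (g \<cdot>\<^bsub>set_cat U\<^esub> f) x = fmap g (fmap f x)"
  by (simp add: set_cat_hom set_cat_cmp)

lemma category_set_cat: "category (set_cat U)"
proof
  show "g \<cdot>\<^bsub>set_cat U\<^esub> f \<in> hom (set_cat U) X Z"
    if "f \<in> hom (set_cat U) X Y" "g \<in> hom (set_cat U) Y Z" for f g X Y Z
    using that by (auto simp: set_cat_hom PiE_iff set_cat_cmp)
  show "ident (set_cat U) Y \<cdot>\<^bsub>set_cat U\<^esub> f = f" if "f \<in> hom (set_cat U) X Y" for f X Y
    by (rule Fn_eqI[OF _ that]) (use that in \<open>auto simp: set_cat_hom PiE_iff set_cat_cmp\<close>)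
  show "f \<cdot>\<^bsub>set_cat U\<^esub> ident (set_cat U) X = f" if "f \<in> hom (set_cat U) X Y" for f X Y
    by (rule Fn_eqI[OF _ that]) (use that in \<open>auto simp: set_cat_hom PiE_iff set_cat_cmp\<close>)
  show "h \<cdot>\<^bsub>set_cat U\<^esub> (g \<cdot>\<^bsub>set_cat U\<^esub> f) = (h \<cdot>\<^bsub>set_cat U\<^esub> g) \<cdot>\<^bsub>set_cat U\<^esub> f"
    if "f \<in> hom (set_cat U) W X" "g \<in> hom (set_cat U) X Y" "h \<in> hom (set_cat U) Y Z" for f g h W X Y Z
    using that by (auto simp: set_cat_hom set_cat_cmp intro!: restrict_ext)
qed (auto simp: set_cat_Arr set_cat_hom)

lemmas set_cat_cmp_hom = category.cmp_hom[OF category_set_cat]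

lemma set_cat_cmp_eq_iff:
  assumes "f \<in> hom (set_cat U) A B" "g \<in> hom (set_cat U) B C" "f' \<in> hom (set_cat U) A B'" "g' \<in> hom (set_cat U) B' C"
  shows "g \<cdot>\<^bsub>set_cat U\<^esub> f = g' \<cdot>\<^bsub>set_cat U\<^esub> f' \<longleftrightarrow> (\<forall>x\<in>A. fmap g (fmap f x) = fmap g' (fmap f' x))"
proof
  assume "g \<cdot>\<^bsub>set_cat U\<^esub> f = g' \<cdot>\<^bsub>set_cat U\<^esub> f'"
  then show "\<forall>x\<in>A. fmap g (fmap f x) = fmap g' (fmap f' x)"
    by (metis set_cat_app_cmp assms(1,3))
next
  assume "\<forall>x\<in>A. fmap g (fmap f x) = fmap g' (fmap f' x)"
  then show "g \<cdot>\<^bsub>set_cat U\<^esub> f = g' \<cdot>\<^bsub>set_cat U\<^esub> f'"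
    by (intro Fn_eqI[OF set_cat_cmp_hom[OF assms(1,2)] set_cat_cmp_hom[OF assms(3,4)]])
      (simp add: set_cat_app_cmp[OF assms(1)] set_cat_app_cmp[OF assms(3)])
qed

lemma set_cat_cmp_eqD:
  assumes "g \<cdot>\<^bsub>set_cat U\<^esub> f = h" "f \<in> hom (set_cat U) A B" "x \<in> A"
  shows "fmap g (fmap f x) = fmap h x"
  using set_cat_app_cmp[OF assms(2,3)] assms(1) by metis

lemma set_cat_cmp_eqI:
  assumes "f \<in> hom (set_cat U) A B" "g \<in> hom (set_cat U) B C" "h \<in> hom (set_cat U) A C"
    "\<And>x. x \<in> A \<Longrightarrow> fmap g (fmap f x) = fmap h x"
  shows "g \<cdot>\<^bsub>set_cat U\<^esub> f = h"
  by (rule Fn_eqI[OF set_cat_cmp_hom[OF assms(1,2)] assms(3)]) (simp add: set_cat_app_cmp[OF assms(1)] assms(4))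

text \<open>A one-element set in \<open>U\<close> represents elements, so testing the universal
  property against it yields the pointwise condition. Conversely, the pointwise unique elements
  assemble to the mediating function.\<close>

lemma set_pullback_iff:
  assumes u: "{u} \<in> U"
    and f: "f \<in> hom (set_cat U) X Z" and g: "g \<in> hom (set_cat U) Y Z"
    and p: "p \<in> hom (set_cat U) P X" and q: "q \<in> hom (set_cat U) P Y"
  shows "is_pullback (set_cat U) f g p q \<longleftrightarrow>
    (\<forall>z\<in>P. fmap f (fmap p z) = fmap g (fmap q z)) \<and>
    (\<forall>x\<in>X. \<forall>y\<in>Y. fmap f x = fmap g y \<longrightarrow> (\<exists>!z. z \<in> P \<and> fmap p z = x \<and> fmap q z = y))"
    (is "?L \<longleftrightarrow> ?R")
proof
  assume L: ?L
  have "\<forall>z\<in>P. fmap f (fmap p z) = fmap g (fmap q z)"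
    using pullbackD(9)[OF L] set_cat_cmp_eq_iff[OF p f q g] by simp
  moreover have "\<exists>!z. z \<in> P \<and> fmap p z = x \<and> fmap q z = y"
    if x: "x \<in> X" and y: "y \<in> Y" and xy: "fmap f x = fmap g y" for x y
  proof -
    let ?pt = "\<lambda>x A. Fn {u} (\<lambda>_\<in>{u}. x) A"
    have pt: "?pt x A \<in> hom (set_cat U) {u} A" if "x \<in> A" "A \<in> U" for x A
      using that u by (auto simp: set_cat_hom)
    have hom: "src (set_cat U) f = X" "src (set_cat U) g = Y" "src (set_cat U) p = P" "X \<in> U" "Y \<in> U" "P \<in> U"
      using f g p by (auto simp: set_cat_hom)
    have "f \<cdot>\<^bsub>set_cat U\<^esub> ?pt x X = g \<cdot>\<^bsub>set_cat U\<^esub> ?pt y Y"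
      unfolding set_cat_cmp_eq_iff[OF pt[OF x hom(4)] f pt[OF y hom(5)] g] using xy by simp
    then have ex1: "\<exists>!h. h \<in> hom (set_cat U) {u} P \<and> p \<cdot>\<^bsub>set_cat U\<^esub> h = ?pt x X \<and> 
        q \<cdot>\<^bsub>set_cat U\<^esub> h = ?pt y Y"
      using pullback_univ[OF L, unfolded hom, OF pt[OF x hom(4)] pt[OF y hom(5)]] by blast
    then obtain h where h: "h \<in> hom (set_cat U) {u} P" 
      "p \<cdot>\<^bsub>set_cat U\<^esub> h = ?pt x X" "q \<cdot>\<^bsub>set_cat U\<^esub> h = ?pt y Y" by blast
    show ?thesis
    proof (rule ex1I[of _ "fmap h u"], intro conjI)
      show "fmap h u \<in> P" using set_cat_app_in[OF h(1)] by simp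
      show "fmap p (fmap h u) = x" "fmap q (fmap h u) = y"
        using set_cat_cmp_eqD[OF h(2,1)] set_cat_cmp_eqD[OF h(3,1)] by simp_all
      fix z assume z: "z \<in> P \<and> fmap p z = x \<and> fmap q z = y"
      have "?pt z P \<in> hom (set_cat U) {u} P" using pt z hom by auto
      moreover have "p \<cdot>\<^bsub>set_cat U\<^esub> ?pt z P = ?pt x X"
        by (rule set_cat_cmp_eqI[OF _ p pt[OF x]]) (use pt hom z in auto)
      moreover have "q \<cdot>\<^bsub>set_cat U\<^esub> ?pt z P = ?pt y Y"
        by (rule set_cat_cmp_eqI[OF _ q pt[OF y]]) (use pt hom z in auto)
      ultimately have "?pt z P = h" using ex1 h by blast
      then show "z = fmap h u" by auto
    qed
  qed
  ultimately show ?R by blast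
next
  assume R: ?R
  have "\<exists>!h. h \<in> hom (set_cat U) W P \<and> p \<cdot>\<^bsub>set_cat U\<^esub> h = x \<and> q \<cdot>\<^bsub>set_cat U\<^esub> h = y"
    if x: "x \<in> hom (set_cat U) W X" and y: "y \<in> hom (set_cat U) W Y"
      and xy: "f \<cdot>\<^bsub>set_cat U\<^esub> x = g \<cdot>\<^bsub>set_cat U\<^esub> y" for W x y
  proof -
    have ex: "\<exists>!z. z \<in> P \<and> fmap p z = fmap x w \<and> fmap q z = fmap y w" if "w \<in> W" for w
      using R xy[unfolded set_cat_cmp_eq_iff[OF x f y g]] that set_cat_app_in[OF x] set_cat_app_in[OF y] by blast
    define \<phi> where "\<phi> w = (THE z. z \<in> P \<and> fmap p z = fmap x w \<and> fmap q z = fmap y w)" for w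
    have \<phi>: "\<phi> w \<in> P \<and> fmap p (\<phi> w) = fmap x w \<and> fmap q (\<phi> w) = fmap y w" if "w \<in> W" for w
      unfolding \<phi>_def by (rule theI'[OF ex[OF that]])
    let ?h = "Fn W (restrict \<phi> W) P"
    have h: "?h \<in> hom (set_cat U) W P"
      using p x \<phi> by (intro Fn_hom) (auto simp: set_cat_hom)
    show ?thesis
    proof (rule ex1I[of _ ?h], intro conjI h)
      show "p \<cdot>\<^bsub>set_cat U\<^esub> ?h = x" by (rule set_cat_cmp_eqI[OF h p x]) (use \<phi> in auto)
      show "q \<cdot>\<^bsub>set_cat U\<^esub> ?h = y" by (rule set_cat_cmp_eqI[OF h q y]) (use \<phi> in auto)
      fix k assume k: "k \<in> hom (set_cat U) W P \<and> p \<cdot>\<^bsub>set_cat U\<^esub> k = x \<and> q \<cdot>\<^bsub>set_cat U\<^esub> k = y"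
      then have k': "k \<in> hom (set_cat U) W P" "p \<cdot>\<^bsub>set_cat U\<^esub> k = x" "q \<cdot>\<^bsub>set_cat U\<^esub> k = y" by auto
      show "k = ?h"
      proof (rule Fn_eqI[OF k'(1) h])
        fix w assume w: "w \<in> W"
        have "fmap k w \<in> P \<and> fmap p (fmap k w) = fmap x w \<and> fmap q (fmap k w) = fmap y w"
          using set_cat_app_in[OF k'(1) w] set_cat_cmp_eqD[OF k'(2,1) w] set_cat_cmp_eqD[OF k'(3,1) w] by simp
        then show "fmap k w = fmap ?h w" using ex[OF w] \<phi>[OF w] w by auto
      qed
    qed
  qed
  moreover have "f \<cdot>\<^bsub>set_cat U\<^esub> p = g \<cdot>\<^bsub>set_cat U\<^esub> q"
    using R by (simp add: set_cat_cmp_eq_iff[OF p f q g])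
  moreover have "src (set_cat U) f = X" "src (set_cat U) g = Y" "src (set_cat U) p = P"
    "src (set_cat U) q = P" "trg (set_cat U) f = Z" "trg (set_cat U) g = Z" "trg (set_cat U) p = X"
    "trg (set_cat U) q = Y"
    using f g p q by (auto simp: set_cat_hom)
  ultimately show ?L using homD(1)[OF f] homD(1)[OF g] homD(1)[OF p] homD(1)[OF q]
    unfolding is_pullback_def by simp
qed

lemma set_terminal_iff:
  assumes u: "{u} \<in> U"
  shows "terminal (set_cat U) t \<longleftrightarrow> t \<in> U \<and> (\<exists>!x. x \<in> t)"
proof
  assume L: "terminal (set_cat U) t"
  then have t: "t \<in> U" and "\<exists>!h. h \<in> hom (set_cat U) {u} t" using u by (auto simp: terminal_def)
  then obtain h where h: "h \<in> hom (set_cat U) {u} t" "\<And>k. k \<in> hom (set_cat U) {u} t \<Longrightarrow> k = h" by auto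
  have "x = fmap h u" if "x \<in> t" for x
    using h(2)[of "Fn {u} (\<lambda>_\<in>{u}. x) t"] that t u by (auto simp: set_cat_hom)
  moreover have "fmap h u \<in> t" using h(1) by (auto simp: set_cat_hom)
  ultimately show "t \<in> U \<and> (\<exists>!x. x \<in> t)" using t by blast
next
  assume R: "t \<in> U \<and> (\<exists>!x. x \<in> t)"
  then obtain x where x: "t = {x}" by blast
  have "\<exists>!f. f \<in> hom (set_cat U) X t" if "X \<in> U" for X
  proof (rule ex1I[of _ "Fn X (\<lambda>_\<in>X. x) t"])
    show *: "Fn X (\<lambda>_\<in>X. x) t \<in> hom (set_cat U) X t" using that R x by (simp add: set_cat_hom)
    show "f = Fn X (\<lambda>_\<in>X. x) t" if "f \<in> hom (set_cat U) X t" for f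
      by (rule Fn_eqI[OF that *]) (use set_cat_app_in[OF that] x in auto)
  qed
  then show "terminal (set_cat U) t" using R by (simp add: terminal_def)
qed

abbreviation act :: "('o, 'a, 'x set, 'x fn) fctr \<Rightarrow> 'a \<Rightarrow> 'x \<Rightarrow> 'x" where
  "act A f \<equiv> fmap (on_arr A f)"

abbreviation app :: "('o, 'a, 'x set, 'x fn) ntrans \<Rightarrow> 'o \<Rightarrow> 'x \<Rightarrow> 'x" where
  "app \<eta> \<Gamma> \<equiv> fmap (component \<eta> \<Gamma>)"

text \<open>Everything is cut down to its domain, so the result is extensional, as objects of
  \<open>functor_cat\<close> have to be.\<close>

definition mk_functor :: "('o, 'a) cat \<Rightarrow> ('o \<Rightarrow> 'x set) \<Rightarrow> ('a \<Rightarrow> 'x \<Rightarrow> 'x) \<Rightarrow> ('o, 'a, 'x set, 'x fn) fctr" where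
  "mk_functor T P a = Fctr (\<lambda>\<Gamma>\<in>Obj T. P \<Gamma>)
     (\<lambda>f\<in>Arr T. Fn (P (src T f)) (\<lambda>x\<in>P (src T f). a f x) (P (trg T f)))"

definition mk_trans :: "('o, 'a) cat \<Rightarrow> ('o, 'a, 'x set, 'x fn) fctr \<Rightarrow> ('o, 'a, 'x set, 'x fn) fctr \<Rightarrow>
    ('o \<Rightarrow> 'x \<Rightarrow> 'x) \<Rightarrow> ('o, 'a, 'x set, 'x fn) ntrans" where
  "mk_trans T A B \<phi> =
     NTrans A (\<lambda>\<Gamma>\<in>Obj T. Fn (on_obj A \<Gamma>) (\<lambda>x\<in>on_obj A \<Gamma>. \<phi> \<Gamma> x) (on_obj B \<Gamma>)) B"

lemma category_full_subcat:
  assumes "category C" shows "category (full_subcat C S)"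
proof -
  interpret category C by fact
  have [simp]: "hom (full_subcat C S) X Y = (if X \<in> S \<and> Y \<in> S then hom C X Y else {})" for X Y
    by (auto simp: hom_def full_subcat_def)
  have [simp]: "cmp (full_subcat C S) = cmp C" "ident (full_subcat C S) = ident C"
    "src (full_subcat C S) = src C" "trg (full_subcat C S) = trg C"
    by (simp_all add: full_subcat_def)
  show ?thesis
    by unfold_locales
      (auto split: if_splits simp: ident_hom cmp_hom ident_left ident_right cmp_assoc,
       auto simp: full_subcat_def src_Obj trg_Obj ident_hom)
qed

section \<open>The category of models, read elementwise\<close>

locale clan_models = clan T \<kappa> Disp + small_sizes \<kappa>
  for T :: "('o, 'u) cat" (structure) and \<kappa> :: "'u rel" and Disp :: "'u set"
begin

abbreviation M :: "(('o, 'u, 'u set, 'u fn) fctr, ('o, 'u, 'u set, 'u fn) ntrans) cat" where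
  "M \<equiv> Mod \<kappa> T Disp"

abbreviation U :: "'u set set" where "U \<equiv> {A. |A| <o \<kappa>}"

lemma small_Obj: "|Obj T| <o \<kappa>" and small_Arr: "|Arr T| <o \<kappa>"
  using small by (auto simp: small_category_def)

lemma pt: "{u} \<in> U" by (simp add: small_finite)

lemma Mod_simps [simp]:
  "src M = nsrc" "trg M = ntrg"
  "ident M A = NTrans A (\<lambda>\<Gamma>\<in>Obj T. Fn (on_obj A \<Gamma>) (\<lambda>x\<in>on_obj A \<Gamma>. x) (on_obj A \<Gamma>)) A"
  by (simp_all add: Mod_def full_subcat_def functor_cat_def Let_def small_sets_def)

lemma Mod_cmp: "\<theta> \<cdot>\<^bsub>M\<^esub> \<eta> = NTrans (nsrc \<eta>)
   (\<lambda>\<Gamma>\<in>Obj T. component \<theta> \<Gamma> \<cdot>\<^bsub>set_cat U\<^esub> component \<eta> \<Gamma>) (ntrg \<theta>)"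
  by (simp add: Mod_def full_subcat_def functor_cat_def Let_def small_sets_def)

lemma functor_sets_iff:
  "is_functor T (small_sets \<kappa>) A \<longleftrightarrow>
    (\<forall>\<Gamma>\<in>Obj T. |on_obj A \<Gamma>| <o \<kappa>) \<and>
    (\<forall>f\<in>Arr T. on_arr A f \<in> hom (set_cat U) (on_obj A (src T f)) (on_obj A (trg T f))) \<and>
    (\<forall>\<Gamma>\<in>Obj T. \<forall>x\<in>on_obj A \<Gamma>. act A (ident T \<Gamma>) x = x) \<and>
    (\<forall>f\<in>Arr T. \<forall>g\<in>Arr T. src T g = trg T f \<longrightarrow>
       (\<forall>x\<in>on_obj A (src T f). act A (g \<cdot> f) x = act A g (act A f x)))" (is "?L \<longleftrightarrow> ?R")
proof
  assume L: ?L
  have *: "on_arr A f \<in> hom (set_cat U) (on_obj A (src T f)) (on_obj A (trg T f))" if "f \<in> Arr T" for f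
    using L that by (auto simp: is_functor_def small_sets_def)
  have "act A (ident T \<Gamma>) x = x" if "\<Gamma> \<in> Obj T" "x \<in> on_obj A \<Gamma>" for \<Gamma> x
  proof -
    have "on_arr A (ident T \<Gamma>) = Fn (on_obj A \<Gamma>) (\<lambda>x\<in>on_obj A \<Gamma>. x) (on_obj A \<Gamma>)"
      using L that by (auto simp: is_functor_def small_sets_def)
    then show ?thesis using that by simp
  qed
  moreover have "act A (g \<cdot> f) x = act A g (act A f x)"
    if "f \<in> Arr T" "g \<in> Arr T" "src T g = trg T f" "x \<in> on_obj A (src T f)" for f g x
  proof -
    have "on_arr A (g \<cdot> f) = on_arr A g \<cdot>\<^bsub>set_cat U\<^esub> on_arr A f"
      using L that by (auto simp: is_functor_def small_sets_def)
    then show ?thesis using set_cat_app_cmp[OF *[OF that(1)] that(4)] by simp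
  qed
  ultimately show ?R using L * by (auto simp: is_functor_def small_sets_def)
next
  assume R: ?R
  have "on_arr A (ident T \<Gamma>) = Fn (on_obj A \<Gamma>) (\<lambda>x\<in>on_obj A \<Gamma>. x) (on_obj A \<Gamma>)" if "\<Gamma> \<in> Obj T" for \<Gamma>
    using R ident_hom[OF that] that
    by (intro Fn_eqI[of _ U "on_obj A \<Gamma>" "on_obj A \<Gamma>"]) (auto simp: hom_def[of T] intro!: Fn_hom)
  moreover have "on_arr A (g \<cdot> f) = on_arr A g \<cdot>\<^bsub>set_cat U\<^esub> on_arr A f"
    if fg: "f \<in> Arr T" "g \<in> Arr T" "src T g = trg T f" for f g
  proof (rule Fn_eqI)
    have gf: "g \<cdot> f \<in> hom T (src T f) (trg T g)" using fg by (intro cmp_hom) (auto simp: hom_def)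
    then show "on_arr A (g \<cdot> f) \<in> hom (set_cat U) (on_obj A (src T f)) (on_obj A (trg T g))"
      using R by (auto simp: hom_def[of T])
    show "on_arr A g \<cdot>\<^bsub>set_cat U\<^esub> on_arr A f \<in> hom (set_cat U) (on_obj A (src T f)) (on_obj A (trg T g))"
      by (rule category.cmp_hom[OF category_set_cat]) (use R fg in auto)
    show "act A (g \<cdot> f) x = fmap (on_arr A g \<cdot>\<^bsub>set_cat U\<^esub> on_arr A f) x" if "x \<in> on_obj A (src T f)" for x
      using R fg that set_cat_app_cmp by metis
  qed
  ultimately show ?L using R by (auto simp: is_functor_def small_sets_def)
qed

lemma Mod_Obj_iff:
  "A \<in> Obj M \<longleftrightarrow> is_functor T (small_sets \<kappa>) A \<and> on_obj A \<in> extensional (Obj T) \<and>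
     on_arr A \<in> extensional (Arr T) \<and> preserves_clan_limits \<kappa> T Disp A"
  by (auto simp: Mod_def full_subcat_def functor_cat_def Let_def)

context
  fixes A assumes A: "A \<in> Obj M"
begin

lemma model_small: "\<Gamma> \<in> Obj T \<Longrightarrow> |on_obj A \<Gamma>| <o \<kappa>"
  and model_arr: "f \<in> Arr T \<Longrightarrow> on_arr A f \<in> hom (set_cat U) (on_obj A (src T f)) (on_obj A (trg T f))"
  and act_ident: "\<Gamma> \<in> Obj T \<Longrightarrow> x \<in> on_obj A \<Gamma> \<Longrightarrow> act A (ident T \<Gamma>) x = x"
  and act_cmp: "f \<in> Arr T \<Longrightarrow> g \<in> Arr T \<Longrightarrow> src T g = trg T f \<Longrightarrow> x \<in> on_obj A (src T f) \<Longrightarrow>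
     act A (g \<cdot> f) x = act A g (act A f x)"
  using A by (auto simp: Mod_Obj_iff functor_sets_iff)

lemma act_in: "f \<in> Arr T \<Longrightarrow> x \<in> on_obj A (src T f) \<Longrightarrow> act A f x \<in> on_obj A (trg T f)"
  using model_arr set_cat_app_in by metis

lemma model_terminal: "terminal T t \<Longrightarrow> \<exists>!x. x \<in> on_obj A t"
  using A by (auto simp: Mod_Obj_iff preserves_clan_limits_def small_sets_def set_terminal_iff[OF pt])

lemma model_pullback:
  assumes "p \<in> Disp" "is_pullback T f p p' f'" "x \<in> on_obj A (src T f)" "y \<in> on_obj A (src T p)"
    "act A f x = act A p y"
  shows "\<exists>!z. z \<in> on_obj A (src T p') \<and> act A p' z = x \<and> act A f' z = y"
proof -
  have "is_pullback (small_sets \<kappa>) (on_arr A f) (on_arr A p) (on_arr A p') (on_arr A f')"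
    using A assms by (auto simp: Mod_Obj_iff preserves_clan_limits_def)
  moreover have "on_arr A f \<in> hom (set_cat U) (on_obj A (src T f)) (on_obj A (trg T f))"
    "on_arr A p \<in> hom (set_cat U) (on_obj A (src T p)) (on_obj A (trg T f))"
    "on_arr A p' \<in> hom (set_cat U) (on_obj A (src T p')) (on_obj A (src T f))"
    "on_arr A f' \<in> hom (set_cat U) (on_obj A (src T p')) (on_obj A (src T p))"
    using pullbackD[OF assms(2)] model_arr by metis+
  ultimately show ?thesis
    using assms(3-5) set_pullback_iff[OF pt, of "on_arr A f"] by (simp add: small_sets_def)
qed

end

text \<open>Commutativity of the image of a pullback square is not among the premises: it follows
  from \<open>comp\<close>, because both composites are the action of the same arrow
  \<open>f \<cdot> p' = p \<cdot> f'\<close>.\<close>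

lemma mk_functor_model:
  assumes small: "\<And>\<Gamma>. \<Gamma> \<in> Obj T \<Longrightarrow> |P \<Gamma>| <o \<kappa>"
    and closed: "\<And>f x. f \<in> Arr T \<Longrightarrow> x \<in> P (src T f) \<Longrightarrow> a f x \<in> P (trg T f)"
    and id: "\<And>\<Gamma> x. \<Gamma> \<in> Obj T \<Longrightarrow> x \<in> P \<Gamma> \<Longrightarrow> a (ident T \<Gamma>) x = x"
    and comp: "\<And>f g x. f \<in> Arr T \<Longrightarrow> g \<in> Arr T \<Longrightarrow> src T g = trg T f \<Longrightarrow> x \<in> P (src T f) \<Longrightarrow>
      a (g \<cdot> f) x = a g (a f x)"
    and one: "\<And>t. terminal T t \<Longrightarrow> \<exists>!x. x \<in> P t"
    and pull: "\<And>f p p' f' x y. p \<in> Disp \<Longrightarrow> is_pullback T f p p' f' \<Longrightarrow> x \<in> P (src T f) \<Longrightarrow>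
      y \<in> P (src T p) \<Longrightarrow> a f x = a p y \<Longrightarrow> \<exists>!z. z \<in> P (src T p') \<and> a p' z = x \<and> a f' z = y"
  shows "mk_functor T P a \<in> Obj M"
    and "\<Gamma> \<in> Obj T \<Longrightarrow> on_obj (mk_functor T P a) \<Gamma> = P \<Gamma>"
    and "f \<in> Arr T \<Longrightarrow> x \<in> P (src T f) \<Longrightarrow> act (mk_functor T P a) f x = a f x"
proof -
  let ?A = "mk_functor T P a"
  show o: "on_obj ?A \<Gamma> = P \<Gamma>" if "\<Gamma> \<in> Obj T" for \<Gamma> using that by (simp add: mk_functor_def)
  have r: "on_arr ?A f = Fn (P (src T f)) (\<lambda>x\<in>P (src T f). a f x) (P (trg T f))" if "f \<in> Arr T" for f
    using that by (simp add: mk_functor_def)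
  then show a: "act ?A f x = a f x" if "f \<in> Arr T" "x \<in> P (src T f)" for f x using that by simp
  have "is_functor T (small_sets \<kappa>) ?A"
    unfolding functor_sets_iff
  proof (intro conjI ballI impI)
    show "on_arr ?A f \<in> hom (set_cat U) (on_obj ?A (src T f)) (on_obj ?A (trg T f))"
      if "f \<in> Arr T" for f
      using that by (simp add: r o src_Obj trg_Obj small closed Fn_hom)
    show "act ?A (ident T \<Gamma>) x = x" if "\<Gamma> \<in> Obj T" "x \<in> on_obj ?A \<Gamma>" for \<Gamma> x
      using that ident_hom[OF that(1)] by (simp add: o hom_def a id)
    show "act ?A (g \<cdot> f) x = act ?A g (act ?A f x)"
      if "f \<in> Arr T" "g \<in> Arr T" "src T g = trg T f" "x \<in> on_obj ?A (src T f)" for f g x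
      using that cmp_hom[of f "src T f" "trg T f" g "trg T g"]
      by (simp add: o src_Obj hom_def a comp closed)
  qed (simp add: o small)
  moreover have "terminal (small_sets \<kappa>) (on_obj ?A t)" if "terminal T t" for t
    using that one[OF that] small by (simp add: small_sets_def set_terminal_iff[OF pt] terminal_def[of T] o)
  moreover have "is_pullback (small_sets \<kappa>) (on_arr ?A f) (on_arr ?A p) (on_arr ?A p') (on_arr ?A f')"
    if p: "p \<in> Disp" and pb: "is_pullback T f p p' f'" for f p p' f'
  proof -
    note D = pullbackD[OF pb]
    have h: "on_arr ?A f \<in> hom (set_cat U) (P (src T f)) (P (trg T f))" if "f \<in> Arr T" for f
      unfolding r[OF that] by (intro Fn_hom) (auto simp: that small src_Obj trg_Obj closed)
    have "a f (a p' z) = a p (a f' z)" if "z \<in> P (src T p')" for z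
      using comp[of p' f z] comp[of f' p z] D that by simp
    then show ?thesis
      unfolding small_sets_def
      using set_pullback_iff[OF pt h[OF D(1)] h[OF D(2), folded D(5)] h[OF D(3), unfolded D(7)] h[OF D(4), folded D(6), unfolded D(8)]]
        pull[OF p pb] closed[OF D(3)] closed[OF D(4)] D by (simp add: a cong: conj_cong)
  qed
  moreover have "on_obj ?A \<in> extensional (Obj T)" "on_arr ?A \<in> extensional (Arr T)"
    by (simp_all add: mk_functor_def)
  ultimately show "?A \<in> Obj M"
    unfolding Mod_Obj_iff preserves_clan_limits_def by blast
qed

lemma Mod_Arr_iff: "\<eta> \<in> Arr M \<longleftrightarrow> nsrc \<eta> \<in> Obj M \<and> ntrg \<eta> \<in> Obj M \<and>
    component \<eta> \<in> extensional (Obj T) \<and> is_natural T (small_sets \<kappa>) \<eta>"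
  by (auto simp: Mod_def full_subcat_def functor_cat_def Let_def)

lemma Mod_hom_iff:
  "\<eta> \<in> hom M A B \<longleftrightarrow> A \<in> Obj M \<and> B \<in> Obj M \<and> nsrc \<eta> = A \<and> ntrg \<eta> = B \<and>
     component \<eta> \<in> extensional (Obj T) \<and>
     (\<forall>\<Gamma>\<in>Obj T. component \<eta> \<Gamma> \<in> hom (set_cat U) (on_obj A \<Gamma>) (on_obj B \<Gamma>)) \<and>
     (\<forall>f\<in>Arr T. \<forall>x\<in>on_obj A (src T f). app \<eta> (trg T f) (act A f x) = act B f (app \<eta> (src T f) x))"
  (is "?L \<longleftrightarrow> ?R")
proof -
  have "component \<eta> (trg T f) \<cdot>\<^bsub>set_cat U\<^esub> on_arr A f = on_arr B f \<cdot>\<^bsub>set_cat U\<^esub> component \<eta> (src T f) \<longleftrightarrow>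
     (\<forall>x\<in>on_obj A (src T f). app \<eta> (trg T f) (act A f x) = act B f (app \<eta> (src T f) x))" (is "?l = ?r \<longleftrightarrow> _")
    if AB: "A \<in> Obj M" "B \<in> Obj M" and "f \<in> Arr T" and
      c: "\<forall>\<Gamma>\<in>Obj T. component \<eta> \<Gamma> \<in> hom (set_cat U) (on_obj A \<Gamma>) (on_obj B \<Gamma>)" for f
  proof -
    have "component \<eta> (src T f) \<in> hom (set_cat U) (on_obj A (src T f)) (on_obj B (src T f))"
      "component \<eta> (trg T f) \<in> hom (set_cat U) (on_obj A (trg T f)) (on_obj B (trg T f))"
      using c src_Obj trg_Obj that by auto
    then show ?thesis
      using set_cat_cmp_eq_iff model_arr[OF AB(1) that(3)] model_arr[OF AB(2) that(3)] by meson
  qed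
  moreover have "?L \<longleftrightarrow> A \<in> Obj M \<and> B \<in> Obj M \<and> nsrc \<eta> = A \<and> ntrg \<eta> = B \<and>
     component \<eta> \<in> extensional (Obj T) \<and> is_natural T (small_sets \<kappa>) \<eta>"
    by (auto simp: hom_def[of M] Mod_Arr_iff)
  ultimately show ?thesis
    unfolding is_natural_def small_sets_def by (auto simp del: Mod_simps)
qed

context
  fixes \<eta> A B assumes \<eta>: "\<eta> \<in> hom M A B"
begin

lemma app_hom: "\<Gamma> \<in> Obj T \<Longrightarrow> component \<eta> \<Gamma> \<in> hom (set_cat U) (on_obj A \<Gamma>) (on_obj B \<Gamma>)"
  and app_nat: "f \<in> Arr T \<Longrightarrow> x \<in> on_obj A (src T f) \<Longrightarrow>
    app \<eta> (trg T f) (act A f x) = act B f (app \<eta> (src T f) x)"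
  and hom_Obj: "A \<in> Obj M" "B \<in> Obj M"
  and hom_ends: "nsrc \<eta> = A" "ntrg \<eta> = B"
  using \<eta> by (auto simp: Mod_hom_iff)

lemma app_in: "\<Gamma> \<in> Obj T \<Longrightarrow> x \<in> on_obj A \<Gamma> \<Longrightarrow> app \<eta> \<Gamma> x \<in> on_obj B \<Gamma>"
  using app_hom set_cat_app_in by metis

lemma app_nat': "f \<in> hom T \<Gamma> \<Delta> \<Longrightarrow> x \<in> on_obj A \<Gamma> \<Longrightarrow>
    app \<eta> \<Delta> (act A f x) = act B f (app \<eta> \<Gamma> x)"
  using app_nat by (auto simp: hom_def)

end

lemma Mod_hom_eqI:
  assumes "\<eta> \<in> hom M A B" "\<theta> \<in> hom M A B" "\<And>\<Gamma> x. \<Gamma> \<in> Obj T \<Longrightarrow> x \<in> on_obj A \<Gamma> \<Longrightarrow> app \<eta> \<Gamma> x = app \<theta> \<Gamma> x"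
  shows "\<eta> = \<theta>"
proof (rule ntrans.expand, intro conjI)
  show "component \<eta> = component \<theta>"
  proof (rule extensionalityI[of _ "Obj T"])
    fix \<Gamma> assume "\<Gamma> \<in> Obj T"
    then show "component \<eta> \<Gamma> = component \<theta> \<Gamma>" 
      using assms by (intro Fn_eqI[OF app_hom app_hom]) auto
  qed (use assms in \<open>auto simp: Mod_hom_iff\<close>)
qed (use assms in \<open>auto simp: Mod_hom_iff\<close>)

lemma mk_trans_hom:
  assumes "A \<in> Obj M" "B \<in> Obj M" 
    and "\<And>\<Gamma> x. \<Gamma> \<in> Obj T \<Longrightarrow> x \<in> on_obj A \<Gamma> \<Longrightarrow> \<phi> \<Gamma> x \<in> on_obj B \<Gamma>"
    and "\<And>f x. f \<in> Arr T \<Longrightarrow> x \<in> on_obj A (src T f) \<Longrightarrow> \<phi> (trg T f) (act A f x) = act B f (\<phi> (src T f) x)"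
  shows "mk_trans T A B \<phi> \<in> hom M A B"
    and "\<Gamma> \<in> Obj T \<Longrightarrow> x \<in> on_obj A \<Gamma> \<Longrightarrow> app (mk_trans T A B \<phi>) \<Gamma> x = \<phi> \<Gamma> x"
  using assms
  by (auto simp: Mod_hom_iff mk_trans_def model_small act_in src_Obj trg_Obj intro!: Fn_hom)

lemma app_cmp:
  assumes "\<eta> \<in> hom M A B" "\<theta> \<in> hom M B C" "\<Gamma> \<in> Obj T" "x \<in> on_obj A \<Gamma>"
  shows "app (\<theta> \<cdot>\<^bsub>M\<^esub> \<eta>) \<Gamma> x = app \<theta> \<Gamma> (app \<eta> \<Gamma> x)"
  using assms(3) set_cat_app_cmp[OF app_hom[OF assms(1,3)] assms(4)] by (simp add: Mod_cmp)

lemma app_ident: "\<Gamma> \<in> Obj T \<Longrightarrow> x \<in> on_obj A \<Gamma> \<Longrightarrow> app (ident M A) \<Gamma> x = x"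
  by simp

lemma Mod_ArrD: "\<eta> \<in> Arr M \<Longrightarrow> \<eta> \<in> hom M (nsrc \<eta>) (ntrg \<eta>)"
  by (simp add: hom_def)

lemma category_Mod: "category M"
proof -
  have c: "\<theta> \<cdot>\<^bsub>M\<^esub> \<eta> \<in> hom M X Z" if "\<eta> \<in> hom M X Y" "\<theta> \<in> hom M Y Z" for \<eta> \<theta> X Y Z
  proof -
    have "component \<theta> \<Gamma> \<cdot>\<^bsub>set_cat U\<^esub> component \<eta> \<Gamma> \<in> hom (set_cat U) (on_obj X \<Gamma>) (on_obj Z \<Gamma>)"
      if \<Gamma>: "\<Gamma> \<in> Obj T" for \<Gamma>
      using app_hom[OF \<open>\<eta> \<in> _\<close> \<Gamma>] app_hom[OF \<open>\<theta> \<in> _\<close> \<Gamma>] category.cmp_hom[OF category_set_cat] by metis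
    moreover have "app (\<theta> \<cdot>\<^bsub>M\<^esub> \<eta>) (trg T f) (act X f x) = act Z f (app (\<theta> \<cdot>\<^bsub>M\<^esub> \<eta>) (src T f) x)"
      if f: "f \<in> Arr T" "x \<in> on_obj X (src T f)" for f x
      using that \<open>\<eta> \<in> _\<close> \<open>\<theta> \<in> _\<close> hom_Obj[OF \<open>\<eta> \<in> _\<close>] src_Obj[OF f(1)] trg_Obj[OF f(1)]
      by (simp add: app_cmp act_in app_nat app_in)
    ultimately show ?thesis
      using hom_Obj[OF that(1)] hom_Obj[OF that(2)] hom_ends[OF that(1)] hom_ends[OF that(2)]
      unfolding Mod_hom_iff by (auto simp: Mod_cmp)
  qed
  have i: "ident M A \<in> hom M A A" if "A \<in> Obj M" for A
    using that by (auto simp: Mod_hom_iff model_small act_in src_Obj trg_Obj intro!: Fn_hom)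
  show ?thesis
  proof
    show "ident M X \<in> hom M X X" if "X \<in> Obj M" for X using i[OF that] .
    show "\<theta> \<cdot>\<^bsub>M\<^esub> \<eta> \<in> hom M X Z" if "\<eta> \<in> hom M X Y" "\<theta> \<in> hom M Y Z" for \<eta> \<theta> X Y Z using c[OF that] .
    show "src M f \<in> Obj M" "trg M f \<in> Obj M" if "f \<in> Arr M" for f using hom_Obj[OF Mod_ArrD[OF that]] by auto
    show "ident M Y \<cdot>\<^bsub>M\<^esub> f = f" if f: "f \<in> hom M X Y" for f X Y
      using i[of Y] hom_Obj[OF f] c[OF f, of "ident M Y" Y] 
      by (intro Mod_hom_eqI[OF _ f]) (auto simp: app_cmp[OF f i] app_in[OF f] simp del: Mod_simps(3) simp: app_ident)
    show "f \<cdot>\<^bsub>M\<^esub> ident M X = f" if f: "f \<in> hom M X Y" for f X Y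
      using i[of X] hom_Obj[OF f] c[OF _ f, of "ident M X"] 
      by (intro Mod_hom_eqI[OF _ f]) (auto simp: app_cmp[OF i f] simp del: Mod_simps(3) simp: app_ident)
    show "h \<cdot>\<^bsub>M\<^esub> (g \<cdot>\<^bsub>M\<^esub> f) = (h \<cdot>\<^bsub>M\<^esub> g) \<cdot>\<^bsub>M\<^esub> f"
      if f: "f \<in> hom M W X" and g: "g \<in> hom M X Y" and h: "h \<in> hom M Y Z" for f g h W X Y Z
      by (rule Mod_hom_eqI[OF c[OF c[OF f g] h] c[OF f c[OF g h]]])
        (simp add: app_cmp[OF c[OF f g] h] app_cmp[OF f c[OF g h]] app_cmp[OF f g] app_cmp[OF g h] app_in[OF f])
  qed
qed

sublocale Mod: category M by (rule category_Mod)

end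

section \<open>Representable models and models up to equivalence\<close>

context clan_models
begin

abbreviation H :: "'o \<Rightarrow> ('o, 'u, 'u set, 'u fn) fctr" where "H \<equiv> hom_functor T"

lemma hom_small: "|hom T X Y| <o \<kappa>"
  using small_subset[OF _ small_Arr] by (auto simp: hom_def)

lemma cmp_hom': "f \<in> Arr T \<Longrightarrow> g \<in> hom T X (src T f) \<Longrightarrow> f \<cdot> g \<in> hom T X (trg T f)"
  using cmp_hom[of g X "src T f" f "trg T f"] by (simp add: hom_def)

lemma H_eq: "H X = mk_functor T (hom T X) (\<lambda>f g. f \<cdot> g)"
  by (simp add: hom_functor_def mk_functor_def)

text \<open>The universal property of a pullback in \<open>T\<close>, read for arrows out of
  \<open>X\<close>, is literally the pullback condition on \<open>hom T X\<close>; likewise for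
  terminal objects.\<close>

lemma H_model: "X \<in> Obj T \<Longrightarrow> H X \<in> Obj M"
  and H_obj: "\<Gamma> \<in> Obj T \<Longrightarrow> on_obj (H X) \<Gamma> = hom T X \<Gamma>"
  and H_act: "f \<in> Arr T \<Longrightarrow> g \<in> hom T X (src T f) \<Longrightarrow> act (H X) f g = f \<cdot> g"
proof -
  show "H X \<in> Obj M" if X: "X \<in> Obj T"
    unfolding H_eq
  proof (rule mk_functor_model(1))
    fix f g x assume "f \<in> Arr T" "g \<in> Arr T" "src T g = trg T f" "x \<in> hom T X (src T f)"
    then show "g \<cdot> f \<cdot> x = g \<cdot> (f \<cdot> x)"
      using cmp_assoc[of x X "src T f" f "trg T f" g "trg T g"] by (simp add: hom_def)
  next
    fix f p p' f' x y
    assume "is_pullback T f p p' f'" "x \<in> hom T X (src T f)" "y \<in> hom T X (src T p)" "f \<cdot> x = p \<cdot> y"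
    then show "\<exists>!z. z \<in> hom T X (src T p') \<and> p' \<cdot> z = x \<and> f' \<cdot> z = y" by (rule pullback_univ)
  qed (use X in \<open>auto simp: hom_small cmp_hom' ident_left terminal_def\<close>)
qed (simp_all add: hom_functor_def)

text \<open>The map out of the representable that the Yoneda lemma assigns to an element
  \<open>x\<close> of \<open>A\<close> over \<Gamma>.\<close>

definition yon :: "('o, 'u, 'u set, 'u fn) fctr \<Rightarrow> 'o \<Rightarrow> 'u \<Rightarrow> ('o, 'u, 'u set, 'u fn) ntrans" where
  "yon A \<Gamma> x = mk_trans T (H \<Gamma>) A (\<lambda>\<Delta> f. act A f x)"

lemma
  assumes A: "A \<in> Obj M" and \<Gamma>: "\<Gamma> \<in> Obj T" and x: "x \<in> on_obj A \<Gamma>"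
  shows yon_hom: "yon A \<Gamma> x \<in> hom M (H \<Gamma>) A"
    and app_yon: "f \<in> hom T \<Gamma> \<Delta> \<Longrightarrow> app (yon A \<Gamma> x) \<Delta> f = act A f x"
proof -
  have 1: "act A f x \<in> on_obj A \<Delta>" if "\<Delta> \<in> Obj T" "f \<in> on_obj (H \<Gamma>) \<Delta>" for \<Delta> f
    using that x act_in[OF A, of f] by (simp add: H_obj hom_def)
  have 2: "act A (act (H \<Gamma>) f g) x = act A f (act A g x)" if "f \<in> Arr T" "g \<in> on_obj (H \<Gamma>) (src T f)" for f g
    using that x act_cmp[OF A, of g f] by (simp add: H_obj H_act src_Obj) (simp add: hom_def)
  note * = mk_trans_hom[OF H_model[OF \<Gamma>] A, of "\<lambda>\<Delta> f. act A f x", OF 1 2, folded yon_def]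
  show "yon A \<Gamma> x \<in> hom M (H \<Gamma>) A" by (rule *(1))
  show "app (yon A \<Gamma> x) \<Delta> f = act A f x" if "f \<in> hom T \<Gamma> \<Delta>"
    using that trg_Obj[of f] by (intro *(2)) (auto simp: H_obj hom_def)
qed

lemma app_yon_ident:
  assumes A: "A \<in> Obj M" and \<Gamma>: "\<Gamma> \<in> Obj T" and x: "x \<in> on_obj A \<Gamma>"
  shows "app (yon A \<Gamma> x) \<Gamma> (ident T \<Gamma>) = x"
  by (simp add: app_yon[OF assms ident_hom[OF \<Gamma>]] act_ident[OF A \<Gamma> x])

lemma app_H:
  assumes \<eta>: "\<eta> \<in> hom M (H \<Gamma>) A" and \<Gamma>: "\<Gamma> \<in> Obj T" and f: "f \<in> hom T \<Gamma> \<Delta>"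
  shows "app \<eta> \<Delta> f = act A f (app \<eta> \<Gamma> (ident T \<Gamma>))"
  using app_nat'[OF \<eta> f, of "ident T \<Gamma>"] f ident_hom[OF \<Gamma>] \<Gamma>
  by (simp add: H_obj H_act homD[OF f] ident_right[OF f])

text \<open>By naturality a map out of a representable sends \<open>f\<close> to the action of
  \<open>f\<close> on its value at the identity, so that single value determines it.\<close>

lemma yon_eqI:
  assumes "\<eta> \<in> hom M (H \<Gamma>) A" "\<theta> \<in> hom M (H \<Gamma>) A" and \<Gamma>: "\<Gamma> \<in> Obj T"
    and "app \<eta> \<Gamma> (ident T \<Gamma>) = app \<theta> \<Gamma> (ident T \<Gamma>)"
  shows "\<eta> = \<theta>"
  by (rule Mod_hom_eqI[OF assms(1,2)]) (simp add: H_obj app_H[OF assms(1) \<Gamma>] app_H[OF assms(2) \<Gamma>] assms(4))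

lemma app_ident_H_in: "\<eta> \<in> hom M (H \<Gamma>) A \<Longrightarrow> \<Gamma> \<in> Obj T \<Longrightarrow> app \<eta> \<Gamma> (ident T \<Gamma>) \<in> on_obj A \<Gamma>"
  using app_in ident_hom H_obj by metis

lemma
  assumes p: "p \<in> hom T X Y"
  shows hom_trans_hom: "hom_trans T p \<in> hom M (H Y) (H X)"
    and app_hom_trans: "g \<in> hom T Y Z \<Longrightarrow> app (hom_trans T p) Z g = g \<cdot> p"
proof -
  have XY: "X \<in> Obj T" "Y \<in> Obj T" using p src_Obj trg_Obj by (auto simp: hom_def)
  have eq: "hom_trans T p = mk_trans T (H Y) (H X) (\<lambda>Z g. g \<cdot> p)"
    using p by (auto simp: hom_trans_def mk_trans_def hom_def H_obj intro!: restrict_ext)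
  note * = mk_trans_hom[OF H_model[OF XY(2)] H_model[OF XY(1)], of "\<lambda>Z g. g \<cdot> p", folded eq]
  have 1: "g \<cdot> p \<in> on_obj (H X) Z" if "Z \<in> Obj T" "g \<in> on_obj (H Y) Z" for Z g
    using that cmp_hom[OF p] by (simp add: H_obj)
  have 2: "act (H Y) f g \<cdot> p = act (H X) f (g \<cdot> p)" if "f \<in> Arr T" "g \<in> on_obj (H Y) (src T f)" for f g
    using that cmp_hom[OF p] cmp_assoc[OF p, of g "src T f" f "trg T f"] 
    by (simp add: H_obj H_act src_Obj) (simp add: hom_def)
  show "hom_trans T p \<in> hom M (H Y) (H X)" by (rule *(1)[OF 1 2])
  show "app (hom_trans T p) Z g = g \<cdot> p" if "g \<in> hom T Y Z"
    using that trg_Obj[of g] by (intro *(2)[OF 1 2]) (auto simp: H_obj hom_def)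
qed

text \<open>Yoneda turns a square from \<open>hom_trans T p\<close> to \<open>r\<close> into a pair
  of elements. As \<open>H\<close> is contravariant, \<open>hom_trans T p\<close> runs from
  \<open>H Y\<close> to \<open>H X\<close>; so the map into \<open>A\<close> is an element
  \<open>a\<close> over \<open>Y\<close> and the map into \<open>B\<close> an element
  \<open>b\<close> over \<open>X\<close>.\<close>

lemma lifts_against_hom_trans_iff:
  assumes r: "r \<in> hom M A B" and p: "p \<in> hom T X Y"
  shows "lifts_against M (hom_trans T p) r \<longleftrightarrow>
    (\<forall>a\<in>on_obj A Y. \<forall>b\<in>on_obj B X. app r Y a = act B p b \<longrightarrow> (\<exists>c\<in>on_obj A X. act A p c = a \<and> app r X c = b))"
    (is "?L \<longleftrightarrow> ?R")
proof -
  note AB = hom_Obj[OF r] and pT = hom_trans_hom[OF p]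
  have pA: "p \<in> Arr T" and XY: "X \<in> Obj T" "Y \<in> Obj T" using p src_Obj trg_Obj by (auto simp: hom_def)
  have ends: "src M (hom_trans T p) = H Y" "trg M (hom_trans T p) = H X" "src M r = A" "trg M r = B"
    using hom_ends[OF pT] hom_ends[OF r] by auto
  \<comment> \<open>\<open>comm\<close>, \<open>comm2\<close> and \<open>comm3\<close> translate
    commutativity of the square and of its two triangles into equations between values at
    identities.\<close>
  have comm: "r \<cdot>\<^bsub>M\<^esub> u = v \<cdot>\<^bsub>M\<^esub> hom_trans T p \<longleftrightarrow>
      app r Y (app u Y (ident T Y)) = act B p (app v X (ident T X))"
    if u: "u \<in> hom M (H Y) A" and v: "v \<in> hom M (H X) B" for u v
  proof -
    have "app (r \<cdot>\<^bsub>M\<^esub> u) Y (ident T Y) = app r Y (app u Y (ident T Y))"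
      using app_cmp[OF u r XY(2)] ident_hom[OF XY(2)] by (simp add: H_obj XY)
    moreover have "app (v \<cdot>\<^bsub>M\<^esub> hom_trans T p) Y (ident T Y) = act B p (app v X (ident T X))"
      using app_cmp[OF pT v XY(2)] ident_hom[OF XY(2)] 
      by (simp add: H_obj XY app_hom_trans[OF p] ident_left[OF p] app_H[OF v XY(1) p])
    ultimately show ?thesis
      using yon_eqI[OF Mod.cmp_hom[OF u r] Mod.cmp_hom[OF pT v] XY(2)] by auto
  qed
  have comm2: "d \<cdot>\<^bsub>M\<^esub> hom_trans T p = u \<longleftrightarrow> act A p (app d X (ident T X)) = app u Y (ident T Y)"
    if u: "u \<in> hom M (H Y) A" and d: "d \<in> hom M (H X) A" for u d
  proof -
    have "app (d \<cdot>\<^bsub>M\<^esub> hom_trans T p) Y (ident T Y) = act A p (app d X (ident T X))"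
      using app_cmp[OF pT d XY(2)] ident_hom[OF XY(2)] 
      by (simp add: H_obj XY app_hom_trans[OF p] ident_left[OF p] app_H[OF d XY(1) p])
    then show ?thesis using yon_eqI[OF Mod.cmp_hom[OF pT d] u XY(2)] by auto
  qed
  have comm3: "r \<cdot>\<^bsub>M\<^esub> d = v \<longleftrightarrow> app r X (app d X (ident T X)) = app v X (ident T X)"
    if v: "v \<in> hom M (H X) B" and d: "d \<in> hom M (H X) A" for v d
  proof -
    have "app (r \<cdot>\<^bsub>M\<^esub> d) X (ident T X) = app r X (app d X (ident T X))"
      using app_cmp[OF d r XY(1)] ident_hom[OF XY(1)] by (simp add: H_obj XY)
    then show ?thesis using yon_eqI[OF Mod.cmp_hom[OF d r] v XY(1)] by auto
  qed
  show ?thesis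
  proof
    assume L: ?L
    show ?R
    proof (intro ballI impI)
      fix a b assume a: "a \<in> on_obj A Y" and b: "b \<in> on_obj B X" and ab: "app r Y a = act B p b"
      note u = yon_hom[OF AB(1) XY(2) a] and v = yon_hom[OF AB(2) XY(1) b]
      have "r \<cdot>\<^bsub>M\<^esub> yon A Y a = yon B X b \<cdot>\<^bsub>M\<^esub> hom_trans T p"
        unfolding comm[OF u v] using ab a b AB XY by (simp add: app_yon_ident)
      then obtain d where d: "d \<in> hom M (H X) A" "d \<cdot>\<^bsub>M\<^esub> hom_trans T p = yon A Y a" "r \<cdot>\<^bsub>M\<^esub> d = yon B X b"
        using L[unfolded lifts_against_def ends] u v by blast
      show "\<exists>c\<in>on_obj A X. act A p c = a \<and> app r X c = b"
        using d(2,3) app_ident_H_in[OF d(1) XY(1)] a b AB XY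
        unfolding comm2[OF u d(1)] comm3[OF v d(1)] by (auto simp: app_yon_ident)
    qed
  next
    assume R: ?R
    show ?L
      unfolding lifts_against_def ends
    proof (intro ballI impI)
      fix u v assume u: "u \<in> hom M (H Y) A" and v: "v \<in> hom M (H X) B" and "r \<cdot>\<^bsub>M\<^esub> u = v \<cdot>\<^bsub>M\<^esub> hom_trans T p"
      then obtain c where c: "c \<in> on_obj A X" "act A p c = app u Y (ident T Y)" "app r X c = app v X (ident T X)"
        using R comm[OF u v] app_ident_H_in[OF u XY(2)] app_ident_H_in[OF v XY(1)] by metis
      note d = yon_hom[OF AB(1) XY(1) c(1)]
      show "\<exists>d\<in>hom M (H X) A. d \<cdot>\<^bsub>M\<^esub> hom_trans T p = u \<and> r \<cdot>\<^bsub>M\<^esub> d = v"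
        by (rule bexI[OF _ d]) (simp add: comm2[OF u d] comm3[OF v d] app_yon_ident AB XY c)
    qed
  qed
qed

text \<open>Fullness means that the naturality squares of \<open>r\<close> at display maps are weak
  pullbacks. Lifting problems are constructed and solved in this form later on.\<close>

lemma full_maps_iff:
  assumes r: "r \<in> hom M A B"
  shows "r \<in> full_maps \<kappa> T Disp \<longleftrightarrow> (\<forall>p\<in>Disp. \<forall>a\<in>on_obj A (trg T p). \<forall>b\<in>on_obj B (src T p).
    app r (trg T p) a = act B p b \<longrightarrow> (\<exists>c\<in>on_obj A (src T p). act A p c = a \<and> app r (src T p) c = b))"
proof -
  have "p \<in> hom T (src T p) (trg T p)" if "p \<in> Disp" for p using that Disp_Arr by (auto simp: hom_def)
  then have "lifts_against M (hom_trans T p) r \<longleftrightarrow> (\<forall>a\<in>on_obj A (trg T p). \<forall>b\<in>on_obj B (src T p).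
    app r (trg T p) a = act B p b \<longrightarrow> (\<exists>c\<in>on_obj A (src T p). act A p c = a \<and> app r (src T p) c = b))"
    if "p \<in> Disp" for p
    using that by (intro lifts_against_hom_trans_iff[OF r]) auto
  then show ?thesis
    using homD(1)[OF r] by (simp add: full_maps_def rlp_def)
qed

end

text \<open>A model presented by a partial equivalence relation \<open>E \<Gamma>\<close> on codes for the elements over
  \<open>\<Gamma>\<close>, whose clan limits are only required up to \<open>E\<close>.\<close>

locale setoid_model = clan_models T \<kappa> Disp
  for T :: "('o, 'u) cat" (structure) and \<kappa> :: "'u rel" and Disp :: "'u set" +
  fixes E :: "'o \<Rightarrow> 'e \<Rightarrow> 'e \<Rightarrow> bool" and a :: "'u \<Rightarrow> 'e \<Rightarrow> 'e"
  assumes E_sym: "\<Gamma> \<in> Obj T \<Longrightarrow> E \<Gamma> x y \<Longrightarrow> E \<Gamma> y x"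
    and E_trans: "\<Gamma> \<in> Obj T \<Longrightarrow> E \<Gamma> x y \<Longrightarrow> E \<Gamma> y z \<Longrightarrow> E \<Gamma> x z"
    and E_small: "\<Gamma> \<in> Obj T \<Longrightarrow> |{x. E \<Gamma> x x}| <o \<kappa>"
    and E_act: "f \<in> Arr T \<Longrightarrow> E (src T f) x y \<Longrightarrow> E (trg T f) (a f x) (a f y)"
    and E_ident: "\<Gamma> \<in> Obj T \<Longrightarrow> E \<Gamma> x x \<Longrightarrow> E \<Gamma> (a (ident T \<Gamma>) x) x"
    and E_cmp: "f \<in> Arr T \<Longrightarrow> g \<in> Arr T \<Longrightarrow> src T g = trg T f \<Longrightarrow> E (src T f) x x \<Longrightarrow>
      E (trg T g) (a (g \<cdot> f) x) (a g (a f x))"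
    and E_terminal: "terminal T t \<Longrightarrow> (\<exists>x. E t x x) \<and> (\<forall>x y. E t x x \<longrightarrow> E t y y \<longrightarrow> E t x y)"
    and E_pullback: "p \<in> Disp \<Longrightarrow> is_pullback T f p p' f' \<Longrightarrow> E (src T f) x x \<Longrightarrow> E (src T p) y y \<Longrightarrow>
      E (trg T f) (a f x) (a p y) \<Longrightarrow>
      \<exists>z. E (src T p') z z \<and> E (src T f) (a p' z) x \<and> E (src T p) (a f' z) y"
    and E_joint: "p \<in> Disp \<Longrightarrow> is_pullback T f p p' f' \<Longrightarrow> E (src T p') x x \<Longrightarrow> E (src T p') y y \<Longrightarrow>
      E (src T f) (a p' x) (a p' y) \<Longrightarrow> E (src T p) (a f' x) (a f' y) \<Longrightarrow> E (src T p') x y"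
begin

definition code :: "'o \<Rightarrow> 'e \<Rightarrow> 'u" where
  "code \<Gamma> = (SOME \<iota>. inj_on \<iota> {x. E \<Gamma> x x})"

text \<open>A class would be a set of codes and not an element of \<open>'u\<close>, so it is
  replaced by the image of a chosen member. The choice is made from the predicate
  \<open>E \<Gamma> x\<close>, which is the same for all members of a class, hence
  \<open>SOME\<close> returns the same one.\<close>

definition cls :: "'o \<Rightarrow> 'e \<Rightarrow> 'u" where
  "cls \<Gamma> x = code \<Gamma> (SOME y. E \<Gamma> x y)"

definition rep :: "'o \<Rightarrow> 'u \<Rightarrow> 'e" where
  "rep \<Gamma> y = (SOME x. E \<Gamma> x x \<and> cls \<Gamma> x = y)"

definition quot :: "('o, 'u, 'u set, 'u fn) fctr" where
  "quot = mk_functor T (\<lambda>\<Gamma>. cls \<Gamma> ` {x. E \<Gamma> x x}) (\<lambda>f y. cls (trg T f) (a f (rep (src T f) y)))"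

lemma code_inj: "\<Gamma> \<in> Obj T \<Longrightarrow> inj_on (code \<Gamma>) {x. E \<Gamma> x x}"
  unfolding code_def using small_embed[OF E_small] by (metis someI_ex)

lemma E_refl: "\<Gamma> \<in> Obj T \<Longrightarrow> E \<Gamma> x y \<Longrightarrow> E \<Gamma> x x \<and> E \<Gamma> y y"
  using E_sym E_trans by metis

lemma cls_eq_iff:
  assumes \<Gamma>: "\<Gamma> \<in> Obj T" and "E \<Gamma> x x" "E \<Gamma> y y"
  shows "cls \<Gamma> x = cls \<Gamma> y \<longleftrightarrow> E \<Gamma> x y"
proof -
  have x: "E \<Gamma> x (SOME z. E \<Gamma> x z)" and y: "E \<Gamma> y (SOME z. E \<Gamma> y z)"
    using assms by (meson someI)+
  have "cls \<Gamma> x = cls \<Gamma> y \<longleftrightarrow> (SOME z. E \<Gamma> x z) = (SOME z. E \<Gamma> y z)"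
    unfolding cls_def using inj_on_eq_iff[OF code_inj[OF \<Gamma>]] E_refl[OF \<Gamma> x] E_refl[OF \<Gamma> y] by simp
  moreover have "E \<Gamma> x = E \<Gamma> y" if "E \<Gamma> x y"
    using that E_trans[OF \<Gamma>] E_sym[OF \<Gamma>] by (intro ext) metis
  moreover have "E \<Gamma> x y" if "(SOME z. E \<Gamma> x z) = (SOME z. E \<Gamma> y z)"
    using that x y E_trans[OF \<Gamma>] E_sym[OF \<Gamma>] by metis
  ultimately show ?thesis by metis
qed

lemma cls_cong: "\<Gamma> \<in> Obj T \<Longrightarrow> E \<Gamma> x y \<Longrightarrow> cls \<Gamma> x = cls \<Gamma> y"
  using cls_eq_iff E_refl by blast

lemma rep_cls:
  assumes \<Gamma>: "\<Gamma> \<in> Obj T" and x: "E \<Gamma> x x"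
  shows "E \<Gamma> (rep \<Gamma> (cls \<Gamma> x)) x"
proof -
  have "E \<Gamma> (rep \<Gamma> (cls \<Gamma> x)) (rep \<Gamma> (cls \<Gamma> x)) \<and> cls \<Gamma> (rep \<Gamma> (cls \<Gamma> x)) = cls \<Gamma> x"
    unfolding rep_def by (rule someI) (use x in auto)
  then show ?thesis using cls_eq_iff[OF \<Gamma> _ x] by auto
qed

lemma cls_rep_act:
  assumes f: "f \<in> Arr T" and x: "E (src T f) x x"
  shows "cls (trg T f) (a f (rep (src T f) (cls (src T f) x))) = cls (trg T f) (a f x)"
  using E_act[OF f rep_cls[OF src_Obj[OF f] x]] cls_eq_iff[OF trg_Obj[OF f]] E_refl[OF trg_Obj[OF f]] by metis

text \<open>Passing to classes makes the conditions up to \<open>E\<close> strict: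
  \<open>E_pullback\<close> gives existence of the element over a pullback, \<open>E_joint\<close>
  its uniqueness.\<close>

lemma quot_model: "quot \<in> Obj M"
  and quot_obj: "\<Gamma> \<in> Obj T \<Longrightarrow> on_obj quot \<Gamma> = cls \<Gamma> ` {x. E \<Gamma> x x}"
  and quot_act: "f \<in> Arr T \<Longrightarrow> E (src T f) x x \<Longrightarrow> act quot f (cls (src T f) x) = cls (trg T f) (a f x)"
proof -
  let ?P = "\<lambda>\<Gamma>. cls \<Gamma> ` {x. E \<Gamma> x x}" and ?a = "\<lambda>f y. cls (trg T f) (a f (rep (src T f) y))"
  have a: "?a f (cls (src T f) x) = cls (trg T f) (a f x)" if "f \<in> Arr T" "E (src T f) x x" for f x
    by (rule cls_rep_act[OF that])
  show "quot \<in> Obj M"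
    unfolding quot_def
  proof (rule mk_functor_model(1))
    show "|?P \<Gamma>| <o \<kappa>" if "\<Gamma> \<in> Obj T" for \<Gamma> using small_image[OF E_small[OF that]] .
    show "?a f y \<in> ?P (trg T f)" if "f \<in> Arr T" "y \<in> ?P (src T f)" for f y
      using that a E_act by force
    show "?a (ident T \<Gamma>) y = y" if \<Gamma>: "\<Gamma> \<in> Obj T" and "y \<in> ?P \<Gamma>" for \<Gamma> y
    proof -
      obtain x where x: "y = cls \<Gamma> x" "E \<Gamma> x x" using \<open>y \<in> _\<close> by auto
      have i: "ident T \<Gamma> \<in> Arr T" "src T (ident T \<Gamma>) = \<Gamma>" "trg T (ident T \<Gamma>) = \<Gamma>"
        using ident_hom[OF \<Gamma>] by (auto simp: hom_def)
      show ?thesis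
        using a[of "ident T \<Gamma>" x] i x E_ident[OF \<Gamma> x(2)] cls_eq_iff[OF \<Gamma>] E_refl[OF \<Gamma>] by auto
    qed
    show "?a (g \<cdot> f) y = ?a g (?a f y)"
      if fg: "f \<in> Arr T" "g \<in> Arr T" "src T g = trg T f" and "y \<in> ?P (src T f)" for f g y
    proof -
      obtain x where x: "y = cls (src T f) x" "E (src T f) x x" using \<open>y \<in> _\<close> by auto
      have gf: "g \<cdot> f \<in> Arr T" "src T (g \<cdot> f) = src T f" "trg T (g \<cdot> f) = trg T g"
        using cmp_hom[of f "src T f" "trg T f" g "trg T g"] fg by (auto simp: hom_def)
      have "?a (g \<cdot> f) y = cls (trg T g) (a g (a f x))"
        using a[of "g \<cdot> f" x] gf x E_cmp[OF fg x(2)] cls_eq_iff[OF trg_Obj[OF fg(2)]] 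
          E_refl[OF trg_Obj[OF fg(2)]] by auto
      also have "\<dots> = ?a g (?a f y)" 
        using a[OF fg(1) x(2)] a[OF fg(2), of "a f x"] E_act[OF fg(1) x(2)] fg(3) x(1) by simp
      finally show ?thesis .
    qed
    show "\<exists>!x. x \<in> ?P t" if "terminal T t" for t
    proof -
      have t: "t \<in> Obj T" using that by (simp add: terminal_def)
      have E: "\<exists>x. E t x x" "\<And>x y. E t x x \<Longrightarrow> E t y y \<Longrightarrow> E t x y" using E_terminal[OF that] by auto
      then obtain x where x: "E t x x" by blast
      have "cls t z = cls t x" if "E t z z" for z
        using cls_eq_iff[OF t that x] E(2)[OF that x] by simp
      then have "?P t = {cls t x}" using x by blast
      then show ?thesis by simp
    qed
    show "\<exists>!z. z \<in> ?P (src T p') \<and> ?a p' z = x \<and> ?a f' z = y"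
      if p: "p \<in> Disp" and pb: "is_pullback T f p p' f'" and x: "x \<in> ?P (src T f)" 
        and y: "y \<in> ?P (src T p)" and xy: "?a f x = ?a p y" for f p p' f' x y
    proof -
      note D = pullbackD[OF pb]
      obtain x' where x': "x = cls (src T f) x'" "E (src T f) x' x'" using x by auto
      obtain y' where y': "y = cls (src T p) y'" "E (src T p) y' y'" using y by auto
      have X: "src T f \<in> Obj T" and Y: "src T p \<in> Obj T" and P: "src T p' \<in> Obj T" and Z: "trg T f \<in> Obj T"
        using D src_Obj trg_Obj by auto
      have "cls (trg T f) (a f x') = cls (trg T f) (a p y')"
        using xy a[OF D(1) x'(2)] a[OF D(2) y'(2)] unfolding x'(1) y'(1) D(5) by simp
      then have "E (trg T f) (a f x') (a p y')"
        using cls_eq_iff[OF Z E_act[OF D(1) x'(2)] E_act[OF D(2) y'(2), folded D(5)]] by simp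
      from E_pullback[OF p pb x'(2) y'(2) this] obtain z where
        z: "E (src T p') z z" "E (src T f) (a p' z) x'" "E (src T p) (a f' z) y'" by blast
      have eq1: "?a p' (cls (src T p') w) = cls (src T f) (a p' w)" if "E (src T p') w w" for w
        using a[OF D(3) that] unfolding D(7) .
      have eq2: "?a f' (cls (src T p') w) = cls (src T p) (a f' w)" if "E (src T p') w w" for w
        using a[OF D(4) that[unfolded D(6)]] unfolding D(6,8) .
      show ?thesis
      proof (rule ex1I[of _ "cls (src T p') z"], intro conjI)
        show "cls (src T p') z \<in> ?P (src T p')" using z by blast
        show "?a p' (cls (src T p') z) = x" unfolding eq1[OF z(1)] x'(1) by (rule cls_cong[OF X z(2)])
        show "?a f' (cls (src T p') z) = y" unfolding eq2[OF z(1)] y'(1) by (rule cls_cong[OF Y z(3)])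
        fix w assume w: "w \<in> ?P (src T p') \<and> ?a p' w = x \<and> ?a f' w = y"
        then obtain v where v: "w = cls (src T p') v" "E (src T p') v v" by blast
        have "cls (src T f) (a p' v) = cls (src T f) x'" using w eq1[OF v(2)] unfolding v(1) x'(1) by simp
        then have "E (src T f) (a p' v) x'"
          using cls_eq_iff[OF X E_act[OF D(3) v(2), unfolded D(7)] x'(2)] by blast
        then have 1: "E (src T f) (a p' v) (a p' z)"
          using z E_sym[OF X] E_trans[OF X] by blast
        have "cls (src T p) (a f' v) = cls (src T p) y'" using w eq2[OF v(2)] unfolding v(1) y'(1) by simp
        then have "E (src T p) (a f' v) y'"
          using cls_eq_iff[OF Y E_act[OF D(4) v(2)[unfolded D(6)], unfolded D(8)] y'(2)] by blast
        then have 2: "E (src T p) (a f' v) (a f' z)"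
          using z E_sym[OF Y] E_trans[OF Y] by blast
        show "w = cls (src T p') z"
          unfolding v(1) by (rule cls_cong[OF P E_joint[OF p pb v(2) z(1) 1 2]])
      qed
    qed
  qed
  show "on_obj quot \<Gamma> = ?P \<Gamma>" if "\<Gamma> \<in> Obj T" using that by (simp add: quot_def mk_functor_def)
  show "act quot f (cls (src T f) x) = cls (trg T f) (a f x)" if "f \<in> Arr T" "E (src T f) x x"
    using a[OF that] that by (simp add: quot_def mk_functor_def)
qed

lemma cls_in: "\<Gamma> \<in> Obj T \<Longrightarrow> E \<Gamma> x x \<Longrightarrow> cls \<Gamma> x \<in> on_obj quot \<Gamma>"
  by (simp add: quot_obj)

lemma quot_cases:
  assumes "\<Gamma> \<in> Obj T" "y \<in> on_obj quot \<Gamma>" obtains x where "E \<Gamma> x x" "y = cls \<Gamma> x"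
  using assms by (auto simp: quot_obj)

text \<open>\<phi> is given on codes. Composed with the choice \<open>rep\<close> it becomes a
  function on classes, and the choice is harmless because the representative of a class is
  equivalent to each of its members.\<close>

lemma quot_hom:
  assumes B: "B \<in> Obj M"
    and \<phi>E: "\<And>\<Gamma> x y. \<Gamma> \<in> Obj T \<Longrightarrow> E \<Gamma> x y \<Longrightarrow> \<phi> \<Gamma> x = \<phi> \<Gamma> y"
    and \<phi>B: "\<And>\<Gamma> x. \<Gamma> \<in> Obj T \<Longrightarrow> E \<Gamma> x x \<Longrightarrow> \<phi> \<Gamma> x \<in> on_obj B \<Gamma>"
    and \<phi>a: "\<And>f x. f \<in> Arr T \<Longrightarrow> E (src T f) x x \<Longrightarrow> \<phi> (trg T f) (a f x) = act B f (\<phi> (src T f) x)"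
  obtains h where "h \<in> hom M quot B" "\<And>\<Gamma> x. \<Gamma> \<in> Obj T \<Longrightarrow> E \<Gamma> x x \<Longrightarrow> app h \<Gamma> (cls \<Gamma> x) = \<phi> \<Gamma> x"
proof -
  define \<psi> where "\<psi> \<Gamma> y = \<phi> \<Gamma> (rep \<Gamma> y)" for \<Gamma> y
  have \<psi>: "\<psi> \<Gamma> (cls \<Gamma> x) = \<phi> \<Gamma> x" if "\<Gamma> \<in> Obj T" "E \<Gamma> x x" for \<Gamma> x
    unfolding \<psi>_def using \<phi>E[OF that(1) rep_cls[OF that]] .
  have 1: "\<psi> \<Gamma> y \<in> on_obj B \<Gamma>" if "\<Gamma> \<in> Obj T" "y \<in> on_obj quot \<Gamma>" for \<Gamma> y
    using quot_cases[OF that] \<psi> \<phi>B that(1) by metis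
  have 2: "\<psi> (trg T f) (act quot f y) = act B f (\<psi> (src T f) y)"
    if f: "f \<in> Arr T" and y: "y \<in> on_obj quot (src T f)" for f y
  proof -
    obtain x where x: "E (src T f) x x" "y = cls (src T f) x" by (rule quot_cases[OF src_Obj[OF f] y])
    then show ?thesis using f src_Obj trg_Obj E_act[OF f x(1)] by (simp add: quot_act \<psi> \<phi>a)
  qed
  have "mk_trans T quot B \<psi> \<in> hom M quot B" by (rule mk_trans_hom(1)[OF quot_model B 1 2])
  moreover have "app (mk_trans T quot B \<psi>) \<Gamma> y = \<psi> \<Gamma> y" if "\<Gamma> \<in> Obj T" "y \<in> on_obj quot \<Gamma>" for \<Gamma> y
    by (rule mk_trans_hom(2)[OF quot_model B 1 2 that])
  ultimately show thesis using that cls_in \<psi> by metis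
qed

lemma quot_hom_eqI:
  assumes "h \<in> hom M quot B" "k \<in> hom M quot B"
    and "\<And>\<Gamma> x. \<Gamma> \<in> Obj T \<Longrightarrow> E \<Gamma> x x \<Longrightarrow> app h \<Gamma> (cls \<Gamma> x) = app k \<Gamma> (cls \<Gamma> x)"
  shows "h = k"
  by (rule Mod_hom_eqI[OF assms(1,2)]) (metis assms(3) quot_cases)

end

section \<open>Term models\<close>

lemma ex1_eqD: "\<exists>!z. P z \<Longrightarrow> P x \<Longrightarrow> P y \<Longrightarrow> x = y"
  by blast

text \<open>Raw terms carry no sort, and nothing ties the arrows in \<open>App\<close> and
  \<open>Pull\<close> to their arguments. \<open>Pull\<close> records all four sides of the square,
  so that evaluation can find the two projections. \<open>Star\<close> records an object because
  terminal objects are not unique. The label in \<open>Fill\<close> tells apart the lifting problems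
  with the same boundary.\<close>

datatype ('g, 'o, 'a) trm =
    Gen 'g
  | App 'a "('g, 'o, 'a) trm"
  | Pull 'a 'a 'a 'a "('g, 'o, 'a) trm" "('g, 'o, 'a) trm"
  | Star 'o
  | Fill 'a "('g, 'o, 'a) trm" 'a

text \<open>Total on raw terms: where the described element fails to be unique, \<open>THE\<close>
  yields an arbitrary value. Evaluation is therefore independent of the relation \<open>eqv\<close>
  and may occur in the side condition \<open>Q\<close> of that relation. The interpretation \<phi>
  of a lift sees the boundary term and not just its value, because a lift chosen over a base has to
  lie over the image of the particular \<open>Fill\<close> term.\<close>

primrec eval :: "('o, 'a) cat \<Rightarrow> ('o, 'a, 'x set, 'x fn) fctr \<Rightarrow> ('g \<Rightarrow> 'x) \<Rightarrow>
    ('a \<Rightarrow> ('g, 'o, 'a) trm \<Rightarrow> 'a \<Rightarrow> 'x \<Rightarrow> 'x) \<Rightarrow> ('g, 'o, 'a) trm \<Rightarrow> 'x" where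
  "eval T B val \<phi> (Gen g) = val g"
| "eval T B val \<phi> (App f s) = act B f (eval T B val \<phi> s)"
| "eval T B val \<phi> (Pull f p p' f' s t) = (THE z. z \<in> on_obj B (src T p') \<and>
     act B p' z = eval T B val \<phi> s \<and> act B f' z = eval T B val \<phi> t)"
| "eval T B val \<phi> (Star t) = (THE x. x \<in> on_obj B t)"
| "eval T B val \<phi> (Fill p s b) = \<phi> p s b (eval T B val \<phi> s)"

text \<open>The model generated by elements \<open>g \<in> G\<close> of sort \<open>srt g\<close>, subject to \<open>f i = j\<close> for every
  edge \<open>(i, f, j)\<close>, and with a new preimage \<open>Fill p s b\<close> of \<open>s\<close> under the display map \<open>p\<close>
  for each label \<open>b\<close> such that \<open>Q p s b\<close>.\<close>

locale term_model = clan_models T \<kappa> Disp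
  for T :: "('o, 'u) cat" (structure) and \<kappa> :: "'u rel" and Disp :: "'u set" +
  fixes G :: "'g set" and srt :: "'g \<Rightarrow> 'o" and ed :: "('g \<times> 'u \<times> 'g) set"
    and Q :: "'u \<Rightarrow> ('g, 'o, 'u) trm \<Rightarrow> 'u \<Rightarrow> bool" and L :: "'u set"
  assumes G_small: "|G| <o \<kappa>" and L_small: "|L| <o \<kappa>"
    and srt: "g \<in> G \<Longrightarrow> srt g \<in> Obj T"
    and ed: "(i, f, j) \<in> ed \<Longrightarrow> i \<in> G \<and> j \<in> G \<and> f \<in> hom T (srt i) (srt j)"
    and Q_label: "Q p s b \<Longrightarrow> b \<in> L"
begin

text \<open>\<open>eqv \<Gamma> s s\<close> expresses that \<open>s\<close> is a well-formed term
  over \<Gamma>. Since \<open>pair\<close> has an equation as premise, well-formedness and equality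
  are generated together. The diagonal cases of the congruence rules are the formation rules.
  \<open>fill\<close> asks for \<open>Q\<close> on both sides, because \<open>Q\<close> is an
  arbitrary predicate on terms and may fail to respect \<open>eqv\<close>.\<close>

inductive eqv :: "'o \<Rightarrow> ('g, 'o, 'u) trm \<Rightarrow> ('g, 'o, 'u) trm \<Rightarrow> bool" where
  gen: "g \<in> G \<Longrightarrow> eqv (srt g) (Gen g) (Gen g)"
| edge: "(i, f, j) \<in> ed \<Longrightarrow> eqv (srt j) (App f (Gen i)) (Gen j)"
| sym: "eqv \<Gamma> s t \<Longrightarrow> eqv \<Gamma> t s"
| trans: "eqv \<Gamma> s t \<Longrightarrow> eqv \<Gamma> t u \<Longrightarrow> eqv \<Gamma> s u"
| app: "f \<in> Arr T \<Longrightarrow> eqv (src T f) s t \<Longrightarrow> eqv (trg T f) (App f s) (App f t)"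
| ident: "\<Gamma> \<in> Obj T \<Longrightarrow> eqv \<Gamma> s s \<Longrightarrow> eqv \<Gamma> (App (ident T \<Gamma>) s) s"
| cmp: "f \<in> Arr T \<Longrightarrow> g \<in> Arr T \<Longrightarrow> src T g = trg T f \<Longrightarrow> eqv (src T f) s s \<Longrightarrow>
    eqv (trg T g) (App (g \<cdot> f) s) (App g (App f s))"
| star: "terminal T t \<Longrightarrow> eqv t (Star t) (Star t)"
| star_unique: "terminal T t \<Longrightarrow> eqv t s s \<Longrightarrow> eqv t u u \<Longrightarrow> eqv t s u"
| pair: "p \<in> Disp \<Longrightarrow> is_pullback T f p p' f' \<Longrightarrow> eqv (src T f) s s' \<Longrightarrow> eqv (src T p) t t' \<Longrightarrow>
    eqv (trg T f) (App f s) (App p t) \<Longrightarrow>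
    eqv (src T p') (Pull f p p' f' s t) (Pull f p p' f' s' t')"
| pair_fst: "p \<in> Disp \<Longrightarrow> is_pullback T f p p' f' \<Longrightarrow> eqv (src T f) s s \<Longrightarrow> eqv (src T p) t t \<Longrightarrow>
    eqv (trg T f) (App f s) (App p t) \<Longrightarrow> eqv (src T f) (App p' (Pull f p p' f' s t)) s"
| pair_snd: "p \<in> Disp \<Longrightarrow> is_pullback T f p p' f' \<Longrightarrow> eqv (src T f) s s \<Longrightarrow> eqv (src T p) t t \<Longrightarrow>
    eqv (trg T f) (App f s) (App p t) \<Longrightarrow> eqv (src T p) (App f' (Pull f p p' f' s t)) t"
| pair_unique: "p \<in> Disp \<Longrightarrow> is_pullback T f p p' f' \<Longrightarrow> eqv (src T p') s s \<Longrightarrow> eqv (src T p') t t \<Longrightarrow>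
    eqv (src T f) (App p' s) (App p' t) \<Longrightarrow> eqv (src T p) (App f' s) (App f' t) \<Longrightarrow> eqv (src T p') s t"
| fill: "p \<in> Disp \<Longrightarrow> eqv (trg T p) s s' \<Longrightarrow> Q p s b \<Longrightarrow> Q p s' b \<Longrightarrow>
    eqv (src T p) (Fill p s b) (Fill p s' b)"
| fill_act: "p \<in> Disp \<Longrightarrow> eqv (trg T p) s s \<Longrightarrow> Q p s b \<Longrightarrow> eqv (trg T p) (App p (Fill p s b)) s"

text \<open>A bound for the terms that \<open>eqv\<close> can reach. Raw terms may mention arbitrary
  elements of \<open>'u\<close>; the levels allow only the small alphabet of generators, arrows,
  objects and labels.\<close>

primrec level :: "nat \<Rightarrow> ('g, 'o, 'u) trm set" where
  "level 0 = {}"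
| "level (Suc n) = level n \<union> Gen ` G \<union> (\<lambda>(f, s). App f s) ` (Arr T \<times> level n) \<union> Star ` Obj T \<union>
     (\<lambda>(f, p, p', f', s, t). Pull f p p' f' s t) ` (Arr T \<times> Arr T \<times> Arr T \<times> Arr T \<times> level n \<times> level n) \<union>
     (\<lambda>(p, s, b). Fill p s b) ` (Arr T \<times> level n \<times> L)"

lemma level_small: "|level n| <o \<kappa>"
proof (induction n)
  case 0 then show ?case by (simp add: small_finite)
next
  case (Suc n)
  then show ?case
    unfolding level.simps
    by (intro small_Un small_image small_Times Suc G_small L_small small_Obj small_Arr)
qed

lemma level_mono: "m \<le> n \<Longrightarrow> level m \<subseteq> level n"
  by (rule lift_Suc_mono_le[of level]) auto

lemma level_closed:
  "g \<in> G \<Longrightarrow> Gen g \<in> (\<Union>n. level n)"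
  "f \<in> Arr T \<Longrightarrow> s \<in> (\<Union>n. level n) \<Longrightarrow> App f s \<in> (\<Union>n. level n)"
  "c \<in> Obj T \<Longrightarrow> Star c \<in> (\<Union>n. level n)"
  "{f, p, p', f'} \<subseteq> Arr T \<Longrightarrow> s \<in> (\<Union>n. level n) \<Longrightarrow> t \<in> (\<Union>n. level n) \<Longrightarrow>
     Pull f p p' f' s t \<in> (\<Union>n. level n)"
  "p \<in> Arr T \<Longrightarrow> s \<in> (\<Union>n. level n) \<Longrightarrow> b \<in> L \<Longrightarrow> Fill p s b \<in> (\<Union>n. level n)"
proof -
  show "Gen g \<in> (\<Union>n. level n)" if "g \<in> G"
    using that by (auto intro!: exI[of _ "Suc 0"])
  show "Star c \<in> (\<Union>n. level n)" if "c \<in> Obj T"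
    using that by (auto intro!: exI[of _ "Suc 0"])
  show "App f s \<in> (\<Union>n. level n)" if "f \<in> Arr T" "s \<in> (\<Union>n. level n)"
  proof -
    obtain n where "s \<in> level n" using \<open>s \<in> _\<close> by auto
    then have "App f s \<in> level (Suc n)" using that(1) by auto
    then show ?thesis by blast
  qed
  show "Fill p s b \<in> (\<Union>n. level n)" if "p \<in> Arr T" "s \<in> (\<Union>n. level n)" "b \<in> L"
  proof -
    obtain n where "s \<in> level n" using \<open>s \<in> _\<close> by auto
    then have "(p, s, b) \<in> Arr T \<times> level n \<times> L" using that by simp
    then have "Fill p s b \<in> (\<lambda>(p, s, b). Fill p s b) ` (Arr T \<times> level n \<times> L)" by (rule rev_image_eqI) simp
    then show ?thesis by (intro UN_I[of "Suc n"]) simp_all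
  qed
  show "Pull f p p' f' s t \<in> (\<Union>n. level n)"
    if fs: "{f, p, p', f'} \<subseteq> Arr T" and s: "s \<in> (\<Union>n. level n)" and t: "t \<in> (\<Union>n. level n)"
  proof -
    obtain m n where "s \<in> level m" "t \<in> level n" using s t by auto
    then have st: "s \<in> level (max m n)" "t \<in> level (max m n)"
      using level_mono[of m "max m n"] level_mono[of n "max m n"] by auto
    let ?S = "Arr T \<times> Arr T \<times> Arr T \<times> Arr T \<times> level (max m n) \<times> level (max m n)"
    have "(f, p, p', f', s, t) \<in> ?S" using fs st by simp
    then have "Pull f p p' f' s t \<in> (\<lambda>(f, p, p', f', s, t). Pull f p p' f' s t) ` ?S"
      by (rule rev_image_eqI) simp
    then show ?thesis by (intro UN_I[of "Suc (max m n)"]) simp_all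
  qed
qed

lemma eqv_level: "eqv \<Gamma> s t \<Longrightarrow> s \<in> (\<Union>n. level n) \<and> t \<in> (\<Union>n. level n)"
proof (induction rule: eqv.induct)
  case (edge i f j)
  then show ?case using ed[OF edge] by (intro conjI level_closed) (auto simp: hom_def)
next
  case (ident \<Gamma> s)
  then show ?case using ident_hom[of \<Gamma>] by (intro conjI level_closed) (auto simp: hom_def)
next
  case (cmp f g s)
  then have "g \<cdot> f \<in> Arr T" using cmp_hom[of f "src T f" "trg T f" g "trg T g"] by (auto simp: hom_def)
  with cmp show ?case by (intro conjI level_closed) blast+
next
  case (star t) then show ?case using level_closed(3) by (auto simp: terminal_def)
next
  case (pair p f p' f' s s' t t')
  with pullbackD[OF pair(2)] show ?case by (intro conjI level_closed) blast+
next
  case (pair_fst p f p' f' s t)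
  with pullbackD[OF pair_fst(2)] show ?case by (intro conjI level_closed) blast+
next
  case (pair_snd p f p' f' s t)
  with pullbackD[OF pair_snd(2)] show ?case by (intro conjI level_closed) blast+
next
  case (fill p s s' b) then show ?case using Disp_Arr Q_label by (intro conjI level_closed) blast+
next
  case (fill_act p s b) then show ?case using Disp_Arr Q_label by (intro conjI level_closed) blast+
qed (use level_closed in blast)+

text \<open>Smallness comes from the levels, \<open>E_pullback\<close> from \<open>pair\<close> and
  its two projection rules, \<open>E_terminal\<close> from the two star rules; the other obligations
  are rules of \<open>eqv\<close> as they stand.\<close>

sublocale setoid_model T \<kappa> Disp eqv App
proof
  show "|{s. eqv \<Gamma> s s}| <o \<kappa>" for \<Gamma>
  proof (rule small_subset)
    show "{s. eqv \<Gamma> s s} \<subseteq> (\<Union>n. level n)" using eqv_level by blast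
    show "|\<Union>n. level n| <o \<kappa>" using small_UN[OF small_countable] level_small by blast
  qed
  show "\<exists>z. eqv (src T p') z z \<and> eqv (src T f) (App p' z) x \<and> eqv (src T p) (App f' z) y"
    if "p \<in> Disp" "is_pullback T f p p' f'" "eqv (src T f) x x" "eqv (src T p) y y"
      "eqv (trg T f) (App f x) (App p y)" for f p p' f' x y
    using pair[OF that] pair_fst[OF that] pair_snd[OF that] by blast
  show "(\<exists>x. eqv t x x) \<and> (\<forall>x y. eqv t x x \<longrightarrow> eqv t y y \<longrightarrow> eqv t x y)" if "terminal T t" for t
    using star[OF that] star_unique[OF that] by blast
qed (rule eqv.intros; assumption)+

text \<open>Soundness of evaluation relative to a base \<open>D\<close>. Independence of the
  representative, membership in \<open>B\<close> and agreement of \<open>r\<close> with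
  \<open>v\<close> go into one induction: a lift at a \<open>Fill\<close> can be chosen in
  \<open>B\<close> only once its boundary is known to lie over the value of \<open>v\<close>, and
  pairings need all three facts as well.\<close>

lemma eval_eqv:
  assumes B: "B \<in> Obj M" and r: "r \<in> hom M B D" and v: "v \<in> hom M quot D"
    and val: "\<And>g. g \<in> G \<Longrightarrow> val g \<in> on_obj B (srt g)"
    and val_ed: "\<And>i f j. (i, f, j) \<in> ed \<Longrightarrow> act B f (val i) = val j"
    and val_r: "\<And>g. g \<in> G \<Longrightarrow> app r (srt g) (val g) = app v (srt g) (cls (srt g) (Gen g))"
    and \<phi>: "\<And>p s b x. p \<in> Disp \<Longrightarrow> eqv (trg T p) s s \<Longrightarrow> x \<in> on_obj B (trg T p) \<Longrightarrow>
      app r (trg T p) x = app v (trg T p) (cls (trg T p) s) \<Longrightarrow> x = eval T B val \<phi> s \<Longrightarrow> Q p s b \<Longrightarrow>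
      \<phi> p s b x \<in> on_obj B (src T p) \<and> act B p (\<phi> p s b x) = x \<and>
      app r (src T p) (\<phi> p s b x) = app v (src T p) (cls (src T p) (Fill p s b))"
    and \<phi>_cong: "\<And>p s s' b x. p \<in> Disp \<Longrightarrow> eqv (trg T p) s s' \<Longrightarrow> Q p s b \<Longrightarrow> Q p s' b \<Longrightarrow> 
      \<phi> p s b x = \<phi> p s' b x"
  shows "eqv \<Gamma> s t \<Longrightarrow> \<Gamma> \<in> Obj T \<and> eval T B val \<phi> s = eval T B val \<phi> t \<and> 
    eval T B val \<phi> s \<in> on_obj B \<Gamma> \<and> app r \<Gamma> (eval T B val \<phi> s) = app v \<Gamma> (cls \<Gamma> s)"
proof (induction rule: eqv.induct)
  let ?e = "eval T B val \<phi>"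
  have eval_app: "?e (App f s) \<in> on_obj B (trg T f) \<and> app r (trg T f) (?e (App f s)) = app v (trg T f) (cls (trg T f) (App f s))"
    if f: "f \<in> Arr T" and s: "eqv (src T f) s s" 
      and e: "?e s \<in> on_obj B (src T f)" "app r (src T f) (?e s) = app v (src T f) (cls (src T f) s)" for f s
    using act_in[OF B f e(1)] app_nat[OF r f e(1)] app_nat[OF v f cls_in[OF src_Obj[OF f] s]] e
    by (simp add: quot_act[OF f s])
  have eval_pair: "?e (Pull f p p' f' s t) \<in> on_obj B (src T p') \<and> act B p' (?e (Pull f p p' f' s t)) = ?e s \<and>
      act B f' (?e (Pull f p p' f' s t)) = ?e t \<and>
      app r (src T p') (?e (Pull f p p' f' s t)) = app v (src T p') (cls (src T p') (Pull f p p' f' s t))"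
    if p: "p \<in> Disp" "is_pullback T f p p' f'" and s: "eqv (src T f) s s" and t: "eqv (src T p) t t"
      and st: "eqv (trg T f) (App f s) (App p t)"
      and es: "?e s \<in> on_obj B (src T f)" "app r (src T f) (?e s) = app v (src T f) (cls (src T f) s)"
      and et: "?e t \<in> on_obj B (src T p)" "app r (src T p) (?e t) = app v (src T p) (cls (src T p) t)"
      and est: "act B f (?e s) = act B p (?e t)"
    for f p p' f' s t
  proof -
    note D = pullbackD[OF p(2)]
    let ?P = "Pull f p p' f' s t"
    define z where "z = ?e ?P"
    \<comment> \<open>The described element exists and is unique because the values of
      \<open>s\<close> and \<open>t\<close> agree after acting with \<open>f\<close> and
      \<open>p\<close>.\<close>
    have e: "z \<in> on_obj B (src T p') \<and> act B p' z = ?e s \<and> act B f' z = ?e t"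
      unfolding z_def eval.simps by (rule theI', rule model_pullback[OF B p es(1) et(1) est])
    have P: "eqv (src T p') ?P ?P" using eqv.pair[OF p s t st] .
    have X: "src T f \<in> Obj T" and Y: "src T p \<in> Obj T" and O: "src T p' \<in> Obj T" using D src_Obj by auto
    have 1: "act D p' (app v (src T p') (cls (src T p') ?P)) = app r (src T f) (?e s)"
      using app_nat[OF v D(3) cls_in[OF O P]] unfolding quot_act[OF D(3) P] D(7)
      using cls_cong[OF X pair_fst[OF p s t st]] es by simp
    have 2: "act D f' (app v (src T p') (cls (src T p') ?P)) = app r (src T p) (?e t)"
      using app_nat[OF v D(4) cls_in[OF O P, unfolded D(6)]] unfolding quot_act[OF D(4) P[unfolded D(6)]] D(8)
      using cls_cong[OF Y pair_snd[OF p s t st]] et by (simp add: D(6))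
    have 3: "act D p' (app r (src T p') z) = app r (src T f) (?e s)"
      using app_nat[OF r D(3) e[THEN conjunct1]] e D(7) by simp
    have 4: "act D f' (app r (src T p') z) = app r (src T p) (?e t)"
      using app_nat[OF r D(4), of z] e D(6,8) by auto
    \<comment> \<open>In \<open>D\<close> the two candidates have the same projections, so they
      coincide by the uniqueness part of the pullback condition.\<close>
    have "act D f (app r (src T f) (?e s)) = act D p (app r (src T p) (?e t))"
      using app_nat[OF r D(1) es(1)] app_nat[OF r D(2) et(1)] est D(5) by simp
    from model_pullback[OF hom_Obj(2)[OF r] p app_in[OF r X es(1)] app_in[OF r Y et(1)] this]
    have "app r (src T p') z = app v (src T p') (cls (src T p') ?P)"
      using 1 2 3 4 app_in[OF r O] app_in[OF v O cls_in[OF O P]] e by blast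
    with e show ?thesis unfolding z_def by blast
  qed
  {
    case (gen g) then show ?case using srt val val_r by simp
  next
    case (edge i f j)
    note E = ed[OF edge] 
    have f: "f \<in> Arr T" "src T f = srt i" "trg T f = srt j" using E by (auto simp: hom_def)
    have "eqv (src T f) (Gen i) (Gen i)" using eqv.gen E f by auto
    from eval_app[OF f(1) this] show ?case using val_ed[OF edge] val val_r srt E f by simp
  next
    case (sym \<Gamma> s t)
    then show ?case using cls_cong[of \<Gamma> s t] by auto
  next
    case (trans \<Gamma> s t u)
    then show ?case by auto
  next
    case (app f s t)
    have "eqv (src T f) s s" using E_refl[OF src_Obj] app by blast
    with app show ?case using eval_app[of f s] trg_Obj by auto
  next
    case (ident \<Gamma> s)
    have i: "ident T \<Gamma> \<in> Arr T" "src T (ident T \<Gamma>) = \<Gamma>" "trg T (ident T \<Gamma>) = \<Gamma>"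
      using ident_hom[OF ident(1)] by (auto simp: hom_def)
    show ?case
      using ident eval_app[OF i(1), of s] act_ident[OF B ident(1)] unfolding i(2,3) by auto
  next
    case (cmp f g s)
    have gf: "g \<cdot> f \<in> Arr T" "src T (g \<cdot> f) = src T f" "trg T (g \<cdot> f) = trg T g"
      using cmp_hom[of f "src T f" "trg T f" g "trg T g"] cmp by (auto simp: hom_def)
    show ?case
      using cmp eval_app[OF gf(1), of s] act_cmp[OF B cmp(1-3)] trg_Obj[OF cmp(2)] unfolding gf(2,3) by auto
  next
    case (star t)
    have t: "t \<in> Obj T" using star by (simp add: terminal_def)
    have e: "?e (Star t) \<in> on_obj B t" unfolding eval.simps by (rule theI', rule model_terminal[OF B star])
    then show ?case
      using t app_in[OF r t e] app_in[OF v t cls_in[OF t eqv.star[OF star]]]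
        model_terminal[OF hom_Obj(2)[OF r] star] by blast
  next
    case (star_unique t s u)
    then show ?case using model_terminal[OF B star_unique(1)] by blast
  next
    case (pair p f p' f' s s' t t')
    note D = pullbackD[OF pair(2)]
    have "act B f (?e s) = act B p (?e t)" using pair.IH(3) by simp
    then show ?case 
      using eval_pair[OF pair(1,2), of s t] pair E_refl[OF src_Obj[OF D(1)], of s s'] 
        E_refl[OF src_Obj[OF D(2)], of t t'] src_Obj[OF D(3)] by auto
  next
    case (pair_fst p f p' f' s t)
    then show ?case 
      using eval_pair[OF pair_fst(1-5)] cls_cong[OF _ eqv.pair_fst[OF pair_fst(1-5)]] by auto
  next
    case (pair_snd p f p' f' s t)
    then show ?case 
      using eval_pair[OF pair_snd(1-5)] cls_cong[OF _ eqv.pair_snd[OF pair_snd(1-5)]] by auto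
  next
    case (pair_unique p f p' f' s t)
    note D = pullbackD[OF pair_unique(2)]
    have es: "?e s \<in> on_obj B (src T p')" and et: "?e t \<in> on_obj B (src T p')" using pair_unique.IH by blast+
    have eq: "act B p' (?e s) = act B p' (?e t)" "act B f' (?e s) = act B f' (?e t)"
      using pair_unique.IH(3,4) by simp_all
    have "act B p' (?e s) \<in> on_obj B (src T f)" "act B f' (?e s) \<in> on_obj B (src T p)"
      using act_in[OF B D(3) es] act_in[OF B D(4), of "?e s"] es D by simp_all
    moreover have "act B f (act B p' (?e s)) = act B p (act B f' (?e s))"
      using act_cmp[OF B D(3,1), of "?e s"] act_cmp[OF B D(4,2), of "?e s"] D es by simp
    ultimately have "\<exists>!z. z \<in> on_obj B (src T p') \<and> act B p' z = act B p' (?e s) \<and> act B f' z = act B f' (?e s)"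
      by (rule model_pullback[OF B pair_unique(1,2)])
    then have "?e s = ?e t" by (rule ex1_eqD) (simp_all add: es et eq)
    then show ?case using pair_unique.IH(1) by blast
  next
    case (fill p s s' b)
    have p: "p \<in> Arr T" using fill Disp_Arr by blast
    have "eqv (trg T p) s s" using E_refl[OF trg_Obj[OF p]] fill by blast
    \<comment> \<open>\<phi> may depend on the boundary term, so passing from \<open>s\<close> to
      \<open>s'\<close> takes \<open>\<phi>_cong\<close> besides equality of their values.\<close>
    then show ?case using \<phi>[of p s "?e s" b] \<phi>_cong[of p s s' b "?e s"] fill src_Obj[OF p] by auto
  next
    case (fill_act p s b)
    have p: "p \<in> Arr T" using fill_act Disp_Arr by blast
    show ?case using \<phi>[of p s "?e s" b] cls_cong[OF trg_Obj[OF p] eqv.fill_act[OF fill_act(1-3)]] fill_act by auto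
  }
qed

end

section \<open>Presentations and factorizations\<close>

context clan_models
begin

text \<open>The terminal model. Taken as the base \<open>D\<close>, it makes the agreement condition
  of the evaluation lemmas vacuous.\<close>

definition one :: "('o, 'u, 'u set, 'u fn) fctr" where
  "one = mk_functor T (\<lambda>_. {undefined}) (\<lambda>_ x. x)"

lemma one_model: "one \<in> Obj M" and one_obj: "\<Gamma> \<in> Obj T \<Longrightarrow> on_obj one \<Gamma> = {undefined}"
  unfolding one_def
  by (rule mk_functor_model(1); simp add: small_finite) (simp add: mk_functor_def)

lemma to_one: "A \<in> Obj M \<Longrightarrow> mk_trans T A one (\<lambda>_ _. undefined) \<in> hom M A one"
  by (rule mk_trans_hom(1)[OF _ one_model]) (simp_all add: one_obj, simp add: one_def mk_functor_def)

lemma one_eq: "\<eta> \<in> hom M A one \<Longrightarrow> \<theta> \<in> hom M B one \<Longrightarrow> \<Gamma> \<in> Obj T \<Longrightarrow> x \<in> on_obj A \<Gamma> \<Longrightarrow> y \<in> on_obj B \<Gamma> \<Longrightarrow>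
    app \<eta> \<Gamma> x = app \<theta> \<Gamma> y"
  using app_in one_obj by (metis singletonD)

text \<open>A graph \<open>(G, srt, ed)\<close> as in \<open>term_model\<close> stands for a diagram of representables;
  \<open>family\<close> are its cocones, by Yoneda, and \<open>presents\<close> its colimits.\<close>

definition family :: "'g set \<Rightarrow> ('g \<Rightarrow> 'o) \<Rightarrow> ('g \<times> 'u \<times> 'g) set \<Rightarrow>
    ('o, 'u, 'u set, 'u fn) fctr \<Rightarrow> ('g \<Rightarrow> 'u) \<Rightarrow> bool" where
  "family G srt ed B v \<longleftrightarrow> (\<forall>g\<in>G. v g \<in> on_obj B (srt g)) \<and> (\<forall>(i, f, j)\<in>ed. act B f (v i) = v j)"

definition presents :: "'g set \<Rightarrow> ('g \<Rightarrow> 'o) \<Rightarrow> ('g \<times> 'u \<times> 'g) set \<Rightarrow>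
    ('o, 'u, 'u set, 'u fn) fctr \<Rightarrow> ('g \<Rightarrow> 'u) \<Rightarrow> bool" where
  "presents G srt ed P u \<longleftrightarrow> P \<in> Obj M \<and> family G srt ed P u \<and>
     (\<forall>B v. B \<in> Obj M \<and> family G srt ed B v \<longrightarrow>
        (\<exists>!h. h \<in> hom M P B \<and> (\<forall>g\<in>G. app h (srt g) (u g) = v g)))"

definition graph :: "'g set \<Rightarrow> ('g \<Rightarrow> 'o) \<Rightarrow> ('g \<times> 'u \<times> 'g) set \<Rightarrow> bool" where
  "graph G srt ed \<longleftrightarrow> (\<forall>g\<in>G. srt g \<in> Obj T) \<and>
     (\<forall>(i, f, j)\<in>ed. i \<in> G \<and> j \<in> G \<and> f \<in> hom T (srt i) (srt j))"

end

context term_model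
begin

text \<open>Evaluation descends to classes by \<open>quot_hom\<close>, and its agreement with
  \<open>v\<close> becomes the equation \<open>r \<cdot> h = v\<close>. This is the source of
  diagonal fillers for maps out of \<open>quot\<close>.\<close>

lemma eval_lift:
  assumes B: "B \<in> Obj M" and r: "r \<in> hom M B D" and v: "v \<in> hom M quot D"
    and val: "family G srt ed B val"
    and val_r: "\<And>g. g \<in> G \<Longrightarrow> app r (srt g) (val g) = app v (srt g) (cls (srt g) (Gen g))"
    and \<phi>: "\<And>p s b x. p \<in> Disp \<Longrightarrow> eqv (trg T p) s s \<Longrightarrow> x \<in> on_obj B (trg T p) \<Longrightarrow>
      app r (trg T p) x = app v (trg T p) (cls (trg T p) s) \<Longrightarrow> x = eval T B val \<phi> s \<Longrightarrow> Q p s b \<Longrightarrow>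
      \<phi> p s b x \<in> on_obj B (src T p) \<and> act B p (\<phi> p s b x) = x \<and>
      app r (src T p) (\<phi> p s b x) = app v (src T p) (cls (src T p) (Fill p s b))"
    and \<phi>_cong: "\<And>p s s' b x. p \<in> Disp \<Longrightarrow> eqv (trg T p) s s' \<Longrightarrow> Q p s b \<Longrightarrow> Q p s' b \<Longrightarrow> 
      \<phi> p s b x = \<phi> p s' b x"
  obtains h where "h \<in> hom M quot B" "r \<cdot>\<^bsub>M\<^esub> h = v"
    "\<And>\<Gamma> s. eqv \<Gamma> s s \<Longrightarrow> app h \<Gamma> (cls \<Gamma> s) = eval T B val \<phi> s"
proof -
  have *: "\<Gamma> \<in> Obj T \<and> eval T B val \<phi> s = eval T B val \<phi> t \<and> eval T B val \<phi> s \<in> on_obj B \<Gamma> \<and>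
      app r \<Gamma> (eval T B val \<phi> s) = app v \<Gamma> (cls \<Gamma> s)" if "eqv \<Gamma> s t" for \<Gamma> s t
    using that val by (intro eval_eqv[OF B r v _ _ val_r \<phi> \<phi>_cong]) (auto simp: family_def)
  show thesis
  proof (rule quot_hom[OF B, of "\<lambda>_. eval T B val \<phi>"])
    show "eval T B val \<phi> s = eval T B val \<phi> t" if "eqv \<Gamma> s t" for \<Gamma> s t using *[OF that] by blast
    show "eval T B val \<phi> s \<in> on_obj B \<Gamma>" if "eqv \<Gamma> s s" for \<Gamma> s using *[OF that] by blast
    show "eval T B val \<phi> (App f s) = act B f (eval T B val \<phi> s)" for f s by simp
    fix h assume h: "h \<in> hom M quot B"
      and eq: "\<And>\<Gamma> s. \<Gamma> \<in> Obj T \<Longrightarrow> eqv \<Gamma> s s \<Longrightarrow> app h \<Gamma> (cls \<Gamma> s) = eval T B val \<phi> s"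
    have "r \<cdot>\<^bsub>M\<^esub> h = v"
    proof (rule quot_hom_eqI[OF Mod.cmp_hom[OF h r] v])
      fix \<Gamma> s assume s: "\<Gamma> \<in> Obj T" "eqv \<Gamma> s s"
      show "app (r \<cdot>\<^bsub>M\<^esub> h) \<Gamma> (cls \<Gamma> s) = app v \<Gamma> (cls \<Gamma> s)"
        unfolding app_cmp[OF h r s(1) cls_in[OF s]] eq[OF s] using *[OF s(2)] by blast
    qed
    with h eq * show thesis using that by blast
  qed
qed

text \<open>The case of base \<open>one\<close>, where any two values over the same object
  agree.\<close>

lemma eval_hom:
  assumes B: "B \<in> Obj M"
    and val: "family G srt ed B val"
    and \<phi>: "\<And>p s b x. p \<in> Disp \<Longrightarrow> eqv (trg T p) s s \<Longrightarrow> x \<in> on_obj B (trg T p) \<Longrightarrow>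
      x = eval T B val \<phi> s \<Longrightarrow> Q p s b \<Longrightarrow> \<phi> p s b x \<in> on_obj B (src T p) \<and> act B p (\<phi> p s b x) = x"
    and \<phi>_cong: "\<And>p s s' b x. p \<in> Disp \<Longrightarrow> eqv (trg T p) s s' \<Longrightarrow> Q p s b \<Longrightarrow> Q p s' b \<Longrightarrow> 
      \<phi> p s b x = \<phi> p s' b x"
  obtains h where "h \<in> hom M quot B" "\<And>\<Gamma> s. eqv \<Gamma> s s \<Longrightarrow> app h \<Gamma> (cls \<Gamma> s) = eval T B val \<phi> s"
proof (rule eval_lift[OF B to_one[OF B] to_one[OF quot_model] val _ _ \<phi>_cong])
  fix h assume "h \<in> hom M quot B" "\<And>\<Gamma> s. eqv \<Gamma> s s \<Longrightarrow> app h \<Gamma> (cls \<Gamma> s) = eval T B val \<phi> s"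
  then show thesis by (rule that)
next
  show "app (mk_trans T B one (\<lambda>_ _. undefined)) (srt g) (val g) =
      app (mk_trans T quot one (\<lambda>_ _. undefined)) (srt g) (cls (srt g) (Gen g))" if "g \<in> G" for g
    using val one_eq[OF to_one[OF B] to_one[OF quot_model] srt[OF that] _ cls_in[OF srt[OF that] eqv.gen[OF that]]] that
    by (auto simp: family_def)
  show "\<phi> p s b x \<in> on_obj B (src T p) \<and> act B p (\<phi> p s b x) = x \<and>
      app (mk_trans T B one (\<lambda>_ _. undefined)) (src T p) (\<phi> p s b x) = 
      app (mk_trans T quot one (\<lambda>_ _. undefined)) (src T p) (cls (src T p) (Fill p s b))"
    if p: "p \<in> Disp" and s: "eqv (trg T p) s s" and x: "x \<in> on_obj B (trg T p)" "x = eval T B val \<phi> s" 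
      and Q: "Q p s b" for p s b x
  proof -
    have p': "src T p \<in> Obj T" using p Disp_Arr src_Obj by blast
    show ?thesis
      using \<phi>[OF p s x Q] one_eq[OF to_one[OF B] to_one[OF quot_model] p' _ cls_in[OF p' eqv.fill[OF p s Q Q]]] by blast
  qed
qed

lemma presents_quot:
  assumes noQ: "\<And>p s b. \<not> Q p s b"
  shows "presents G srt ed quot (\<lambda>g. cls (srt g) (Gen g))"
proof -
  have fam: "family G srt ed quot (\<lambda>g. cls (srt g) (Gen g))"
  proof -
    have "act quot f (cls (srt i) (Gen i)) = cls (srt j) (Gen j)" if "(i, f, j) \<in> ed" for i f j
    proof -
      have f: "f \<in> Arr T" "src T f = srt i" "trg T f = srt j" "i \<in> G" "j \<in> G" using ed[OF that] by (auto simp: hom_def)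
      show ?thesis using quot_act[OF f(1), of "Gen i"] cls_cong[OF srt eqv.edge[OF that]] f eqv.gen[OF f(4)] by simp
    qed
    then show ?thesis using cls_in srt eqv.gen by (auto simp: family_def)
  qed
  moreover have "\<exists>!h. h \<in> hom M quot B \<and> (\<forall>g\<in>G. app h (srt g) (cls (srt g) (Gen g)) = v g)"
    if B: "B \<in> Obj M" and v: "family G srt ed B v" for B v
  proof -
    let ?\<phi> = "\<lambda>p s b x. x"
    obtain h where h: "h \<in> hom M quot B" "\<And>\<Gamma> s. eqv \<Gamma> s s \<Longrightarrow> app h \<Gamma> (cls \<Gamma> s) = eval T B v ?\<phi> s"
      by (rule eval_hom[OF B v, of ?\<phi>]) (use noQ in auto)
    show ?thesis
    proof (rule ex1I[of _ h])
      show "h \<in> hom M quot B \<and> (\<forall>g\<in>G. app h (srt g) (cls (srt g) (Gen g)) = v g)"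
        using h eqv.gen by auto
      fix k assume k: "k \<in> hom M quot B \<and> (\<forall>g\<in>G. app k (srt g) (cls (srt g) (Gen g)) = v g)"
      \<comment> \<open>Uniqueness by lifting \<open>k\<close> along the identity of
        \<open>B\<close>: the lift is an evaluation and equals \<open>k\<close>, so every competitor
        is the evaluation determined by \<open>v\<close>.\<close>
      obtain l where l: "l \<in> hom M quot B" "ident M B \<cdot>\<^bsub>M\<^esub> l = k"
        "\<And>\<Gamma> s. eqv \<Gamma> s s \<Longrightarrow> app l \<Gamma> (cls \<Gamma> s) = eval T B v ?\<phi> s"
        by (rule eval_lift[OF B Mod.ident_hom[OF B] _ v, of k ?\<phi>]) (use k v noQ srt in \<open>auto simp: family_def\<close>)
      have "k = l" using Mod.ident_left[OF l(1)] l(2) by (simp del: Mod_simps)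
      then show "k = h" using l h by (auto intro: quot_hom_eqI)
    qed
  qed
  ultimately show ?thesis by (auto simp: presents_def quot_model)
qed

end

section \<open>Existence of presentations and the one-step factorization\<close>

context clan_models
begin

lemma presentation_exists:
  assumes "|G| <o \<kappa>" and "graph G srt ed"
  obtains P u where "presents G srt ed P u"
proof -
  interpret term_model T \<kappa> Disp G srt ed "\<lambda>p s b. False" "{}"
    using assms by unfold_locales (auto simp: graph_def small_finite)
  show thesis using presents_quot that by blast
qed

lemma presentsD:
  assumes "presents G srt ed P u"
  shows "P \<in> Obj M" "g \<in> G \<Longrightarrow> u g \<in> on_obj P (srt g)" "(i, f, j) \<in> ed \<Longrightarrow> act P f (u i) = u j"
  using assms by (auto simp: presents_def family_def)

lemma presents_ex:
  assumes "presents G srt ed P u" "B \<in> Obj M" "family G srt ed B v"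
  shows "\<exists>h\<in>hom M P B. \<forall>g\<in>G. app h (srt g) (u g) = v g"
  using assms unfolding presents_def by blast

lemma family_app:
  assumes "graph G srt ed" "h \<in> hom M P B" "family G srt ed P u"
  shows "family G srt ed B (\<lambda>g. app h (srt g) (u g))"
  using assms app_in[OF assms(2)] app_nat'[OF assms(2)] 
  by (fastforce simp: family_def graph_def)

text \<open>The values of \<open>h\<close> on the generators form a family in \<open>B\<close>, and
  both maps induce it; the uniqueness half of the universal property applies.\<close>

lemma presents_eqI:
  assumes P: "presents G srt ed P u" and gr: "graph G srt ed"
    and h: "h \<in> hom M P B" and k: "k \<in> hom M P B" 
    and eq: "\<And>g. g \<in> G \<Longrightarrow> app h (srt g) (u g) = app k (srt g) (u g)"
  shows "h = k"
proof -
  have "family G srt ed B (\<lambda>g. app h (srt g) (u g))"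
    using family_app[OF gr h] P by (auto simp: presents_def)
  then have "\<exists>!l. l \<in> hom M P B \<and> (\<forall>g\<in>G. app l (srt g) (u g) = app h (srt g) (u g))"
    using P hom_Obj[OF h] by (simp add: presents_def)
  then show ?thesis by (rule ex1_eqD) (use h k eq in auto)
qed

lemma full_factorization:
  assumes f: "f \<in> hom M A B"
  obtains C e m where "e \<in> hom M A C" "m \<in> hom M C B" "f = m \<cdot>\<^bsub>M\<^esub> e" "m \<in> full_maps \<kappa> T Disp"
    "e \<in> extensions \<kappa> T Disp"
proof -
  note AB = hom_Obj[OF f]
  \<comment> \<open>Generators and edges form the category of elements of \<open>A\<close>; without
    formal lifts these data would present \<open>A\<close> itself.\<close>
  define G where "G = (SIGMA \<Gamma>:Obj T. on_obj A \<Gamma>)"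
  define ed where "ed = {((\<Gamma>, x), h, (\<Delta>, act A h x)) |\<Gamma> x h \<Delta>. h \<in> hom T \<Gamma> \<Delta> \<and> x \<in> on_obj A \<Gamma>}"
  define val where "val = (\<lambda>(\<Gamma>, x). app f \<Gamma> x)"
  \<comment> \<open>In \<open>B\<close> a formal lift is evaluated as its own label. Hence
    \<open>Q\<close> can say of a raw term \<open>s\<close> that \<open>b\<close> lies over the
    value of \<open>s\<close>, that is, that \<open>s\<close> and \<open>b\<close> form a lifting
    problem against the map to \<open>B\<close>.\<close>
  define \<phi> :: "'u \<Rightarrow> ('o \<times> 'u, 'o, 'u) trm \<Rightarrow> 'u \<Rightarrow> 'u \<Rightarrow> 'u" where "\<phi> = (\<lambda>p s b z. b)"
  define Q where "Q p s b \<longleftrightarrow> p \<in> Disp \<and> b \<in> on_obj B (src T p) \<and> act B p b = eval T B val \<phi> s" for p s b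
  have hom_Obj_T: "\<Gamma> \<in> Obj T \<and> \<Delta> \<in> Obj T" if "h \<in> hom T \<Gamma> \<Delta>" for h \<Gamma> \<Delta>
    using that src_Obj trg_Obj by (auto simp: hom_def)
  interpret term_model T \<kappa> Disp G fst ed Q "\<Union>\<Gamma>\<in>Obj T. on_obj B \<Gamma>"
  proof
    show "|G| <o \<kappa>" unfolding G_def by (intro small_Sigma small_Obj model_small AB)
    show "|\<Union>\<Gamma>\<in>Obj T. on_obj B \<Gamma>| <o \<kappa>" by (intro small_UN small_Obj model_small AB)
    show "fst g \<in> Obj T" if "g \<in> G" for g using that by (auto simp: G_def)
    show "i \<in> G \<and> j \<in> G \<and> h \<in> hom T (fst i) (fst j)" if "(i, h, j) \<in> ed" for i h j
      using that act_in[OF AB(1), of h] hom_Obj_T by (auto simp: ed_def G_def) (auto simp: hom_def)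
    show "b \<in> (\<Union>\<Gamma>\<in>Obj T. on_obj B \<Gamma>)" if "Q p s b" for p s b
      using that Disp_Arr src_Obj by (auto simp: Q_def)
  qed
  have G: "(\<Gamma>, x) \<in> G \<longleftrightarrow> \<Gamma> \<in> Obj T \<and> x \<in> on_obj A \<Gamma>" for \<Gamma> x by (auto simp: G_def)
  have gen: "eqv \<Gamma> (Gen (\<Gamma>, x)) (Gen (\<Gamma>, x))" if "\<Gamma> \<in> Obj T" "x \<in> on_obj A \<Gamma>" for \<Gamma> x
    using eqv.gen[of "(\<Gamma>, x)"] that by (simp add: G)
  let ?e = "mk_trans T A quot (\<lambda>\<Gamma> x. cls \<Gamma> (Gen (\<Gamma>, x)))"
  have e_nat: "cls (trg T h) (Gen (trg T h, act A h x)) = act quot h (cls (src T h) (Gen (src T h, x)))"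
    if h: "h \<in> Arr T" and x: "x \<in> on_obj A (src T h)" for h x
  proof -
    have "((src T h, x), h, (trg T h, act A h x)) \<in> ed"
      using that by (auto simp: ed_def hom_def)
    from eqv.edge[OF this] show ?thesis
      using quot_act[OF h gen[OF src_Obj[OF h] x]] cls_cong[OF trg_Obj[OF h]] by simp
  qed
  have e: "?e \<in> hom M A quot"
    by (rule mk_trans_hom(1)[OF AB(1) quot_model]) (use cls_in gen e_nat in auto)
  have app_e: "app ?e \<Gamma> x = cls \<Gamma> (Gen (\<Gamma>, x))" if "\<Gamma> \<in> Obj T" "x \<in> on_obj A \<Gamma>" for \<Gamma> x
    by (rule mk_trans_hom(2)[OF AB(1) quot_model]) (use cls_in gen e_nat that in auto)
  have fam: "family G fst ed B val"
    using app_in[OF f] app_nat'[OF f] by (auto simp: family_def val_def ed_def G)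
  obtain m where m: "m \<in> hom M quot B" "\<And>\<Gamma> s. eqv \<Gamma> s s \<Longrightarrow> app m \<Gamma> (cls \<Gamma> s) = eval T B val \<phi> s"
    by (rule eval_hom[OF AB(2) fam, of \<phi>]) (auto simp: Q_def \<phi>_def)
  have me: "m \<cdot>\<^bsub>M\<^esub> ?e = f"
  proof (rule Mod_hom_eqI[OF Mod.cmp_hom[OF e m(1)] f])
    fix \<Gamma> x assume x: "\<Gamma> \<in> Obj T" "x \<in> on_obj A \<Gamma>"
    show "app (m \<cdot>\<^bsub>M\<^esub> ?e) \<Gamma> x = app f \<Gamma> x"
      using app_cmp[OF e m(1) x] m(2)[OF gen[OF x]] app_e[OF x] by (simp add: val_def)
  qed
  have m_full: "m \<in> full_maps \<kappa> T Disp"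
    unfolding full_maps_iff[OF m(1)]
  proof (intro ballI impI)
    fix p a b assume p: "p \<in> Disp" and a: "a \<in> on_obj quot (trg T p)" and b: "b \<in> on_obj B (src T p)"
      and ab: "app m (trg T p) a = act B p b"
    have p': "p \<in> Arr T" using p Disp_Arr by blast
    obtain s where s: "eqv (trg T p) s s" "a = cls (trg T p) s" by (rule quot_cases[OF trg_Obj[OF p'] a])
    \<comment> \<open>The term \<open>s\<close> may itself contain formal lifts, and
      \<open>Q\<close> admits every problem over \<open>B\<close>. Its solution is a term of the
      same model, so no iteration takes place.\<close>
    have "Q p s b" using p b ab m(2)[OF s(1)] s(2) by (simp add: Q_def)
    note F = eqv.fill[OF p s(1) this this] eqv.fill_act[OF p s(1) this]
    show "\<exists>c\<in>on_obj quot (src T p). act quot p c = a \<and> app m (src T p) c = b"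
      using cls_in[OF src_Obj[OF p'] F(1)] quot_act[OF p' F(1)] m(2)[OF F(1)] cls_cong[OF trg_Obj[OF p'] F(2)] s(2)
      by (intro bexI[of _ "cls (src T p) (Fill p s b)"]) (simp_all add: \<phi>_def)
  qed
  have e_ext: "?e \<in> extensions \<kappa> T Disp"
  proof -
    have "lifts_against M ?e r" if r: "r \<in> full_maps \<kappa> T Disp" for r
      unfolding lifts_against_def
    proof (intro ballI impI)
      fix k v assume "k \<in> hom M (src M ?e) (src M r)" "v \<in> hom M (trg M ?e) (trg M r)"
        and sq: "r \<cdot>\<^bsub>M\<^esub> k = v \<cdot>\<^bsub>M\<^esub> ?e"
      define C where "C = src M r"
      define D where "D = trg M r"
      have rCD: "r \<in> hom M C D" using r by (auto simp: full_maps_def rlp_def hom_def C_def D_def)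
      have k: "k \<in> hom M A C" and v: "v \<in> hom M quot D"
        using \<open>k \<in> _\<close> \<open>v \<in> _\<close> hom_ends[OF e] by (auto simp: C_def D_def mk_trans_def)
      note CD = hom_Obj[OF rCD]
      have sq': "app r \<Gamma> (app k \<Gamma> x) = app v \<Gamma> (cls \<Gamma> (Gen (\<Gamma>, x)))" if "\<Gamma> \<in> Obj T" "x \<in> on_obj A \<Gamma>" for \<Gamma> x
        using app_cmp[OF k rCD that] app_cmp[OF e v that] app_e[OF that] sq by simp
      define w where "w = (\<lambda>(\<Gamma>, x). app k \<Gamma> x)"
      \<comment> \<open>A lift along \<open>r\<close> over the value that \<open>v\<close> takes on
        the class of \<open>Fill p s b\<close>. It depends on \<open>s\<close> only through that
        class, whence \<open>\<psi>_cong\<close>.\<close>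
      define \<psi> :: "'u \<Rightarrow> ('o \<times> 'u, 'o, 'u) trm \<Rightarrow> 'u \<Rightarrow> 'u \<Rightarrow> 'u" where 
        "\<psi> p s b z = (SOME c. c \<in> on_obj C (src T p) \<and> act C p c = z \<and>
           app r (src T p) c = app v (src T p) (cls (src T p) (Fill p s b)))" for p s b z
      have fam: "family G fst ed C w"
        using app_in[OF k] app_nat'[OF k] by (auto simp: family_def w_def ed_def G)
      have \<psi>: "\<psi> p s b x \<in> on_obj C (src T p) \<and> act C p (\<psi> p s b x) = x \<and>
         app r (src T p) (\<psi> p s b x) = app v (src T p) (cls (src T p) (Fill p s b))"
        if p: "p \<in> Disp" and s: "eqv (trg T p) s s" and x: "x \<in> on_obj C (trg T p)" 
          and xs: "app r (trg T p) x = app v (trg T p) (cls (trg T p) s)" and Q: "Q p s b" for p s b x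
      proof -
        have p': "p \<in> Arr T" using p Disp_Arr by blast
        note F = eqv.fill[OF p s Q Q] eqv.fill_act[OF p s Q]
        \<comment> \<open>The formal lift is sent by \<open>v\<close> to an element of
          \<open>D\<close> over the image of its boundary; fullness of \<open>r\<close> lifts this
          element to \<open>C\<close>.\<close>
        have "app v (trg T p) (cls (trg T p) s) = act D p (app v (src T p) (cls (src T p) (Fill p s b)))"
          using app_nat[OF v p' cls_in[OF src_Obj[OF p'] F(1)]] quot_act[OF p' F(1)] cls_cong[OF trg_Obj[OF p'] F(2)]
          by simp
        then have "\<exists>c. c \<in> on_obj C (src T p) \<and> act C p c = x \<and> 
            app r (src T p) c = app v (src T p) (cls (src T p) (Fill p s b))"
          using r[unfolded full_maps_iff[OF rCD]] p x xs app_in[OF v src_Obj[OF p'] cls_in[OF src_Obj[OF p'] F(1)]] 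
          by (metis (no_types, lifting))
        then show ?thesis unfolding \<psi>_def by (rule someI_ex)
      qed
      have \<psi>_cong: "\<psi> p s b x = \<psi> p s' b x" 
        if "p \<in> Disp" "eqv (trg T p) s s'" "Q p s b" "Q p s' b" for p s s' b x
        using cls_cong[OF src_Obj eqv.fill[OF that]] that(1) Disp_Arr by (auto simp: \<psi>_def)
      obtain d where d: "d \<in> hom M quot C" "r \<cdot>\<^bsub>M\<^esub> d = v"
        "\<And>\<Gamma> s. eqv \<Gamma> s s \<Longrightarrow> app d \<Gamma> (cls \<Gamma> s) = eval T C w \<psi> s"
      proof (rule eval_lift[OF CD(1) rCD v fam _ \<psi> \<psi>_cong])
        show "app r (fst g) (w g) = app v (fst g) (cls (fst g) (Gen g))" if "g \<in> G" for g
          using sq' that by (auto simp: G_def w_def)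
      next
        fix h assume "h \<in> hom M quot C" "r \<cdot>\<^bsub>M\<^esub> h = v"
          "\<And>\<Gamma> s. eqv \<Gamma> s s \<Longrightarrow> app h \<Gamma> (cls \<Gamma> s) = eval T C w \<psi> s"
        then show thesis by (rule that)
      qed
      have "d \<cdot>\<^bsub>M\<^esub> ?e = k"
      proof (rule Mod_hom_eqI[OF Mod.cmp_hom[OF e d(1)] k])
        fix \<Gamma> x assume x: "\<Gamma> \<in> Obj T" "x \<in> on_obj A \<Gamma>"
        show "app (d \<cdot>\<^bsub>M\<^esub> ?e) \<Gamma> x = app k \<Gamma> x"
          using app_cmp[OF e d(1) x] d(3)[OF gen[OF x]] app_e[OF x] by (simp add: w_def)
      qed
      with d show "\<exists>d\<in>hom M (trg M ?e) (src M r). d \<cdot>\<^bsub>M\<^esub> ?e = k \<and> r \<cdot>\<^bsub>M\<^esub> d = v"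
        by (auto simp: C_def mk_trans_def)
    qed
    then show ?thesis using e by (auto simp: extensions_def llp_def hom_def)
  qed
  show thesis by (rule that[OF e m(1) me[symmetric] m_full e_ext])
qed

end

section \<open>Full maps, extensions and full quotients\<close>

context clan_models
begin

lemma Disp_hom: "p \<in> Disp \<Longrightarrow> p \<in> hom T (src T p) (trg T p)"
  using Disp_Arr by (auto simp: hom_def)

lemma full_maps_hom: "r \<in> full_maps \<kappa> T Disp \<Longrightarrow> r \<in> hom M (nsrc r) (ntrg r)"
  by (simp add: full_maps_def rlp_def hom_def)

lemma hom_trans_extension: "p \<in> Disp \<Longrightarrow> hom_trans T p \<in> extensions \<kappa> T Disp"
  using homD(1)[OF hom_trans_hom[OF Disp_hom]] by (auto simp: extensions_def llp_def full_maps_def rlp_def)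

text \<open>Extensions lift against full maps by definition, so every class between the generators
  and all extensions has the same right lifts. Applied to all extensions this serves the
  factorization system, and to the extensions between compact 0-extensions it gives (CG).\<close>

lemma full_maps_eq_rlp:
  assumes "hom_trans T ` Disp \<subseteq> I" "I \<subseteq> extensions \<kappa> T Disp"
  shows "full_maps \<kappa> T Disp = rlp M I"
proof
  show "full_maps \<kappa> T Disp \<subseteq> rlp M I"
    using assms(2) full_maps_hom by (auto simp: rlp_def extensions_def llp_def hom_def)
  show "rlp M I \<subseteq> full_maps \<kappa> T Disp"
    using assms(1) by (auto simp: full_maps_def rlp_def)
qed

lemma weak_factorization_system_Mod:
  "weak_factorization_system M (extensions \<kappa> T Disp) (full_maps \<kappa> T Disp)"
  unfolding weak_factorization_system_def
proof (intro conjI ballI)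
  show "full_maps \<kappa> T Disp = rlp M (extensions \<kappa> T Disp)"
    using hom_trans_extension by (intro full_maps_eq_rlp) auto
  fix f assume "f \<in> Arr M"
  from full_factorization[OF Mod_ArrD[OF this]] obtain C e m where
    "e \<in> hom M (nsrc f) C" "m \<in> hom M C (ntrg f)" "f = m \<cdot>\<^bsub>M\<^esub> e" 
    "m \<in> full_maps \<kappa> T Disp" "e \<in> extensions \<kappa> T Disp" by blast
  then show "\<exists>e\<in>extensions \<kappa> T Disp. \<exists>m\<in>full_maps \<kappa> T Disp. trg M e = src M m \<and> f = m \<cdot>\<^bsub>M\<^esub> e"
    using hom_ends by (metis Mod_simps(1,2))
qed (simp add: extensions_def)

text \<open>A model has exactly one element over a terminal object, and by Yoneda these elements are
  the maps out of \<open>H t\<close>.\<close>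

lemma initial_H: assumes t: "terminal T t" shows "initial M (H t)"
proof -
  have tO: "t \<in> Obj T" using t by (simp add: terminal_def)
  have "\<exists>!f. f \<in> hom M (H t) A" if A: "A \<in> Obj M" for A
  proof -
    obtain x where x: "x \<in> on_obj A t" using model_terminal[OF A t] by blast
    show ?thesis
    proof (rule ex1I[of _ "yon A t x"])
      show "yon A t x \<in> hom M (H t) A" by (rule yon_hom[OF A tO x])
      fix f assume f: "f \<in> hom M (H t) A"
      have "app f t (ident T t) = app (yon A t x) t (ident T t)"
        using app_ident_H_in[OF f tO] app_ident_H_in[OF yon_hom[OF A tO x] tO] 
        by (rule ex1_eqD[OF model_terminal[OF A t]])
      then show "f = yon A t x" by (rule yon_eqI[OF f yon_hom[OF A tO x] tO])
    qed
  qed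
  then show ?thesis using H_model[OF tO] by (simp add: initial_def)
qed

text \<open>The arrow from \<Gamma> to a terminal object is a display map, and
  \<open>hom_trans\<close> turns it into the map from the initial model to
  \<open>H \<Gamma>\<close>.\<close>

lemma zero_extension_H:
  assumes \<Gamma>: "\<Gamma> \<in> Obj T" shows "zero_extension M (extensions \<kappa> T Disp) (H \<Gamma>)"
proof -
  obtain t where t: "terminal T t" using terminal_exists ..
  then obtain p where p: "p \<in> hom T \<Gamma> t" using \<Gamma> by (auto simp: terminal_def)
  then have "p \<in> Disp" using terminal_Disp[OF t, of p] by (simp add: hom_def)
  then show ?thesis
    using initial_H[OF t] hom_trans_hom[OF p] hom_trans_extension H_model[OF \<Gamma>]
    unfolding zero_extension_def by blast
qed

text \<open>The obstacle to a pointwise quotient is that two classes may agree over the base of a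
  pullback although the given representatives do not. \<open>full_lift\<close> removes it and serves
  again for fullness of the quotient map.\<close>

lemma full_quotients:
  assumes p: "p \<in> full_maps \<kappa> T Disp" and q: "q \<in> full_maps \<kappa> T Disp"
    and eqr: "equivalence_relation M p q"
  obtains e where "is_coequalizer M p q e" "is_pullback M e e p q" "e \<in> full_maps \<kappa> T Disp"
proof -
  define R where "R = nsrc p"
  define A where "A = ntrg p"
  have ph: "p \<in> hom M R A" using full_maps_hom[OF p] by (simp add: R_def A_def)
  have qh: "q \<in> hom M R A" using full_maps_hom[OF q] eqr by (simp add: R_def A_def equivalence_relation_def)
  have mono: "x = y" if "x \<in> hom M X R" "y \<in> hom M X R" "p \<cdot>\<^bsub>M\<^esub> x = p \<cdot>\<^bsub>M\<^esub> y" "q \<cdot>\<^bsub>M\<^esub> x = q \<cdot>\<^bsub>M\<^esub> y" for X x y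
    using eqr that unfolding equivalence_relation_def by (simp add: R_def)
  have equ: "equiv (hom M X A) {(p \<cdot>\<^bsub>M\<^esub> x, q \<cdot>\<^bsub>M\<^esub> x) |x. x \<in> hom M X R}" if "X \<in> Obj M" for X
    using eqr that unfolding equivalence_relation_def R_def A_def Mod_simps by blast
  note RA = hom_Obj[OF ph]
  define E where "E \<Gamma> x y \<longleftrightarrow> (\<exists>r\<in>on_obj R \<Gamma>. app p \<Gamma> r = x \<and> app q \<Gamma> r = y)" for \<Gamma> x y
  have E_in: "x \<in> on_obj A \<Gamma> \<and> y \<in> on_obj A \<Gamma>" if "\<Gamma> \<in> Obj T" "E \<Gamma> x y" for \<Gamma> x y
    using that app_in[OF ph] app_in[OF qh] by (auto simp: E_def)
  have cmp_yon: "h \<cdot>\<^bsub>M\<^esub> yon R \<Gamma> r = yon A \<Gamma> (app h \<Gamma> r)" 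
    if h: "h \<in> hom M R A" and \<Gamma>: "\<Gamma> \<in> Obj T" and r: "r \<in> on_obj R \<Gamma>" for h \<Gamma> r
    using app_cmp[OF yon_hom[OF RA(1) \<Gamma> r] h \<Gamma>] ident_hom[OF \<Gamma>]
    by (intro yon_eqI[OF Mod.cmp_hom[OF yon_hom[OF RA(1) \<Gamma> r] h] yon_hom[OF RA(2) \<Gamma> app_in[OF h \<Gamma> r]] \<Gamma>])
      (simp add: app_yon_ident RA \<Gamma> r app_in[OF h \<Gamma> r] H_obj)
  \<comment> \<open>The hypothesis at the test object \<open>H \<Gamma>\<close>. Yoneda transfers it
    to the elements over \<Gamma>, where it makes \<open>E \<Gamma>\<close> an equivalence
    relation.\<close>
  define rl where "rl \<Gamma> = {(p \<cdot>\<^bsub>M\<^esub> k, q \<cdot>\<^bsub>M\<^esub> k) |k. k \<in> hom M (H \<Gamma>) R}" for \<Gamma>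
  have equ_rl: "equiv (hom M (H \<Gamma>) A) (rl \<Gamma>)" if "\<Gamma> \<in> Obj T" for \<Gamma>
    unfolding rl_def by (rule equ[OF H_model[OF that]])
  have rel: "(yon A \<Gamma> x, yon A \<Gamma> y) \<in> rl \<Gamma> \<longleftrightarrow> E \<Gamma> x y"
    if \<Gamma>: "\<Gamma> \<in> Obj T" and x: "x \<in> on_obj A \<Gamma>" and y: "y \<in> on_obj A \<Gamma>" for \<Gamma> x y
  proof
    assume "E \<Gamma> x y"
    then obtain r where r: "r \<in> on_obj R \<Gamma>" "app p \<Gamma> r = x" "app q \<Gamma> r = y" by (auto simp: E_def)
    then show "(yon A \<Gamma> x, yon A \<Gamma> y) \<in> rl \<Gamma>"
      using cmp_yon[OF ph \<Gamma> r(1)] cmp_yon[OF qh \<Gamma> r(1)] yon_hom[OF RA(1) \<Gamma> r(1)]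
      by (auto simp: rl_def intro!: exI[of _ "yon R \<Gamma> r"])
  next
    assume "(yon A \<Gamma> x, yon A \<Gamma> y) \<in> rl \<Gamma>"
    then obtain k where k: "k \<in> hom M (H \<Gamma>) R" "yon A \<Gamma> x = p \<cdot>\<^bsub>M\<^esub> k" "yon A \<Gamma> y = q \<cdot>\<^bsub>M\<^esub> k" by (auto simp: rl_def)
    have i: "ident T \<Gamma> \<in> on_obj (H \<Gamma>) \<Gamma>" using \<Gamma> ident_hom by (simp add: H_obj)
    show "E \<Gamma> x y" unfolding E_def
    proof (intro bexI conjI)
      show "app p \<Gamma> (app k \<Gamma> (ident T \<Gamma>)) = x"
        using app_cmp[OF k(1) ph \<Gamma> i] app_yon_ident[OF RA(2) \<Gamma> x] k(2) by simp
      show "app q \<Gamma> (app k \<Gamma> (ident T \<Gamma>)) = y"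
        using app_cmp[OF k(1) qh \<Gamma> i] app_yon_ident[OF RA(2) \<Gamma> y] k(3) by simp
      show "app k \<Gamma> (ident T \<Gamma>) \<in> on_obj R \<Gamma>" by (rule app_in[OF k(1) \<Gamma> i])
    qed
  qed
  have Erefl: "E \<Gamma> x x" if "\<Gamma> \<in> Obj T" "x \<in> on_obj A \<Gamma>" for \<Gamma> x
    using equiv_class_self[OF equ_rl[OF that(1)] yon_hom[OF RA(2) that]] rel[OF that that(2)] by blast
  have E_sym: "E \<Gamma> y x" if "\<Gamma> \<in> Obj T" "E \<Gamma> x y" for \<Gamma> x y
  proof -
    have "sym (rl \<Gamma>)" 
      using equ_rl[OF that(1)] by (rule equivE)
    from symD[OF this] show ?thesis using rel[OF that(1)] E_in[OF that] that(2) by blast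
  qed
  have E_trans: "E \<Gamma> x z" if "\<Gamma> \<in> Obj T" "E \<Gamma> x y" "E \<Gamma> y z" for \<Gamma> x y z
  proof -
    have "trans (rl \<Gamma>)" 
      using equ_rl[OF that(1)] by (rule equivE)
    from transD[OF this, of "yon A \<Gamma> x" "yon A \<Gamma> y" "yon A \<Gamma> z"] show ?thesis
      using rel[OF that(1)] E_in[OF that(1,2)] E_in[OF that(1,3)] that(2,3) by blast
  qed
  \<comment> \<open>Joint monicity tested on maps out of representables: \<open>p\<close> and
    \<open>q\<close> are jointly injective on elements.\<close>
  have joint: "r = s" if \<Gamma>: "\<Gamma> \<in> Obj T" and r: "r \<in> on_obj R \<Gamma>" and s: "s \<in> on_obj R \<Gamma>" 
    and "app p \<Gamma> r = app p \<Gamma> s" "app q \<Gamma> r = app q \<Gamma> s" for \<Gamma> r s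
  proof -
    have "yon R \<Gamma> r = yon R \<Gamma> s"
      using that by (intro mono[OF yon_hom yon_hom]) (simp_all add: RA cmp_yon ph qh)
    then show ?thesis using app_yon_ident[OF RA(1) \<Gamma>] r s by metis
  qed
  have Eact: "E (trg T f) (act A f x) (act A f y)" if f: "f \<in> Arr T" and xy: "E (src T f) x y" for f x y
    using xy act_in[OF RA(1) f] app_nat[OF ph f] app_nat[OF qh f] unfolding E_def by metis
  \<comment> \<open>A witness relating \<open>x\<close> to \<open>act A d y\<close> is lifted along
    \<open>d\<close>, by fullness of \<open>q\<close>, to a witness with second leg
    \<open>y\<close>. Its first leg \<open>y'\<close> is then equivalent to \<open>y\<close> and
    lies over \<open>x\<close> exactly.\<close>
  have full_lift: "\<exists>y'. E (src T d) y' y \<and> act A d y' = x" 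
    if d: "d \<in> Disp" and y: "y \<in> on_obj A (src T d)" and E: "E (trg T d) x (act A d y)" for d x y
  proof -
    have dA: "d \<in> Arr T" using d Disp_Arr by blast
    obtain r where r: "r \<in> on_obj R (trg T d)" "app p (trg T d) r = x" "app q (trg T d) r = act A d y"
      using E by (auto simp: E_def)
    obtain r' where r': "r' \<in> on_obj R (src T d)" "act R d r' = r" "app q (src T d) r' = y"
      using q[unfolded full_maps_iff[OF qh]] d r y by blast
    then show ?thesis
      using app_nat[OF ph dA r'(1)] r by (auto simp: E_def intro!: exI[of _ "app p (src T d) r'"])
  qed
  interpret setoid_model T \<kappa> Disp E "act A"
  proof
    show "|{x. E \<Gamma> x x}| <o \<kappa>" if "\<Gamma> \<in> Obj T" for \<Gamma>
      by (rule small_subset[OF _ model_small[OF RA(2) that]]) (use E_in that in blast)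
    show "E \<Gamma> (act A (ident T \<Gamma>) x) x" if "\<Gamma> \<in> Obj T" "E \<Gamma> x x" for \<Gamma> x
      using act_ident[OF RA(2) that(1)] E_in that by auto
    show "E (trg T g) (act A (g \<cdot> f) x) (act A g (act A f x))" 
      if "f \<in> Arr T" "g \<in> Arr T" "src T g = trg T f" "E (src T f) x x" for f g x
      using act_cmp[OF RA(2) that(1-3)] Eact[OF that(2) Eact[OF that(1,4), folded that(3)]] E_in[OF src_Obj that(4)] that(1) by simp
    show "(\<exists>x. E t x x) \<and> (\<forall>x y. E t x x \<longrightarrow> E t y y \<longrightarrow> E t x y)" if "terminal T t" for t
    proof -
      have t: "t \<in> Obj T" using that by (simp add: terminal_def)
      show ?thesis using model_terminal[OF RA(2) that] Erefl[OF t] E_in[OF t] by blast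
    qed
    show "\<exists>z. E (src T d') z z \<and> E (src T f) (act A d' z) x \<and> E (src T d) (act A f' z) y"
      if d: "d \<in> Disp" and pb: "is_pullback T f d d' f'" and x: "E (src T f) x x" and y: "E (src T d) y y" 
        and xy: "E (trg T f) (act A f x) (act A d y)" for f d d' f' x y
    proof -
      note D = pullbackD[OF pb]
      have xA: "x \<in> on_obj A (src T f)" and yA: "y \<in> on_obj A (src T d)" 
        using E_in x y src_Obj D by blast+
      obtain y' where y': "E (src T d) y' y" "act A d y' = act A f x"
        using full_lift[OF d yA xy[unfolded D(5)]] by blast
      have "y' \<in> on_obj A (src T d)" using E_in[OF src_Obj[OF D(2)] y'(1)] by blast
      from model_pullback[OF RA(2) d pb xA this y'(2)[symmetric]]
      obtain z where "z \<in> on_obj A (src T d')" "act A d' z = x" "act A f' z = y'" by blast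
      then show ?thesis using Erefl[OF src_Obj[OF D(3)]] x y'(1) by blast
    qed
    show "E (src T d') x y" 
      if d: "d \<in> Disp" and pb: "is_pullback T f d d' f'" and x: "E (src T d') x x" and y: "E (src T d') y y" 
        and xy1: "E (src T f) (act A d' x) (act A d' y)" and xy2: "E (src T d) (act A f' x) (act A f' y)" for f d d' f' x y
    proof -
      note D = pullbackD[OF pb]
      note O = src_Obj[OF D(3)] trg_Obj[OF D(1)]
      have xA: "x \<in> on_obj A (src T d')" and yA: "y \<in> on_obj A (src T d')" using E_in x y O by blast+
      obtain r where r: "r \<in> on_obj R (src T f)" "app p (src T f) r = act A d' x" "app q (src T f) r = act A d' y"
        using xy1 by (auto simp: E_def)
      obtain s where s: "s \<in> on_obj R (src T d)" "app p (src T d) s = act A f' x" "app q (src T d) s = act A f' y"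
        using xy2 by (auto simp: E_def)
      have comm: "act A f (act A d' z) = act A d (act A f' z)" if "z \<in> on_obj A (src T d')" for z
        using act_cmp[OF RA(2) D(3,1), of z] act_cmp[OF RA(2) D(4,2), of z] that D by simp
      \<comment> \<open>Over the base the two witnesses have the same legs, hence agree by
        \<open>joint\<close>. They glue to an element \<open>z\<close> of \<open>R\<close>, and the
        legs of \<open>z\<close> turn out to be \<open>x\<close> and \<open>y\<close>.\<close>
      have "act R f r = act R d s"
      proof (rule joint[OF O(2)])
        show "act R f r \<in> on_obj R (trg T f)" by (rule act_in[OF RA(1) D(1) r(1)])
        show "act R d s \<in> on_obj R (trg T f)" using act_in[OF RA(1) D(2) s(1)] D(5) by simp
        show "app p (trg T f) (act R f r) = app p (trg T f) (act R d s)"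
          unfolding app_nat[OF ph D(1) r(1)] r(2) comm[OF xA] s(2)[symmetric] using app_nat[OF ph D(2) s(1)] D(5) by simp
        show "app q (trg T f) (act R f r) = app q (trg T f) (act R d s)"
          unfolding app_nat[OF qh D(1) r(1)] r(3) comm[OF yA] s(3)[symmetric] using app_nat[OF qh D(2) s(1)] D(5) by simp
      qed
      from model_pullback[OF RA(1) d pb r(1) s(1) this]
      obtain z where z: "z \<in> on_obj R (src T d')" "act R d' z = r" "act R f' z = s" by blast
      have eqI: "app h (src T d') z = w" 
        if h: "h \<in> hom M R A" and w: "w \<in> on_obj A (src T d')"
          and "app h (src T f) r = act A d' w" "app h (src T d) s = act A f' w" for h w
      proof -
        have w1: "act A d' w \<in> on_obj A (src T f)" "act A f' w \<in> on_obj A (src T d)"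
          using act_in[OF RA(2) D(3) w] act_in[OF RA(2) D(4), of w] w D by simp_all
        show ?thesis
        proof (rule ex1_eqD[OF model_pullback[OF RA(2) d pb w1 comm[OF w]]])
          show "app h (src T d') z \<in> on_obj A (src T d') \<and> act A d' (app h (src T d') z) = act A d' w \<and>
            act A f' (app h (src T d') z) = act A f' w"
            using app_in[OF h O(1) z(1)] app_nat[OF h D(3) z(1)] app_nat[OF h D(4), of z] z D that(3,4) by simp
        qed (use w in simp)
      qed
      show ?thesis
        unfolding E_def using eqI[OF ph xA r(2) s(2)] eqI[OF qh yA r(3) s(3)] z(1) by blast
    qed
  qed (use E_sym E_trans Eact in blast)+
  let ?e = "mk_trans T A quot cls"
  have e: "?e \<in> hom M A quot"
    by (rule mk_trans_hom(1)[OF RA(2) quot_model]) (use cls_in Erefl quot_act src_Obj in auto)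
  have app_e: "app ?e \<Gamma> x = cls \<Gamma> x" if "\<Gamma> \<in> Obj T" "x \<in> on_obj A \<Gamma>" for \<Gamma> x
    by (rule mk_trans_hom(2)[OF RA(2) quot_model]) (use cls_in Erefl quot_act src_Obj that in auto)
  have app_e_eq: "app ?e \<Gamma> x = app ?e \<Gamma> y \<longleftrightarrow> E \<Gamma> x y" if "\<Gamma> \<in> Obj T" "x \<in> on_obj A \<Gamma>" "y \<in> on_obj A \<Gamma>" for \<Gamma> x y
    using that by (simp add: app_e cls_eq_iff Erefl)
  have ep: "?e \<cdot>\<^bsub>M\<^esub> p = ?e \<cdot>\<^bsub>M\<^esub> q"
  proof (rule Mod_hom_eqI[OF Mod.cmp_hom[OF ph e] Mod.cmp_hom[OF qh e]])
    fix \<Gamma> x assume x: "\<Gamma> \<in> Obj T" "x \<in> on_obj R \<Gamma>"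
    then show "app (?e \<cdot>\<^bsub>M\<^esub> p) \<Gamma> x = app (?e \<cdot>\<^bsub>M\<^esub> q) \<Gamma> x"
      unfolding app_cmp[OF ph e x] app_cmp[OF qh e x]
      by (subst app_e_eq) (auto simp: E_def app_in[OF ph] app_in[OF qh])
  qed
  have ends: "src M p = R" "src M q = R" "trg M p = A" "trg M q = A" "src M ?e = A" "trg M ?e = quot"
    using homD[OF ph] homD[OF qh] homD[OF e] by auto
  have "is_coequalizer M p q ?e"
    unfolding is_coequalizer_def ends
  proof (intro conjI allI ballI impI)
    fix X x assume x: "x \<in> hom M A X" and eq: "x \<cdot>\<^bsub>M\<^esub> p = x \<cdot>\<^bsub>M\<^esub> q"
    have resp: "app x \<Gamma> a = app x \<Gamma> b" if "\<Gamma> \<in> Obj T" "E \<Gamma> a b" for \<Gamma> a b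
      using that app_cmp[OF ph x that(1)] app_cmp[OF qh x that(1)] eq by (auto simp: E_def)
    obtain h where h: "h \<in> hom M quot X" "\<And>\<Gamma> a. \<Gamma> \<in> Obj T \<Longrightarrow> E \<Gamma> a a \<Longrightarrow> app h \<Gamma> (cls \<Gamma> a) = app x \<Gamma> a"
    proof (rule quot_hom[OF hom_Obj(2)[OF x], of "app x"])
      show "app x \<Gamma> a = app x \<Gamma> b" if "\<Gamma> \<in> Obj T" "E \<Gamma> a b" for \<Gamma> a b by (rule resp[OF that])
      show "app x \<Gamma> a \<in> on_obj X \<Gamma>" if "\<Gamma> \<in> Obj T" "E \<Gamma> a a" for \<Gamma> a
        using app_in[OF x that(1)] E_in[OF that] by blast
      show "app x (trg T f) (act A f a) = act X f (app x (src T f) a)" if "f \<in> Arr T" "E (src T f) a a" for f a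
        using app_nat[OF x that(1)] E_in[OF src_Obj[OF that(1)] that(2)] by blast
    next
      fix h assume "h \<in> hom M quot X" "\<And>\<Gamma> a. \<Gamma> \<in> Obj T \<Longrightarrow> E \<Gamma> a a \<Longrightarrow> app h \<Gamma> (cls \<Gamma> a) = app x \<Gamma> a"
      then show thesis by (rule that)
    qed
    show "\<exists>!h. h \<in> hom M quot X \<and> h \<cdot>\<^bsub>M\<^esub> ?e = x"
    proof (rule ex1I[of _ h], intro conjI h(1))
      show "h \<cdot>\<^bsub>M\<^esub> ?e = x"
      proof (rule Mod_hom_eqI[OF Mod.cmp_hom[OF e h(1)] x])
        fix \<Gamma> a assume a: "\<Gamma> \<in> Obj T" "a \<in> on_obj A \<Gamma>"
        show "app (h \<cdot>\<^bsub>M\<^esub> ?e) \<Gamma> a = app x \<Gamma> a"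
          unfolding app_cmp[OF e h(1) a] app_e[OF a] by (rule h(2)[OF a(1) Erefl[OF a]])
      qed
      fix k assume k: "k \<in> hom M quot X \<and> k \<cdot>\<^bsub>M\<^esub> ?e = x"
      show "k = h"
      proof (rule quot_hom_eqI[OF _ h(1)])
        fix \<Gamma> a assume a: "\<Gamma> \<in> Obj T" "E \<Gamma> a a"
        then have aA: "a \<in> on_obj A \<Gamma>" using E_in by blast
        show "app k \<Gamma> (cls \<Gamma> a) = app h \<Gamma> (cls \<Gamma> a)"
          using app_cmp[OF e _ a(1) aA, of k] k app_e[OF a(1) aA] h(2)[OF a] by auto
      qed (use k in simp)
    qed
  qed (use homD[OF ph] homD[OF qh] homD[OF e] ep in auto)
  moreover have "is_pullback M ?e ?e p q"
    unfolding is_pullback_def ends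
  proof (intro conjI allI ballI impI)
    fix X x y assume x: "x \<in> hom M X A" and y: "y \<in> hom M X A" and eq: "?e \<cdot>\<^bsub>M\<^esub> x = ?e \<cdot>\<^bsub>M\<^esub> y"
    have Exy: "E \<Gamma> (app x \<Gamma> a) (app y \<Gamma> a)" if a: "\<Gamma> \<in> Obj T" "a \<in> on_obj X \<Gamma>" for \<Gamma> a
      using app_cmp[OF x e a] app_cmp[OF y e a] eq app_e_eq[OF a(1) app_in[OF x a] app_in[OF y a]] by simp
    \<comment> \<open>Chosen witnesses for the equivalence of the two values. By
      \<open>joint\<close> each witness is unique, which makes the choice natural.\<close>
    define \<phi> where "\<phi> \<Gamma> a = (SOME r. r \<in> on_obj R \<Gamma> \<and> app p \<Gamma> r = app x \<Gamma> a \<and> app q \<Gamma> r = app y \<Gamma> a)" for \<Gamma> a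
    have \<phi>: "\<phi> \<Gamma> a \<in> on_obj R \<Gamma> \<and> app p \<Gamma> (\<phi> \<Gamma> a) = app x \<Gamma> a \<and> app q \<Gamma> (\<phi> \<Gamma> a) = app y \<Gamma> a" 
      if "\<Gamma> \<in> Obj T" "a \<in> on_obj X \<Gamma>" for \<Gamma> a
      unfolding \<phi>_def by (rule someI_ex) (use Exy[OF that] in \<open>auto simp: E_def\<close>)
    have 1: "\<phi> (trg T f) (act X f a) = act R f (\<phi> (src T f) a)" if f: "f \<in> Arr T" and a: "a \<in> on_obj X (src T f)" for f a
    proof (rule joint[OF trg_Obj[OF f]])
      note * = \<phi>[OF src_Obj[OF f] a] and ** = \<phi>[OF trg_Obj[OF f] act_in[OF hom_Obj(1)[OF x] f a]]
      show "\<phi> (trg T f) (act X f a) \<in> on_obj R (trg T f)" using ** by blast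
      show "act R f (\<phi> (src T f) a) \<in> on_obj R (trg T f)" using act_in[OF RA(1) f] * by blast
      show "app p (trg T f) (\<phi> (trg T f) (act X f a)) = app p (trg T f) (act R f (\<phi> (src T f) a))"
        using ** * app_nat[OF ph f, of "\<phi> (src T f) a"] app_nat[OF x f a] by simp
      show "app q (trg T f) (\<phi> (trg T f) (act X f a)) = app q (trg T f) (act R f (\<phi> (src T f) a))"
        using ** * app_nat[OF qh f, of "\<phi> (src T f) a"] app_nat[OF y f a] by simp
    qed
    let ?h = "mk_trans T X R \<phi>"
    have h: "?h \<in> hom M X R" by (rule mk_trans_hom(1)[OF hom_Obj(1)[OF x] RA(1)]) (use \<phi> 1 in auto)
    have app_h: "app ?h \<Gamma> a = \<phi> \<Gamma> a" if "\<Gamma> \<in> Obj T" "a \<in> on_obj X \<Gamma>" for \<Gamma> a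
      by (rule mk_trans_hom(2)[OF hom_Obj(1)[OF x] RA(1)]) (use \<phi> 1 that in auto)
    show "\<exists>!h. h \<in> hom M X R \<and> p \<cdot>\<^bsub>M\<^esub> h = x \<and> q \<cdot>\<^bsub>M\<^esub> h = y"
    proof (rule ex1I[of _ ?h], intro conjI h)
      show "p \<cdot>\<^bsub>M\<^esub> ?h = x"
        by (rule Mod_hom_eqI[OF Mod.cmp_hom[OF h ph] x]) (simp add: app_cmp[OF h ph] app_h \<phi>)
      show "q \<cdot>\<^bsub>M\<^esub> ?h = y"
        by (rule Mod_hom_eqI[OF Mod.cmp_hom[OF h qh] y]) (simp add: app_cmp[OF h qh] app_h \<phi>)
      then show "k = ?h" if "k \<in> hom M X R \<and> p \<cdot>\<^bsub>M\<^esub> k = x \<and> q \<cdot>\<^bsub>M\<^esub> k = y" for k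
        using that \<open>p \<cdot>\<^bsub>M\<^esub> ?h = x\<close> by (intro mono[OF _ h]) auto
    qed
  qed (use homD[OF ph] homD[OF qh] homD[OF e] ep in auto)
  moreover have "?e \<in> full_maps \<kappa> T Disp"
    unfolding full_maps_iff[OF e]
  proof (intro ballI impI)
    fix d a b assume d: "d \<in> Disp" and a: "a \<in> on_obj A (trg T d)" and b: "b \<in> on_obj quot (src T d)"
      and ab: "app ?e (trg T d) a = act quot d b"
    have dA: "d \<in> Arr T" using d Disp_Arr by blast
    obtain b' where b': "E (src T d) b' b'" "b = cls (src T d) b'" by (rule quot_cases[OF src_Obj[OF dA] b])
    have b'A: "b' \<in> on_obj A (src T d)" using E_in[OF src_Obj[OF dA] b'(1)] by blast
    \<comment> \<open>With this, \<open>full_lift\<close> moves the representative \<open>b'\<close>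
      within its class so that it lies over \<open>a\<close>.\<close>
    have "E (trg T d) a (act A d b')"
      using ab a unfolding b'(2) quot_act[OF dA b'(1)] app_e[OF trg_Obj[OF dA] a]
      using cls_eq_iff[OF trg_Obj[OF dA] Erefl[OF trg_Obj[OF dA] a] Eact[OF dA b'(1)]] by blast
    then obtain y' where y': "E (src T d) y' b'" "act A d y' = a" using full_lift[OF d b'A] by blast
    have "y' \<in> on_obj A (src T d)" using E_in[OF src_Obj[OF dA] y'(1)] by blast
    then show "\<exists>c\<in>on_obj A (src T d). act A d c = a \<and> app ?e (src T d) c = b"
      using y' app_e[OF src_Obj[OF dA]] cls_cong[OF src_Obj[OF dA] y'(1)] b'(2) by auto
  qed
  ultimately show thesis by (rule that)
qed

end

section \<open>Filtered categories and cocompleteness\<close>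

lemma filteredD:
  assumes "filtered J"
  shows "category J" "Obj J \<noteq> {}"
    and "i \<in> Obj J \<Longrightarrow> j \<in> Obj J \<Longrightarrow> \<exists>k a b. a \<in> hom J i k \<and> b \<in> hom J j k"
    and "a \<in> hom J i j \<Longrightarrow> b \<in> hom J i j \<Longrightarrow> \<exists>k d. d \<in> hom J j k \<and> d \<cdot>\<^bsub>J\<^esub> a = d \<cdot>\<^bsub>J\<^esub> b"
proof -
  show "category J" "Obj J \<noteq> {}" using assms by (auto simp: filtered_def)
  show "\<exists>k a b. a \<in> hom J i k \<and> b \<in> hom J j k" if "i \<in> Obj J" "j \<in> Obj J"
    using assms that unfolding filtered_def by (meson all_not_in_conv)
  show "\<exists>k d. d \<in> hom J j k \<and> d \<cdot>\<^bsub>J\<^esub> a = d \<cdot>\<^bsub>J\<^esub> b" if "a \<in> hom J i j" "b \<in> hom J i j"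
  proof -
    have "\<exists>d\<in>Arr J. src J d = trg J a \<and> d \<cdot>\<^bsub>J\<^esub> a = d \<cdot>\<^bsub>J\<^esub> b"
    proof -
      have "\<forall>a\<in>Arr J. \<forall>b\<in>Arr J. src J a = src J b \<and> trg J a = trg J b \<longrightarrow>
          (\<exists>d\<in>Arr J. src J d = trg J a \<and> d \<cdot>\<^bsub>J\<^esub> a = d \<cdot>\<^bsub>J\<^esub> b)"
        using assms unfolding filtered_def by (elim conjE)
      from this[rule_format, OF homD(1)[OF that(1)] homD(1)[OF that(2)]]
      show ?thesis using homD[OF that(1)] homD[OF that(2)] by simp
    qed
    then show ?thesis using homD(3)[OF that(1)] by (auto simp: hom_def)
  qed
qed

text \<open>First \<open>j\<close> and \<open>k\<close> are sent to a common object; the two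
  composites from \<open>i\<close> are then parallel and can be equalized.\<close>

lemma filtered_amalgamate:
  assumes J: "filtered J" and a: "a \<in> hom J i j" and b: "b \<in> hom J i k"
  obtains l u v where "u \<in> hom J j l" "v \<in> hom J k l" "u \<cdot>\<^bsub>J\<^esub> a = v \<cdot>\<^bsub>J\<^esub> b"
proof -
  interpret category J by (rule filteredD(1)[OF J])
  have "j \<in> Obj J" "k \<in> Obj J" using a b trg_Obj by (auto simp: hom_def)
  then obtain m u v where uv: "u \<in> hom J j m" "v \<in> hom J k m" using filteredD(3)[OF J] by blast
  then obtain l d where d: "d \<in> hom J m l" "d \<cdot>\<^bsub>J\<^esub> (u \<cdot>\<^bsub>J\<^esub> a) = d \<cdot>\<^bsub>J\<^esub> (v \<cdot>\<^bsub>J\<^esub> b)"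
    using filteredD(4)[OF J] cmp_hom a b by meson
  show thesis
    by (rule that[of "d \<cdot>\<^bsub>J\<^esub> u" l "d \<cdot>\<^bsub>J\<^esub> v"])
      (use uv d a b in \<open>auto intro: cmp_hom simp flip: cmp_assoc\<close>)
qed

text \<open>By induction on \<open>S\<close>: the arrow found for the new condition and the one
  found for the others are amalgamated under \<open>j\<close>, and stability carries all conditions
  forward. This is where finiteness of a presentation meets filteredness.\<close>

lemma filtered_common:
  assumes J: "filtered J" and j: "j \<in> Obj J" and "finite S"
    and ex: "\<And>q. q \<in> S \<Longrightarrow> \<exists>k. \<exists>a\<in>hom J j k. P q a"
    and stable: "\<And>q k l a b. q \<in> S \<Longrightarrow> P q a \<Longrightarrow> a \<in> hom J j k \<Longrightarrow> b \<in> hom J k l \<Longrightarrow> P q (b \<cdot>\<^bsub>J\<^esub> a)"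
  obtains k a where "a \<in> hom J j k" "\<And>q. q \<in> S \<Longrightarrow> P q a"
proof -
  interpret category J by (rule filteredD(1)[OF J])
  have "\<exists>k. \<exists>a\<in>hom J j k. \<forall>q\<in>S. P q a"
    using \<open>finite S\<close> ex stable
  proof (induction S)
    case empty
    then show ?case using ident_hom[OF j] by blast
  next
    case (insert q S)
    then obtain k a where a: "a \<in> hom J j k" "\<forall>q\<in>S. P q a" by (metis insert_iff)
    obtain l b where b: "b \<in> hom J j l" "P q b" using insert.prems(1)[of q] by blast
    obtain m u v where uv: "u \<in> hom J k m" "v \<in> hom J l m" "u \<cdot>\<^bsub>J\<^esub> a = v \<cdot>\<^bsub>J\<^esub> b"
      by (rule filtered_amalgamate[OF J a(1) b(1)])
    have "P q' (u \<cdot>\<^bsub>J\<^esub> a)" if q': "q' \<in> insert q S" for q'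
    proof (cases "q' = q")
      case True
      then show ?thesis using insert.prems(2)[of q, OF _ b(2,1) uv(2)] uv(3) by simp
    next
      case False
      then show ?thesis using insert.prems(2)[of q', OF q' _ a(1) uv(1)] a(2) q' by blast
    qed
    then show ?case using cmp_hom[OF a(1) uv(1)] by blast
  qed
  then show thesis using that by blast
qed

text \<open>The usual recognition of filtered colimits of sets. Injectivity is asked within a single
  stage only, since elements of different stages can first be moved to a common one.\<close>

lemma filtered_set_colimit:
  assumes J: "filtered J"
    and F_arr: "\<And>a. a \<in> Arr J \<Longrightarrow> on_arr F a \<in> hom (set_cat UNIV) (on_obj F (src J a)) (on_obj F (trg J a))"
    and c: "\<And>j. j \<in> Obj J \<Longrightarrow> c j \<in> hom (set_cat UNIV) (on_obj F j) z"
    and nat: "\<And>a x. a \<in> Arr J \<Longrightarrow> x \<in> on_obj F (src J a) \<Longrightarrow>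
      fmap (c (trg J a)) (fmap (on_arr F a) x) = fmap (c (src J a)) x"
    and surj: "\<And>h. h \<in> z \<Longrightarrow> \<exists>j\<in>Obj J. \<exists>x\<in>on_obj F j. fmap (c j) x = h"
    and inj: "\<And>j x y. j \<in> Obj J \<Longrightarrow> x \<in> on_obj F j \<Longrightarrow> y \<in> on_obj F j \<Longrightarrow> fmap (c j) x = fmap (c j) y \<Longrightarrow>
      \<exists>k. \<exists>a\<in>hom J j k. fmap (on_arr F a) x = fmap (on_arr F a) y"
  shows "is_colimit J (set_cat UNIV) F z c"
proof -
  interpret category J by (rule filteredD(1)[OF J])
  have F_in: "fmap (on_arr F a) x \<in> on_obj F k" if "a \<in> hom J j k" "x \<in> on_obj F j" for a j k x
    using that F_arr[of a] set_cat_app_in by (auto simp: hom_def[of J])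
  have natural: "fmap (d k) (fmap (on_arr F a) x) = fmap (d j) x"
    if d: "is_cocone J (set_cat UNIV) F y d" and a: "a \<in> hom J j k" and x: "x \<in> on_obj F j" for y d a j k x
  proof -
    have "d k \<cdot>\<^bsub>set_cat UNIV\<^esub> on_arr F a = d j" using d a by (auto simp: is_cocone_def hom_def[of J])
    then show ?thesis using set_cat_app_cmp[of "on_arr F a" UNIV "on_obj F j" "on_obj F k" x "d k"] F_arr[of a] a x
      by (auto simp: hom_def[of J])
  qed
  have cocone: "is_cocone J (set_cat UNIV) F z c"
    unfolding is_cocone_def
  proof (intro conjI ballI)
    show "c (trg J a) \<cdot>\<^bsub>set_cat UNIV\<^esub> on_arr F a = c (src J a)" if a: "a \<in> Arr J" for a
      by (rule set_cat_cmp_eqI[OF F_arr[OF a] c[OF trg_Obj[OF a]] c[OF src_Obj[OF a]]]) (rule nat[OF a])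
  qed (auto simp: c)
  have "\<exists>!h. h \<in> hom (set_cat UNIV) z y \<and> (\<forall>j\<in>Obj J. h \<cdot>\<^bsub>set_cat UNIV\<^esub> c j = d j)"
    if d: "is_cocone J (set_cat UNIV) F y d" for y d
  proof -
    have dh: "d j \<in> hom (set_cat UNIV) (on_obj F j) y" if "j \<in> Obj J" for j using d that by (simp add: is_cocone_def)
    \<comment> \<open>Both elements are moved to a common stage \<open>k\<close>, where
      \<open>inj\<close> applies; so the value of \<open>d\<close> depends only on the point of
      \<open>z\<close>.\<close>
    have wd: "fmap (d i) x = fmap (d j) x'"
      if i: "i \<in> Obj J" "x \<in> on_obj F i" and j: "j \<in> Obj J" "x' \<in> on_obj F j" and eq: "fmap (c i) x = fmap (c j) x'" for i j x x'
    proof -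
      obtain k a b where ab: "a \<in> hom J i k" "b \<in> hom J j k" using filteredD(3)[OF J i(1) j(1)] by blast
      have k: "k \<in> Obj J" using ab trg_Obj by (auto simp: hom_def)
      have "fmap (c k) (fmap (on_arr F a) x) = fmap (c k) (fmap (on_arr F b) x')"
        using natural[OF cocone ab(1) i(2)] natural[OF cocone ab(2) j(2)] eq by simp
      then obtain l e where e: "e \<in> hom J k l" "fmap (on_arr F e) (fmap (on_arr F a) x) = fmap (on_arr F e) (fmap (on_arr F b) x')"
        using inj[OF k F_in[OF ab(1) i(2)] F_in[OF ab(2) j(2)]] by blast
      have "fmap (d i) x = fmap (d l) (fmap (on_arr F e) (fmap (on_arr F a) x))"
        using natural[OF d ab(1) i(2)] natural[OF d e(1) F_in[OF ab(1) i(2)]] by simp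
      also have "\<dots> = fmap (d j) x'"
        using natural[OF d ab(2) j(2)] natural[OF d e(1) F_in[OF ab(2) j(2)]] e(2) by simp
      finally show ?thesis .
    qed
    define \<phi> where "\<phi> h = (SOME v. \<exists>j\<in>Obj J. \<exists>x\<in>on_obj F j. fmap (c j) x = h \<and> v = fmap (d j) x)" for h
    have \<phi>: "\<phi> (fmap (c j) x) = fmap (d j) x" if "j \<in> Obj J" "x \<in> on_obj F j" for j x
      unfolding \<phi>_def by (rule some_equality) (use that wd in blast)+
    have h: "Fn z (restrict \<phi> z) y \<in> hom (set_cat UNIV) z y"
    proof (rule Fn_hom)
      fix w assume "w \<in> z"
      then obtain j x where x: "j \<in> Obj J" "x \<in> on_obj F j" "fmap (c j) x = w" using surj by blast
      then show "\<phi> w \<in> y" using \<phi>[OF x(1,2)] set_cat_app_in[OF dh[OF x(1)] x(2)] by simp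
    qed simp_all
    have hc: "fmap (Fn z (restrict \<phi> z) y) (fmap (c j) x) = fmap (d j) x" if "j \<in> Obj J" "x \<in> on_obj F j" for j x
      using \<phi>[OF that] set_cat_app_in[OF c[OF that(1)] that(2)] by simp
    show ?thesis
    proof (rule ex1I[of _ "Fn z (restrict \<phi> z) y"], intro conjI h ballI)
      fix j assume j: "j \<in> Obj J"
      show "Fn z (restrict \<phi> z) y \<cdot>\<^bsub>set_cat UNIV\<^esub> c j = d j"
        by (rule set_cat_cmp_eqI[OF c[OF j] h dh[OF j]]) (rule hc[OF j])
    next
      fix k assume k: "k \<in> hom (set_cat UNIV) z y \<and> (\<forall>j\<in>Obj J. k \<cdot>\<^bsub>set_cat UNIV\<^esub> c j = d j)"
      show "k = Fn z (restrict \<phi> z) y"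
      proof (rule Fn_eqI[OF _ h])
        fix w assume "w \<in> z"
        then obtain j x where x: "j \<in> Obj J" "x \<in> on_obj F j" "fmap (c j) x = w" using surj by blast
        then show "fmap k w = fmap (Fn z (restrict \<phi> z) y) w"
          using set_cat_cmp_eqD[OF _ c[OF x(1)] x(2), of k "d j"] k hc[OF x(1,2)] by simp
      qed (use k in simp)
    qed
  qed
  with cocone show ?thesis by (simp add: is_colimit_def)
qed

section \<open>Small colimits of models by generators and relations\<close>

locale diagram = clan_models T \<kappa> Disp
  for T :: "('o, 'u) cat" (structure) and \<kappa> :: "'u rel" and Disp :: "'u set" +
  fixes J :: "('j, 'i) cat" and D :: "('j, 'i, ('o, 'u, 'u set, 'u fn) fctr, ('o, 'u, 'u set, 'u fn) ntrans) fctr"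
  assumes J: "category J" and D: "is_functor J M D" and J_small: "|Obj J| <o \<kappa>"
begin

interpretation J: category J by (rule J)

lemma D_obj: "j \<in> Obj J \<Longrightarrow> on_obj D j \<in> Obj M"
  and D_arr: "a \<in> hom J i j \<Longrightarrow> on_arr D a \<in> hom M (on_obj D i) (on_obj D j)"
  and D_ident: "j \<in> Obj J \<Longrightarrow> on_arr D (ident J j) = ident M (on_obj D j)"
  and D_cmp: "a \<in> hom J i j \<Longrightarrow> b \<in> hom J j k \<Longrightarrow> on_arr D (b \<cdot>\<^bsub>J\<^esub> a) = on_arr D b \<cdot>\<^bsub>M\<^esub> on_arr D a"
  using D by (auto simp: is_functor_def hom_def[of J] simp del: Mod_simps)

lemma app_D_ident: "j \<in> Obj J \<Longrightarrow> \<Gamma> \<in> Obj T \<Longrightarrow> x \<in> on_obj (on_obj D j) \<Gamma> \<Longrightarrow> app (on_arr D (ident J j)) \<Gamma> x = x"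
  by (simp add: D_ident)

lemma app_D_cmp: "a \<in> hom J i j \<Longrightarrow> b \<in> hom J j k \<Longrightarrow> \<Gamma> \<in> Obj T \<Longrightarrow> x \<in> on_obj (on_obj D i) \<Gamma> \<Longrightarrow>
    app (on_arr D (b \<cdot>\<^bsub>J\<^esub> a)) \<Gamma> x = app (on_arr D b) \<Gamma> (app (on_arr D a) \<Gamma> x)"
  by (simp add: D_cmp app_cmp[OF D_arr D_arr])

lemma hom_Obj_J: "a \<in> hom J i j \<Longrightarrow> i \<in> Obj J \<and> j \<in> Obj J"
  using J.src_Obj J.trg_Obj by (auto simp: hom_def)

lemma app_D_in: "a \<in> hom J i j \<Longrightarrow> \<Gamma> \<in> Obj T \<Longrightarrow> x \<in> on_obj (on_obj D i) \<Gamma> \<Longrightarrow>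
    app (on_arr D a) \<Gamma> x \<in> on_obj (on_obj D j) \<Gamma>"
  using app_in[OF D_arr] .

lemma cocone_iff:
  "is_cocone J M D y d \<longleftrightarrow> y \<in> Obj M \<and> (\<forall>j\<in>Obj J. d j \<in> hom M (on_obj D j) y) \<and>
    (\<forall>i j a \<Gamma> x. a \<in> hom J i j \<longrightarrow> \<Gamma> \<in> Obj T \<longrightarrow> x \<in> on_obj (on_obj D i) \<Gamma> \<longrightarrow>
       app (d j) \<Gamma> (app (on_arr D a) \<Gamma> x) = app (d i) \<Gamma> x)" (is "?L \<longleftrightarrow> ?R")
proof
  assume L: ?L
  then have d: "d j \<in> hom M (on_obj D j) y" if "j \<in> Obj J" for j using that by (simp add: is_cocone_def)
  have "app (d j) \<Gamma> (app (on_arr D a) \<Gamma> x) = app (d i) \<Gamma> x"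
    if a: "a \<in> hom J i j" and x: "\<Gamma> \<in> Obj T" "x \<in> on_obj (on_obj D i) \<Gamma>" for i j a \<Gamma> x
    using app_cmp[OF D_arr[OF a] d x] hom_Obj_J[OF a] L homD[OF a] by (auto simp: is_cocone_def)
  then show ?R using L by (simp add: is_cocone_def)
next
  assume R: ?R
  have "d (trg J a) \<cdot>\<^bsub>M\<^esub> on_arr D a = d (src J a)" if a: "a \<in> Arr J" for a
  proof -
    have a': "a \<in> hom J (src J a) (trg J a)" using a by (simp add: hom_def)
    have d: "d (src J a) \<in> hom M (on_obj D (src J a)) y" "d (trg J a) \<in> hom M (on_obj D (trg J a)) y"
      using R hom_Obj_J[OF a'] by auto
    show ?thesis
      by (rule Mod_hom_eqI[OF Mod.cmp_hom[OF D_arr[OF a'] d(2)] d(1)]) 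
        (use R a' in \<open>simp add: app_cmp[OF D_arr[OF a'] d(2)]\<close>)
  qed
  then show ?L using R by (simp add: is_cocone_def)
qed

text \<open>The generators are all elements of all models in the diagram; with the relations below,
  a family on this graph is the same thing as a cocone.\<close>

lemma colimit_exists: "\<exists>x c. is_colimit J M D x c"
proof -
  define G where "G = (SIGMA j:Obj J. SIGMA \<Gamma>:Obj T. on_obj (on_obj D j) \<Gamma>)"
  define srt where "srt = (\<lambda>(j :: 'j, \<Gamma> :: 'o, x :: 'u). \<Gamma>)"
  \<comment> \<open>Edges of the first kind make each cocone leg natural in \<Gamma>. Those of the
    second kind, labelled by identities, glue an element to its image under a transition map of the
    diagram.\<close>
  define ed where "ed = {((j, \<Gamma>, x), f, (j, \<Delta>, act (on_obj D j) f x)) |j \<Gamma> \<Delta> f x.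
      j \<in> Obj J \<and> f \<in> hom T \<Gamma> \<Delta> \<and> x \<in> on_obj (on_obj D j) \<Gamma>} \<union>
    {((i, \<Gamma>, x), ident T \<Gamma>, (j, \<Gamma>, app (on_arr D a) \<Gamma> x)) |i j a \<Gamma> x.
      a \<in> hom J i j \<and> \<Gamma> \<in> Obj T \<and> x \<in> on_obj (on_obj D i) \<Gamma>}"
  have G: "(j, \<Gamma>, x) \<in> G \<longleftrightarrow> j \<in> Obj J \<and> \<Gamma> \<in> Obj T \<and> x \<in> on_obj (on_obj D j) \<Gamma>" for j \<Gamma> x
    by (auto simp: G_def)
  have srt: "srt (j, \<Gamma>, x) = \<Gamma>" for j \<Gamma> x by (simp add: srt_def)
  have act_D: "act (on_obj D j) f x \<in> on_obj (on_obj D j) \<Delta>" 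
    if "j \<in> Obj J" "f \<in> hom T \<Gamma> \<Delta>" "x \<in> on_obj (on_obj D j) \<Gamma>" for j f \<Gamma> \<Delta> x
    using act_in[OF D_obj[OF that(1)], of f] that by (simp add: hom_def)
  have "|G| <o \<kappa>" unfolding G_def by (intro small_Sigma J_small small_Obj model_small D_obj)
  moreover have gr: "graph G srt ed"
    using src_Obj trg_Obj act_D app_D_in hom_Obj_J
    by (auto simp: graph_def ed_def G srt ident_hom) (auto simp: hom_def)
  ultimately obtain P u where P: "presents G srt ed P u" by (rule presentation_exists)
  have PM: "P \<in> Obj M" by (rule presentsD(1)[OF P])
  have u_in: "u (j, \<Gamma>, x) \<in> on_obj P \<Gamma>" if "j \<in> Obj J" "\<Gamma> \<in> Obj T" "x \<in> on_obj (on_obj D j) \<Gamma>" for j \<Gamma> x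
    using presentsD(2)[OF P, of "(j, \<Gamma>, x)"] that by (simp add: G srt)
  have u_act: "act P f (u (j, \<Gamma>, x)) = u (j, \<Delta>, act (on_obj D j) f x)"
    if "j \<in> Obj J" "f \<in> hom T \<Gamma> \<Delta>" "x \<in> on_obj (on_obj D j) \<Gamma>" for j f \<Gamma> \<Delta> x
    by (rule presentsD(3)[OF P]) (use that in \<open>auto simp: ed_def\<close>)
  have u_D: "u (i, \<Gamma>, x) = u (j, \<Gamma>, app (on_arr D a) \<Gamma> x)"
    if a: "a \<in> hom J i j" and x: "\<Gamma> \<in> Obj T" "x \<in> on_obj (on_obj D i) \<Gamma>" for i j a \<Gamma> x
  proof -
    have "act P (ident T \<Gamma>) (u (i, \<Gamma>, x)) = u (j, \<Gamma>, app (on_arr D a) \<Gamma> x)"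
      by (rule presentsD(3)[OF P]) (use that in \<open>auto simp: ed_def\<close>)
    then show ?thesis using act_ident[OF PM x(1)] u_in hom_Obj_J[OF a] x by simp
  qed
  let ?c = "\<lambda>j. mk_trans T (on_obj D j) P (\<lambda>\<Gamma> x. u (j, \<Gamma>, x))"
  have u_act': "u (j, trg T f, act (on_obj D j) f x) = act P f (u (j, src T f, x))"
    if "j \<in> Obj J" "f \<in> Arr T" "x \<in> on_obj (on_obj D j) (src T f)" for j f x
    using u_act[OF that(1) _ that(3), of f "trg T f"] that(2) by (simp add: hom_def)
  have c: "?c j \<in> hom M (on_obj D j) P" if "j \<in> Obj J" for j
    by (rule mk_trans_hom(1)[OF D_obj[OF that] PM]) (simp_all add: u_in u_act' that)
  have app_c: "app (?c j) \<Gamma> x = u (j, \<Gamma>, x)" if "j \<in> Obj J" "\<Gamma> \<in> Obj T" "x \<in> on_obj (on_obj D j) \<Gamma>" for j \<Gamma> x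
    by (rule mk_trans_hom(2)[OF D_obj[OF that(1)] PM]) (simp_all add: u_in u_act' that)
  have cocone: "is_cocone J M D P ?c"
    unfolding cocone_iff
  proof (intro conjI allI impI ballI)
    fix i j a \<Gamma> x assume a: "a \<in> hom J i j" and x: "\<Gamma> \<in> Obj T" "x \<in> on_obj (on_obj D i) \<Gamma>"
    show "app (?c j) \<Gamma> (app (on_arr D a) \<Gamma> x) = app (?c i) \<Gamma> x"
      using hom_Obj_J[OF a] x app_D_in[OF a x] u_D[OF a x] by (simp add: app_c)
  qed (simp_all add: PM c)
  have "\<exists>!h. h \<in> hom M P y \<and> (\<forall>j\<in>Obj J. h \<cdot>\<^bsub>M\<^esub> ?c j = d j)" if "is_cocone J M D y d" for y d
  proof -
    have y: "y \<in> Obj M" and d: "\<And>j. j \<in> Obj J \<Longrightarrow> d j \<in> hom M (on_obj D j) y"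
      and d_nat: "\<And>i j a \<Gamma> x. a \<in> hom J i j \<Longrightarrow> \<Gamma> \<in> Obj T \<Longrightarrow> x \<in> on_obj (on_obj D i) \<Gamma> \<Longrightarrow>
       app (d j) \<Gamma> (app (on_arr D a) \<Gamma> x) = app (d i) \<Gamma> x"
      using that unfolding cocone_iff by blast+
    define v where "v = (\<lambda>(j, \<Gamma>, x). app (d j) \<Gamma> x)"
    have v: "v (j, \<Gamma>, x) = app (d j) \<Gamma> x" for j \<Gamma> x by (simp add: v_def)
    have 1: "v g \<in> on_obj y (srt g)" if "g \<in> G" for g
      using that app_in[OF d] by (cases g) (simp add: G srt v)
    have 2: "act y f (v i) = v j" if "(i, f, j) \<in> ed" for i f j
      using that unfolding ed_def
    proof (elim UnE CollectE exE conjE)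
      fix k \<Gamma> \<Delta> g x assume *: "(i, f, j) = ((k, \<Gamma>, x), g, (k, \<Delta>, act (on_obj D k) g x))" 
        "k \<in> Obj J" "g \<in> hom T \<Gamma> \<Delta>" "x \<in> on_obj (on_obj D k) \<Gamma>"
      show ?thesis using app_nat'[OF d[OF *(2)] *(3,4)] *(1) by (simp add: v)
    next
      fix k l a \<Gamma> x assume *: "(i, f, j) = ((k, \<Gamma>, x), ident T \<Gamma>, (l, \<Gamma>, app (on_arr D a) \<Gamma> x))" 
        "a \<in> hom J k l" "\<Gamma> \<in> Obj T" "x \<in> on_obj (on_obj D k) \<Gamma>"
      show ?thesis using d_nat[OF *(2-4)] act_ident[OF y *(3)] app_in[OF d *(3,4)] hom_Obj_J[OF *(2)] *(1) by (simp add: v)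
    qed
    have "family G srt ed y v" unfolding family_def using 1 2 by blast
    then have "\<exists>!h. h \<in> hom M P y \<and> (\<forall>g\<in>G. app h (srt g) (u g) = v g)"
      using P y unfolding presents_def by blast
    \<comment> \<open>Family values and cocone legs are the same data, read by elements or by
      components, so unique existence transfers.\<close>
    moreover have iff: "(\<forall>g\<in>G. app h (srt g) (u g) = v g) \<longleftrightarrow> (\<forall>j\<in>Obj J. h \<cdot>\<^bsub>M\<^esub> ?c j = d j)"
      if h: "h \<in> hom M P y" for h
    proof
      assume L: "\<forall>g\<in>G. app h (srt g) (u g) = v g"
      show "\<forall>j\<in>Obj J. h \<cdot>\<^bsub>M\<^esub> ?c j = d j"
      proof
        fix j assume j: "j \<in> Obj J"
        show "h \<cdot>\<^bsub>M\<^esub> ?c j = d j"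
        proof (rule Mod_hom_eqI[OF Mod.cmp_hom[OF c[OF j] h] d[OF j]])
          fix \<Gamma> x assume x: "\<Gamma> \<in> Obj T" "x \<in> on_obj (on_obj D j) \<Gamma>"
          have "(j, \<Gamma>, x) \<in> G" using j x by (simp add: G)
          from L[rule_format, OF this]
          show "app (h \<cdot>\<^bsub>M\<^esub> ?c j) \<Gamma> x = app (d j) \<Gamma> x"
            unfolding app_cmp[OF c[OF j] h x] app_c[OF j x] by (simp add: srt v)
        qed
      qed
    next
      assume R: "\<forall>j\<in>Obj J. h \<cdot>\<^bsub>M\<^esub> ?c j = d j"
      show "\<forall>g\<in>G. app h (srt g) (u g) = v g"
      proof
        fix g assume "g \<in> G"
        then obtain j \<Gamma> x where g: "g = (j, \<Gamma>, x)" and x: "j \<in> Obj J" "\<Gamma> \<in> Obj T" "x \<in> on_obj (on_obj D j) \<Gamma>" 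
          by (cases g) (auto simp: G)
        show "app h (srt g) (u g) = v g"
          using app_cmp[OF c[OF x(1)] h x(2,3)] app_c[OF x] R x(1) by (simp add: g srt v)
      qed
    qed
    then have "h \<in> hom M P y \<and> (\<forall>g\<in>G. app h (srt g) (u g) = v g) \<longleftrightarrow>
        h \<in> hom M P y \<and> (\<forall>j\<in>Obj J. h \<cdot>\<^bsub>M\<^esub> ?c j = d j)" for h by blast
    ultimately show ?thesis by simp
  qed
  with cocone show ?thesis unfolding is_colimit_def by blast
qed

end

section \<open>Filtered colimits of models\<close>

locale filtered_diagram = diagram T \<kappa> Disp J D
  for T :: "('o, 'u) cat" (structure) and \<kappa> :: "'u rel" and Disp :: "'u set"
    and J :: "('j, 'i) cat" and D :: "('j, 'i, ('o, 'u, 'u set, 'u fn) fctr, ('o, 'u, 'u set, 'u fn) ntrans) fctr" +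
  assumes filtered: "filtered J"
begin

interpretation J: category J by (rule J)

text \<open>The standard equality in a filtered colimit of sets. Membership is built in, so the
  relation is partial and its diagonal consists of the genuine elements.\<close>

definition germ :: "'o \<Rightarrow> 'j \<times> 'u \<Rightarrow> 'j \<times> 'u \<Rightarrow> bool" where
  "germ \<Gamma> = (\<lambda>(i, x) (j, y). x \<in> on_obj (on_obj D i) \<Gamma> \<and> y \<in> on_obj (on_obj D j) \<Gamma> \<and>
     (\<exists>k. \<exists>a\<in>hom J i k. \<exists>b\<in>hom J j k. app (on_arr D a) \<Gamma> x = app (on_arr D b) \<Gamma> y))"

definition germ_act :: "'u \<Rightarrow> 'j \<times> 'u \<Rightarrow> 'j \<times> 'u" where
  "germ_act f = (\<lambda>(j, x). (j, act (on_obj D j) f x))"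

lemma germ_refl_iff: "germ \<Gamma> (j, x) (j, x) \<longleftrightarrow> j \<in> Obj J \<and> x \<in> on_obj (on_obj D j) \<Gamma>"
  using J.ident_hom hom_Obj_J by (auto simp: germ_def)

lemma germI: "a \<in> hom J i k \<Longrightarrow> b \<in> hom J j k \<Longrightarrow> x \<in> on_obj (on_obj D i) \<Gamma> \<Longrightarrow> y \<in> on_obj (on_obj D j) \<Gamma> \<Longrightarrow>
    app (on_arr D a) \<Gamma> x = app (on_arr D b) \<Gamma> y \<Longrightarrow> germ \<Gamma> (i, x) (j, y)"
  by (auto simp: germ_def)

lemma germE:
  assumes "germ \<Gamma> (i, x) (j, y)"
  obtains k a b where "a \<in> hom J i k" "b \<in> hom J j k" "x \<in> on_obj (on_obj D i) \<Gamma>" "y \<in> on_obj (on_obj D j) \<Gamma>"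
    "app (on_arr D a) \<Gamma> x = app (on_arr D b) \<Gamma> y"
  using assms by (auto simp: germ_def)

lemma germ_app: "a \<in> hom J i j \<Longrightarrow> \<Gamma> \<in> Obj T \<Longrightarrow> x \<in> on_obj (on_obj D i) \<Gamma> \<Longrightarrow> germ \<Gamma> (j, app (on_arr D a) \<Gamma> x) (i, x)"
  using hom_Obj_J[of a i j] by (intro germI[of "ident J j" j j a])
    (auto simp: J.ident_hom app_D_ident app_D_in simp del: Mod_simps)

lemma germ_sym: "germ \<Gamma> s t \<Longrightarrow> germ \<Gamma> t s"
  by (cases s; cases t) (auto elim!: germE intro: germI)

lemma germ_trans:
  assumes \<Gamma>: "\<Gamma> \<in> Obj T" and "germ \<Gamma> s t" "germ \<Gamma> t r"
  shows "germ \<Gamma> s r"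
proof -
  obtain i x j y l z where s: "s = (i, x)" "t = (j, y)" "r = (l, z)" by (cases s, cases t, cases r)
  obtain k a b where 1: "a \<in> hom J i k" "b \<in> hom J j k" "x \<in> on_obj (on_obj D i) \<Gamma>" "y \<in> on_obj (on_obj D j) \<Gamma>"
    "app (on_arr D a) \<Gamma> x = app (on_arr D b) \<Gamma> y" using assms(2) unfolding s by (rule germE)
  obtain k' b' c where 2: "b' \<in> hom J j k'" "c \<in> hom J l k'" "y \<in> on_obj (on_obj D j) \<Gamma>" "z \<in> on_obj (on_obj D l) \<Gamma>"
    "app (on_arr D b') \<Gamma> y = app (on_arr D c) \<Gamma> z" using assms(3) unfolding s by (rule germE)
  obtain m u v where uv: "u \<in> hom J k m" "v \<in> hom J k' m" "u \<cdot>\<^bsub>J\<^esub> b = v \<cdot>\<^bsub>J\<^esub> b'"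
    by (rule filtered_amalgamate[OF filtered 1(2) 2(1)])
  have "app (on_arr D (u \<cdot>\<^bsub>J\<^esub> a)) \<Gamma> x = app (on_arr D u) \<Gamma> (app (on_arr D b) \<Gamma> y)"
    using app_D_cmp[OF 1(1) uv(1) \<Gamma> 1(3)] 1(5) by simp
  also have "\<dots> = app (on_arr D v) \<Gamma> (app (on_arr D b') \<Gamma> y)"
    using app_D_cmp[OF 1(2) uv(1) \<Gamma> 1(4)] app_D_cmp[OF 2(1) uv(2) \<Gamma> 2(3)] uv(3) by simp
  also have "\<dots> = app (on_arr D (v \<cdot>\<^bsub>J\<^esub> c)) \<Gamma> z"
    using app_D_cmp[OF 2(2) uv(2) \<Gamma> 2(4)] 2(5) by simp
  finally show ?thesis
    unfolding s by (rule germI[OF J.cmp_hom[OF 1(1) uv(1)] J.cmp_hom[OF 2(2) uv(2)] 1(3) 2(4)])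
qed

text \<open>One pair of arrows has to serve both equations, because the two projections of an
  element over a pullback must be compared at the same stage. After \<open>u\<close> and
  \<open>v\<close> make the composites from \<open>i\<close> agree, \<open>w\<close> does so for
  those from \<open>j\<close>.\<close>

lemma germ_common:
  assumes "\<Gamma> \<in> Obj T" "\<Delta> \<in> Obj T" "germ \<Gamma> (i, x) (j, y)" "germ \<Delta> (i, x') (j, y')"
  obtains k a b where "a \<in> hom J i k" "b \<in> hom J j k" "app (on_arr D a) \<Gamma> x = app (on_arr D b) \<Gamma> y"
    "app (on_arr D a) \<Delta> x' = app (on_arr D b) \<Delta> y'"
proof -
  obtain k a b where 1: "a \<in> hom J i k" "b \<in> hom J j k" "x \<in> on_obj (on_obj D i) \<Gamma>" "y \<in> on_obj (on_obj D j) \<Gamma>"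
    "app (on_arr D a) \<Gamma> x = app (on_arr D b) \<Gamma> y" using assms(3) by (rule germE)
  obtain k' a' b' where 2: "a' \<in> hom J i k'" "b' \<in> hom J j k'" "x' \<in> on_obj (on_obj D i) \<Delta>" "y' \<in> on_obj (on_obj D j) \<Delta>"
    "app (on_arr D a') \<Delta> x' = app (on_arr D b') \<Delta> y'" using assms(4) by (rule germE)
  obtain m u v where uv: "u \<in> hom J k m" "v \<in> hom J k' m" "u \<cdot>\<^bsub>J\<^esub> a = v \<cdot>\<^bsub>J\<^esub> a'"
    by (rule filtered_amalgamate[OF filtered 1(1) 2(1)])
  obtain n w where w: "w \<in> hom J m n" "w \<cdot>\<^bsub>J\<^esub> (u \<cdot>\<^bsub>J\<^esub> b) = w \<cdot>\<^bsub>J\<^esub> (v \<cdot>\<^bsub>J\<^esub> b')"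
    using filteredD(4)[OF filtered J.cmp_hom[OF 1(2) uv(1)] J.cmp_hom[OF 2(2) uv(2)]] by blast
  let ?u = "w \<cdot>\<^bsub>J\<^esub> u" and ?v = "w \<cdot>\<^bsub>J\<^esub> v"
  have u: "?u \<in> hom J k n" and v: "?v \<in> hom J k' n" using uv w J.cmp_hom by auto
  have a: "?u \<cdot>\<^bsub>J\<^esub> a = ?v \<cdot>\<^bsub>J\<^esub> a'" 
    using J.cmp_assoc[OF 1(1) uv(1) w(1)] J.cmp_assoc[OF 2(1) uv(2) w(1)] uv(3) by simp
  have b: "?u \<cdot>\<^bsub>J\<^esub> b = ?v \<cdot>\<^bsub>J\<^esub> b'" 
    using J.cmp_assoc[OF 1(2) uv(1) w(1)] J.cmp_assoc[OF 2(2) uv(2) w(1)] w(2) by simp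
  show thesis
  proof (rule that[OF J.cmp_hom[OF 1(1) u] J.cmp_hom[OF 1(2) u]])
    show "app (on_arr D (?u \<cdot>\<^bsub>J\<^esub> a)) \<Gamma> x = app (on_arr D (?u \<cdot>\<^bsub>J\<^esub> b)) \<Gamma> y"
      using app_D_cmp[OF 1(1) u assms(1) 1(3)] app_D_cmp[OF 1(2) u assms(1) 1(4)] 1(5) by simp
    show "app (on_arr D (?u \<cdot>\<^bsub>J\<^esub> a)) \<Delta> x' = app (on_arr D (?u \<cdot>\<^bsub>J\<^esub> b)) \<Delta> y'"
      unfolding a b using app_D_cmp[OF 2(1) v assms(2) 2(3)] app_D_cmp[OF 2(2) v assms(2) 2(4)] 2(5) by simp
  qed
qed

text \<open>An instance of filtered colimits commuting with finite limits: the finitely many germs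
  in a clan condition are brought to one stage, whose model supplies the element or the
  equation.\<close>

sublocale setoid_model T \<kappa> Disp germ germ_act
proof
  show "germ \<Gamma> y x" if "germ \<Gamma> x y" for \<Gamma> x y by (rule germ_sym[OF that])
  show "germ \<Gamma> x z" if "\<Gamma> \<in> Obj T" "germ \<Gamma> x y" "germ \<Gamma> y z" for \<Gamma> x y z by (rule germ_trans[OF that])
  show "|{x. germ \<Gamma> x x}| <o \<kappa>" if \<Gamma>: "\<Gamma> \<in> Obj T" for \<Gamma>
  proof (rule small_subset)
    show "{x. germ \<Gamma> x x} \<subseteq> (SIGMA j:Obj J. on_obj (on_obj D j) \<Gamma>)" by (auto simp: germ_refl_iff)
    show "|SIGMA j:Obj J. on_obj (on_obj D j) \<Gamma>| <o \<kappa>" by (intro small_Sigma J_small model_small D_obj \<Gamma>)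
  qed
  show "germ (trg T f) (germ_act f s) (germ_act f t)" if f: "f \<in> Arr T" and st: "germ (src T f) s t" for f s t
  proof -
    obtain i x j y where s: "s = (i, x)" "t = (j, y)" by (cases s, cases t)
    obtain k a b where 1: "a \<in> hom J i k" "b \<in> hom J j k" "x \<in> on_obj (on_obj D i) (src T f)" "y \<in> on_obj (on_obj D j) (src T f)"
      "app (on_arr D a) (src T f) x = app (on_arr D b) (src T f) y" using st unfolding s by (rule germE)
    show ?thesis
      unfolding s germ_act_def prod.case
      by (rule germI[OF 1(1,2)]) 
        (use f 1 hom_Obj_J in \<open>auto simp: app_nat[OF D_arr[OF 1(1)] f] app_nat[OF D_arr[OF 1(2)] f] intro!: act_in D_obj\<close>)
  qed
  show "germ \<Gamma> (germ_act (ident T \<Gamma>) s) s" if "\<Gamma> \<in> Obj T" "germ \<Gamma> s s" for \<Gamma> s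
    using that by (cases s) (auto simp: germ_act_def germ_refl_iff act_ident D_obj)
  show "germ (trg T g) (germ_act (g \<cdot> f) s) (germ_act g (germ_act f s))"
    if f: "f \<in> Arr T" and g: "g \<in> Arr T" and fg: "src T g = trg T f" and s: "germ (src T f) s s" for f g s
  proof -
    obtain j x where s': "s = (j, x)" by (cases s)
    have x: "j \<in> Obj J" "x \<in> on_obj (on_obj D j) (src T f)" using s by (auto simp: s' germ_refl_iff)
    have "act (on_obj D j) g (act (on_obj D j) f x) \<in> on_obj (on_obj D j) (trg T g)"
      by (intro act_in D_obj x g) (use act_in[OF D_obj[OF x(1)] f x(2)] fg in simp)
    then show ?thesis
      using x act_cmp[OF D_obj[OF x(1)] f g fg x(2)] by (simp add: s' germ_act_def germ_refl_iff)
  qed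
  show "(\<exists>s. germ t s s) \<and> (\<forall>r s. germ t r r \<longrightarrow> germ t s s \<longrightarrow> germ t r s)" if t: "terminal T t" for t
  proof (intro conjI allI impI)
    obtain j where j: "j \<in> Obj J" using filteredD(2)[OF filtered] by blast
    then obtain x where "x \<in> on_obj (on_obj D j) t" using model_terminal[OF D_obj[OF j] t] by blast
    then show "\<exists>s. germ t s s" using j germ_refl_iff by blast
    fix r s assume rs: "germ t r r" "germ t s s"
    obtain i x j y where s: "r = (i, x)" "s = (j, y)" by (cases r, cases s)
    have x: "i \<in> Obj J" "x \<in> on_obj (on_obj D i) t" and y: "j \<in> Obj J" "y \<in> on_obj (on_obj D j) t" 
      using rs by (auto simp: s germ_refl_iff)
    have tO: "t \<in> Obj T" using t by (simp add: terminal_def)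
    obtain k a b where ab: "a \<in> hom J i k" "b \<in> hom J j k" using filteredD(3)[OF filtered x(1) y(1)] by blast
    have "app (on_arr D a) t x = app (on_arr D b) t y"
      by (rule ex1_eqD[OF model_terminal[OF D_obj t]])
        (use app_D_in[OF ab(1) tO x(2)] app_D_in[OF ab(2) tO y(2)] hom_Obj_J[OF ab(1)] in auto)
    then show "germ t r s" unfolding s by (rule germI[OF ab x(2) y(2)])
  qed
  show "\<exists>z. germ (src T p') z z \<and> germ (src T f) (germ_act p' z) r \<and> germ (src T p) (germ_act f' z) s"
    if p: "p \<in> Disp" and pb: "is_pullback T f p p' f'" and r: "germ (src T f) r r" and s: "germ (src T p) s s"
      and rs: "germ (trg T f) (germ_act f r) (germ_act p s)" for f p p' f' r s
  proof -
    note P = pullbackD[OF pb]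
    obtain i x j y where s': "r = (i, x)" "s = (j, y)" by (cases r, cases s)
    have x: "i \<in> Obj J" "x \<in> on_obj (on_obj D i) (src T f)" and y: "j \<in> Obj J" "y \<in> on_obj (on_obj D j) (src T p)" 
      using r s by (auto simp: s' germ_refl_iff)
    obtain k a b where 1: "a \<in> hom J i k" "b \<in> hom J j k"
      "app (on_arr D a) (trg T f) (act (on_obj D i) f x) = app (on_arr D b) (trg T f) (act (on_obj D j) p y)" 
      using rs unfolding s' germ_act_def prod.case by (rule germE)
    have k: "k \<in> Obj J" using hom_Obj_J[OF 1(1)] by simp
    have "act (on_obj D k) f (app (on_arr D a) (src T f) x) = act (on_obj D k) p (app (on_arr D b) (src T p) y)"
      using 1(3) app_nat[OF D_arr[OF 1(1)] P(1) x(2)] app_nat[OF D_arr[OF 1(2)] P(2) y(2)] P(5) by simp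
    from model_pullback[OF D_obj[OF k] p pb app_D_in[OF 1(1) src_Obj[OF P(1)] x(2)] app_D_in[OF 1(2) src_Obj[OF P(2)] y(2)] this]
    obtain z where z: "z \<in> on_obj (on_obj D k) (src T p')" "act (on_obj D k) p' z = app (on_arr D a) (src T f) x"
      "act (on_obj D k) f' z = app (on_arr D b) (src T p) y" by blast
    have "germ (src T p') (k, z) (k, z)" using z(1) k by (simp add: germ_refl_iff)
    moreover have "germ (src T f) (germ_act p' (k, z)) r"
      using germ_app[OF 1(1) src_Obj[OF P(1)] x(2)] by (simp add: germ_act_def z s')
    moreover have "germ (src T p) (germ_act f' (k, z)) s"
      using germ_app[OF 1(2) src_Obj[OF P(2)] y(2)] by (simp add: germ_act_def z s')
    ultimately show ?thesis by blast
  qed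
  show "germ (src T p') r s"
    if p: "p \<in> Disp" and pb: "is_pullback T f p p' f'" and r: "germ (src T p') r r" and s: "germ (src T p') s s"
      and 1: "germ (src T f) (germ_act p' r) (germ_act p' s)" and 2: "germ (src T p) (germ_act f' r) (germ_act f' s)"
    for f p p' f' r s
  proof -
    note P = pullbackD[OF pb]
    obtain i x j y where s': "r = (i, x)" "s = (j, y)" by (cases r, cases s)
    have x: "i \<in> Obj J" "x \<in> on_obj (on_obj D i) (src T p')" and y: "j \<in> Obj J" "y \<in> on_obj (on_obj D j) (src T p')" 
      using r s by (auto simp: s' germ_refl_iff)
    obtain k a b where ab: "a \<in> hom J i k" "b \<in> hom J j k" 
      and e1: "app (on_arr D a) (src T f) (act (on_obj D i) p' x) = app (on_arr D b) (src T f) (act (on_obj D j) p' y)"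
      and e2: "app (on_arr D a) (src T p) (act (on_obj D i) f' x) = app (on_arr D b) (src T p) (act (on_obj D j) f' y)"
      using 1 2 unfolding s' germ_act_def prod.case by (rule germ_common[OF src_Obj[OF P(1)] src_Obj[OF P(2)]])
    have k: "k \<in> Obj J" using hom_Obj_J[OF ab(1)] by simp
    define x' where "x' = app (on_arr D a) (src T p') x"
    define y' where "y' = app (on_arr D b) (src T p') y"
    have x': "x' \<in> on_obj (on_obj D k) (src T p')" and y': "y' \<in> on_obj (on_obj D k) (src T p')"
      unfolding x'_def y'_def using app_D_in src_Obj[OF P(3)] ab x y by auto
    have e1': "act (on_obj D k) p' x' = act (on_obj D k) p' y'"
      unfolding x'_def y'_def app_nat[OF D_arr[OF ab(1)] P(3) x(2), symmetric] 
        app_nat[OF D_arr[OF ab(2)] P(3) y(2), symmetric] P(7) by (rule e1)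
    have e2': "act (on_obj D k) f' x' = act (on_obj D k) f' y'"
      unfolding x'_def y'_def 
      using app_nat[OF D_arr[OF ab(1)] P(4), of x] app_nat[OF D_arr[OF ab(2)] P(4), of y] e2 x y by (simp add: P(6,8))
    have in1: "act (on_obj D k) p' x' \<in> on_obj (on_obj D k) (src T f)" 
      and in2: "act (on_obj D k) f' x' \<in> on_obj (on_obj D k) (src T p)"
      using act_in[OF D_obj[OF k] P(3) x'] act_in[OF D_obj[OF k] P(4), of x'] x' P by simp_all
    have comm: "act (on_obj D k) f (act (on_obj D k) p' x') = act (on_obj D k) p (act (on_obj D k) f' x')"
      using act_cmp[OF D_obj[OF k] P(3,1), of x'] act_cmp[OF D_obj[OF k] P(4,2), of x'] x' P by simp
    have "x' = y'"
      by (rule ex1_eqD[OF model_pullback[OF D_obj[OF k] p pb in1 in2 comm]]) (simp_all add: x' y' e1' e2')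
    then show ?thesis unfolding s' x'_def y'_def by (rule germI[OF ab x(2) y(2)])
  qed
qed

text \<open>A colimit \<open>y\<close> in the category of models is compared with the pointwise one.
  The map \<open>h\<close> comes from the universal property of \<open>y\<close>, and
  \<open>k\<close> evaluates a germ by its cocone leg. Since \<open>h\<close> after
  \<open>c j\<close> sends \<open>x\<close> to its class, equal values in \<open>y\<close> give
  equal germs; surjectivity follows because \<open>h\<close> followed by \<open>k\<close> is the
  identity.\<close>

lemma
  assumes "is_colimit J M D y c"
  shows filtered_colimit_surj: "\<Gamma> \<in> Obj T \<Longrightarrow> z \<in> on_obj y \<Gamma> \<Longrightarrow>
      \<exists>j\<in>Obj J. \<exists>x\<in>on_obj (on_obj D j) \<Gamma>. app (c j) \<Gamma> x = z"
    and filtered_colimit_inj: "\<Gamma> \<in> Obj T \<Longrightarrow> j \<in> Obj J \<Longrightarrow> x \<in> on_obj (on_obj D j) \<Gamma> \<Longrightarrow>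
      x' \<in> on_obj (on_obj D j) \<Gamma> \<Longrightarrow> app (c j) \<Gamma> x = app (c j) \<Gamma> x' \<Longrightarrow>
      \<exists>k. \<exists>a\<in>hom J j k. app (on_arr D a) \<Gamma> x = app (on_arr D a) \<Gamma> x'"
proof -
  have cc: "is_cocone J M D y c" using assms by (simp add: is_colimit_def)
  have y: "y \<in> Obj M" and c: "\<And>j. j \<in> Obj J \<Longrightarrow> c j \<in> hom M (on_obj D j) y"
    and c_nat: "\<And>i j a \<Gamma> x. a \<in> hom J i j \<Longrightarrow> \<Gamma> \<in> Obj T \<Longrightarrow> x \<in> on_obj (on_obj D i) \<Gamma> \<Longrightarrow>
       app (c j) \<Gamma> (app (on_arr D a) \<Gamma> x) = app (c i) \<Gamma> x"
    using cc unfolding cocone_iff by blast+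
  let ?q = "\<lambda>j. mk_trans T (on_obj D j) quot (\<lambda>\<Gamma> x. cls \<Gamma> (j, x))"
  have q_in: "cls \<Gamma> (j, x) \<in> on_obj quot \<Gamma>" if "j \<in> Obj J" "\<Gamma> \<in> Obj T" "x \<in> on_obj (on_obj D j) \<Gamma>" for j \<Gamma> x
    using that by (simp add: cls_in germ_refl_iff)
  have q_act: "cls (trg T f) (j, act (on_obj D j) f x) = act quot f (cls (src T f) (j, x))"
    if "j \<in> Obj J" "f \<in> Arr T" "x \<in> on_obj (on_obj D j) (src T f)" for j f x
    using quot_act[OF that(2), of "(j, x)"] that by (simp add: germ_refl_iff germ_act_def)
  have q: "?q j \<in> hom M (on_obj D j) quot" if "j \<in> Obj J" for j
    by (rule mk_trans_hom(1)[OF D_obj[OF that] quot_model]) (simp_all add: q_in q_act that)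
  have app_q: "app (?q j) \<Gamma> x = cls \<Gamma> (j, x)" if "j \<in> Obj J" "\<Gamma> \<in> Obj T" "x \<in> on_obj (on_obj D j) \<Gamma>" for j \<Gamma> x
    by (rule mk_trans_hom(2)[OF D_obj[OF that(1)] quot_model]) (simp_all add: q_in q_act that)
  have "is_cocone J M D quot ?q"
    unfolding cocone_iff
  proof (intro conjI allI impI ballI)
    fix i j a \<Gamma> x assume a: "a \<in> hom J i j" and x: "\<Gamma> \<in> Obj T" "x \<in> on_obj (on_obj D i) \<Gamma>"
    show "app (?q j) \<Gamma> (app (on_arr D a) \<Gamma> x) = app (?q i) \<Gamma> x"
      using hom_Obj_J[OF a] x app_D_in[OF a x] cls_cong[OF x(1) germ_app[OF a x]] by (simp add: app_q)
  qed (simp_all add: quot_model q)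
  then obtain h where h: "h \<in> hom M y quot" "\<And>j. j \<in> Obj J \<Longrightarrow> h \<cdot>\<^bsub>M\<^esub> c j = ?q j"
    using assms unfolding is_colimit_def by blast
  have hc: "app h \<Gamma> (app (c j) \<Gamma> x) = cls \<Gamma> (j, x)" if "j \<in> Obj J" "\<Gamma> \<in> Obj T" "x \<in> on_obj (on_obj D j) \<Gamma>" for j \<Gamma> x
    using app_cmp[OF c[OF that(1)] h(1) that(2,3)] h(2)[OF that(1)] app_q[OF that] by simp
  obtain k where k: "k \<in> hom M quot y" "\<And>\<Gamma> s. \<Gamma> \<in> Obj T \<Longrightarrow> germ \<Gamma> s s \<Longrightarrow> app k \<Gamma> (cls \<Gamma> s) = (\<lambda>(j, x). app (c j) \<Gamma> x) s"
  proof (rule quot_hom[OF y, of "\<lambda>\<Gamma> (j, x). app (c j) \<Gamma> x"])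
    show "(\<lambda>(j, x). app (c j) \<Gamma> x) s = (\<lambda>(j, x). app (c j) \<Gamma> x) t" if \<Gamma>: "\<Gamma> \<in> Obj T" and st: "germ \<Gamma> s t" for \<Gamma> s t
    proof -
      obtain i x j x' where s: "s = (i, x)" "t = (j, x')" by (cases s, cases t)
      obtain k a b where 1: "a \<in> hom J i k" "b \<in> hom J j k" "x \<in> on_obj (on_obj D i) \<Gamma>" "x' \<in> on_obj (on_obj D j) \<Gamma>"
        "app (on_arr D a) \<Gamma> x = app (on_arr D b) \<Gamma> x'" using st unfolding s by (rule germE)
      show ?thesis using c_nat[OF 1(1) \<Gamma> 1(3)] c_nat[OF 1(2) \<Gamma> 1(4)] 1(5) by (simp add: s)
    qed
    show "(\<lambda>(j, x). app (c j) \<Gamma> x) s \<in> on_obj y \<Gamma>" if "\<Gamma> \<in> Obj T" "germ \<Gamma> s s" for \<Gamma> s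
      using that app_in[OF c] by (cases s) (simp add: germ_refl_iff)
    show "(\<lambda>(j, x). app (c j) (trg T f) x) (germ_act f s) = act y f ((\<lambda>(j, x). app (c j) (src T f) x) s)"
      if "f \<in> Arr T" "germ (src T f) s s" for f s
      using that app_nat[OF c] by (cases s) (simp add: germ_refl_iff germ_act_def)
  next
    fix k assume "k \<in> hom M quot y" 
      "\<And>\<Gamma> s. \<Gamma> \<in> Obj T \<Longrightarrow> germ \<Gamma> s s \<Longrightarrow> app k \<Gamma> (cls \<Gamma> s) = (\<lambda>(j, x). app (c j) \<Gamma> x) s"
    then show thesis by (rule that)
  qed
  have kh: "k \<cdot>\<^bsub>M\<^esub> h = ident M y"
  proof -
    have ex1: "\<exists>!l. l \<in> hom M y y \<and> (\<forall>j\<in>Obj J. l \<cdot>\<^bsub>M\<^esub> c j = c j)"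
      using assms cc unfolding is_colimit_def by blast
    have khc: "k \<cdot>\<^bsub>M\<^esub> h \<cdot>\<^bsub>M\<^esub> c j = c j" if j: "j \<in> Obj J" for j
    proof (rule Mod_hom_eqI[OF Mod.cmp_hom[OF c[OF j] Mod.cmp_hom[OF h(1) k(1)]] c[OF j]])
      fix \<Gamma> x assume x: "\<Gamma> \<in> Obj T" "x \<in> on_obj (on_obj D j) \<Gamma>"
      have "app (k \<cdot>\<^bsub>M\<^esub> h \<cdot>\<^bsub>M\<^esub> c j) \<Gamma> x = app k \<Gamma> (app h \<Gamma> (app (c j) \<Gamma> x))"
        using app_cmp[OF c[OF j] Mod.cmp_hom[OF h(1) k(1)] x] app_cmp[OF h(1) k(1) x(1) app_in[OF c[OF j] x]] by simp
      also have "\<dots> = app (c j) \<Gamma> x" using hc[OF j x] k(2)[OF x(1), of "(j, x)"] j x by (simp add: germ_refl_iff)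
      finally show "app (k \<cdot>\<^bsub>M\<^esub> h \<cdot>\<^bsub>M\<^esub> c j) \<Gamma> x = app (c j) \<Gamma> x" .
    qed
    show ?thesis
      by (rule ex1_eqD[OF ex1])
        (use Mod.cmp_hom[OF h(1) k(1)] Mod.ident_hom[OF y] Mod.ident_left[OF c] khc in \<open>simp_all del: Mod_simps\<close>)
  qed
  show "\<exists>j\<in>Obj J. \<exists>x\<in>on_obj (on_obj D j) \<Gamma>. app (c j) \<Gamma> x = z" if z: "\<Gamma> \<in> Obj T" "z \<in> on_obj y \<Gamma>"
  proof -
    obtain s where s: "germ \<Gamma> s s" "app h \<Gamma> z = cls \<Gamma> s" by (rule quot_cases[OF z(1) app_in[OF h(1) z]])
    obtain j x where jx: "s = (j, x)" by (cases s)
    have "z = app k \<Gamma> (app h \<Gamma> z)" using app_cmp[OF h(1) k(1) z] kh app_ident[OF z] by (simp del: Mod_simps)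
    also have "\<dots> = app (c j) \<Gamma> x" using k(2)[OF z(1) s(1)] s(2) jx by simp
    finally show ?thesis using s(1) by (auto simp: jx germ_refl_iff)
  qed
  show "\<exists>k. \<exists>a\<in>hom J j k. app (on_arr D a) \<Gamma> x = app (on_arr D a) \<Gamma> x'"
    if \<Gamma>: "\<Gamma> \<in> Obj T" and j: "j \<in> Obj J" and x: "x \<in> on_obj (on_obj D j) \<Gamma>" 
      and x': "x' \<in> on_obj (on_obj D j) \<Gamma>" and eq: "app (c j) \<Gamma> x = app (c j) \<Gamma> x'"
  proof -
    have "cls \<Gamma> (j, x) = cls \<Gamma> (j, x')" using hc[OF j \<Gamma> x] hc[OF j \<Gamma> x'] eq by simp
    then have "germ \<Gamma> (j, x) (j, x')" using cls_eq_iff[OF \<Gamma>] j x x' by (simp add: germ_refl_iff)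
    then obtain k a b where 1: "a \<in> hom J j k" "b \<in> hom J j k" "app (on_arr D a) \<Gamma> x = app (on_arr D b) \<Gamma> x'"
      by (rule germE)
    obtain l d where d: "d \<in> hom J k l" "d \<cdot>\<^bsub>J\<^esub> a = d \<cdot>\<^bsub>J\<^esub> b" using filteredD(4)[OF filtered 1(1,2)] by blast
    have "app (on_arr D (d \<cdot>\<^bsub>J\<^esub> a)) \<Gamma> x = app (on_arr D (d \<cdot>\<^bsub>J\<^esub> a)) \<Gamma> x'"
      using app_D_cmp[OF 1(1) d(1) \<Gamma> x] app_D_cmp[OF 1(2) d(1) \<Gamma> x'] 1(3) d(2) by simp
    then show ?thesis using J.cmp_hom[OF 1(1) d(1)] by blast
  qed
qed

end

section \<open>Compactness of finite presentations, density of representables\<close>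

context filtered_diagram
begin

interpretation J: category J by (rule J)

text \<open>A map out of \<open>X\<close> amounts to finitely many elements subject to finitely many
  equations. Elements of \<open>y\<close> come from some stage, equations valid in \<open>y\<close>
  hold from some later stage on, and finitely many of either fit into one stage.\<close>

lemma hom_preserves_colimit:
  assumes X: "presents G srt ed X u" and gr: "graph G srt ed" and fin: "finite G" "finite ed"
    and col: "is_colimit J M D y c"
  shows "is_colimit J (set_cat UNIV) (fctr_comp (hom_functor M X) D)
    (on_obj (hom_functor M X) y) (\<lambda>j. on_arr (hom_functor M X) (c j))"
proof -
  have XM: "X \<in> Obj M" by (rule presentsD(1)[OF X])
  have u: "u g \<in> on_obj X (srt g)" "srt g \<in> Obj T" if "g \<in> G" for g
    using presentsD(2)[OF X that] gr that by (auto simp: graph_def)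
  have y: "y \<in> Obj M" and c: "\<And>j. j \<in> Obj J \<Longrightarrow> c j \<in> hom M (on_obj D j) y"
    and c_nat: "\<And>i j a \<Gamma> x. a \<in> hom J i j \<Longrightarrow> \<Gamma> \<in> Obj T \<Longrightarrow> x \<in> on_obj (on_obj D i) \<Gamma> \<Longrightarrow>
       app (c j) \<Gamma> (app (on_arr D a) \<Gamma> x) = app (c i) \<Gamma> x"
    using col unfolding is_colimit_def cocone_iff by blast+
  let ?H = "hom_functor M X"
  have F_obj: "on_obj (fctr_comp ?H D) j = hom M X (on_obj D j)" if "j \<in> Obj J" for j
    using D_obj[OF that] by (simp add: fctr_comp_def hom_functor_def)
  have H_arr: "on_arr ?H f = Fn (hom M X A) (\<lambda>g\<in>hom M X A. f \<cdot>\<^bsub>M\<^esub> g) (hom M X B)" if "f \<in> hom M A B" for f A B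
    using homD[OF that] by (simp add: hom_functor_def)
  have H_hom: "on_arr ?H f \<in> hom (set_cat UNIV) (hom M X A) (hom M X B)" if "f \<in> hom M A B" for f A B
    unfolding H_arr[OF that] by (rule Fn_hom) (simp_all add: Mod.cmp_hom[OF _ that])
  have H_y: "on_obj ?H y = hom M X y" using y by (simp add: hom_functor_def)
  have F_arr: "on_arr (fctr_comp ?H D) a = on_arr ?H (on_arr D a)" for a by (simp add: fctr_comp_def)
  have fmap_H: "fmap (on_arr ?H f) g = f \<cdot>\<^bsub>M\<^esub> g" if "f \<in> hom M A B" "g \<in> hom M X A" for f g A B
    using that(2) by (simp add: H_arr[OF that(1)])
  have c_D: "c j \<cdot>\<^bsub>M\<^esub> on_arr D a = c i" if a: "a \<in> hom J i j" for a i j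
    using col homD[OF a] by (auto simp: is_colimit_def is_cocone_def)
  show ?thesis
  proof (rule filtered_set_colimit[OF filtered])
    fix a assume "a \<in> Arr J"
    then have a: "a \<in> hom J (src J a) (trg J a)" by (simp add: hom_def)
    note o = hom_Obj_J[OF a]
    show "on_arr (fctr_comp ?H D) a \<in> hom (set_cat UNIV) (on_obj (fctr_comp ?H D) (src J a)) (on_obj (fctr_comp ?H D) (trg J a))"
      using H_hom[OF D_arr[OF a]] o by (simp add: F_obj F_arr)
    fix x assume "x \<in> on_obj (fctr_comp ?H D) (src J a)"
    then have x: "x \<in> hom M X (on_obj D (src J a))" using o by (simp add: F_obj)
    have "c (trg J a) \<cdot>\<^bsub>M\<^esub> (on_arr D a \<cdot>\<^bsub>M\<^esub> x) = c (src J a) \<cdot>\<^bsub>M\<^esub> x"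
      using Mod.cmp_assoc[OF x D_arr[OF a] c] o c_D[OF a] by simp
    then show "fmap (on_arr ?H (c (trg J a))) (fmap (on_arr (fctr_comp ?H D) a) x) = fmap (on_arr ?H (c (src J a))) x"
      using fmap_H[OF D_arr[OF a] x] fmap_H[OF c[OF conjunct2[OF o]] Mod.cmp_hom[OF x D_arr[OF a]]] 
        fmap_H[OF c[OF conjunct1[OF o]] x] by (simp add: F_arr)
  next
    fix j assume j: "j \<in> Obj J"
    show "on_arr ?H (c j) \<in> hom (set_cat UNIV) (on_obj (fctr_comp ?H D) j) (on_obj ?H y)"
      using H_hom[OF c[OF j]] by (simp only: F_obj[OF j] H_y)
  next
    fix h assume "h \<in> on_obj ?H y"
    then have h: "h \<in> hom M X y" by (simp only: H_y)
    \<comment> \<open>Induction on the generators. The lifted values \<open>w\<close> may still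
      violate the edge equations, which so far are known only after passing to
      \<open>y\<close>.\<close>
    have "\<exists>j\<in>Obj J. \<exists>w. \<forall>g\<in>G. w g \<in> on_obj (on_obj D j) (srt g) \<and> app (c j) (srt g) (w g) = app h (srt g) (u g)"
      using fin(1) u
    proof (induction G)
      case empty then show ?case using filteredD(2)[OF filtered] by blast
    next
      case (insert g G)
      then obtain j w where w: "j \<in> Obj J" 
        "\<And>g. g \<in> G \<Longrightarrow> w g \<in> on_obj (on_obj D j) (srt g) \<and> app (c j) (srt g) (w g) = app h (srt g) (u g)" 
        by (metis insert_iff)
      have g: "srt g \<in> Obj T" "app h (srt g) (u g) \<in> on_obj y (srt g)" using insert.prems[of g] app_in[OF h] by simp_all
      obtain i x where x: "i \<in> Obj J" "x \<in> on_obj (on_obj D i) (srt g)" "app (c i) (srt g) x = app h (srt g) (u g)"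
        using filtered_colimit_surj[OF col g] by blast
      obtain k a b where ab: "a \<in> hom J j k" "b \<in> hom J i k" using filteredD(3)[OF filtered w(1) x(1)] by blast
      define w' where "w' g' = (if g' = g then app (on_arr D b) (srt g) x else app (on_arr D a) (srt g') (w g'))" for g'
      have "w' g' \<in> on_obj (on_obj D k) (srt g') \<and> app (c k) (srt g') (w' g') = app h (srt g') (u g')" 
        if g': "g' \<in> insert g G" for g'
      proof (cases "g' = g")
        case True
        then show ?thesis using app_D_in[OF ab(2) g(1) x(2)] c_nat[OF ab(2) g(1) x(2)] x(3) by (simp add: w'_def)
      next
        case False
        then have g'G: "g' \<in> G" and s: "srt g' \<in> Obj T" using g' insert.prems[of g'] by auto
        show ?thesis
          using app_D_in[OF ab(1) s] c_nat[OF ab(1) s] w(2)[OF g'G] False by (simp add: w'_def)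
      qed
      then show ?case using hom_Obj_J[OF ab(1)] by blast
    qed
    then obtain j w where j: "j \<in> Obj J" and w: "\<And>g. g \<in> G \<Longrightarrow> w g \<in> on_obj (on_obj D j) (srt g)"
      "\<And>g. g \<in> G \<Longrightarrow> app (c j) (srt g) (w g) = app h (srt g) (u g)" by blast
    have E: "i \<in> G \<and> l \<in> G \<and> f \<in> Arr T \<and> src T f = srt i \<and> trg T f = srt l \<and>
        act (on_obj D j) f (w i) \<in> on_obj (on_obj D j) (srt l)" if "(i, f, l) \<in> ed" for i f l
      using gr that act_in[OF D_obj[OF j], of f "w i"] w(1)[of i] by (fastforce simp: graph_def hom_def)
    \<comment> \<open>The equation of one edge after transport along \<open>a\<close>. It is
      attained because it holds in \<open>y\<close>, and it persists under further transport, as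
      \<open>filtered_common\<close> requires.\<close>
    define P where "P = (\<lambda>(i, f, l) a. app (on_arr D a) (srt l) (act (on_obj D j) f (w i)) = app (on_arr D a) (srt l) (w l))"
    obtain k a where a: "a \<in> hom J j k" "\<And>e. e \<in> ed \<Longrightarrow> P e a"
    proof (rule filtered_common[OF filtered j fin(2), of P])
      fix e assume e: "e \<in> ed"
      obtain i f l where ifl: "e = (i, f, l)" by (cases e)
      note * = E[OF e[unfolded ifl]]
      have "app (c j) (srt l) (act (on_obj D j) f (w i)) = act y f (app h (srt i) (u i))"
        using app_nat[OF c[OF j], of f "w i"] * w by simp
      also have "\<dots> = app h (srt l) (u l)"
        using app_nat[OF h, of f "u i"] * u(1)[of i] presentsD(3)[OF X e[unfolded ifl]] by simp
      also have "\<dots> = app (c j) (srt l) (w l)" using * w(2) by simp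
      finally show "\<exists>k. \<exists>a\<in>hom J j k. P e a"
        unfolding P_def ifl prod.case using * u(2) w(1)
        by (intro filtered_colimit_inj[OF col]) (auto simp: j)
      fix k l' a b assume "P e a" "a \<in> hom J j k" "b \<in> hom J k l'"
      then show "P e (b \<cdot>\<^bsub>J\<^esub> a)"
        using * u(2) w(1) by (auto simp: P_def ifl app_D_cmp)
    next
      fix k a assume "a \<in> hom J j k" "\<And>e. e \<in> ed \<Longrightarrow> P e a"
      then show thesis by (rule that)
    qed
    have k: "k \<in> Obj J" using hom_Obj_J[OF a(1)] by simp
    let ?v = "\<lambda>g. app (on_arr D a) (srt g) (w g)"
    have fam: "family G srt ed (on_obj D k) ?v"
      unfolding family_def
    proof (intro conjI ballI)
      show "?v g \<in> on_obj (on_obj D k) (srt g)" if "g \<in> G" for g using app_D_in[OF a(1)] u w that by simp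
      fix e assume e: "e \<in> ed"
      obtain i f l where ifl: "e = (i, f, l)" by (cases e)
      show "case e of (i, f, l) \<Rightarrow> act (on_obj D k) f (?v i) = ?v l"
        using a(2)[OF e] app_nat[OF D_arr[OF a(1)], of f "w i"] E[OF e[unfolded ifl]] w(1)[of i] by (simp add: P_def ifl)
    qed
    obtain g where g: "g \<in> hom M X (on_obj D k)" "\<And>i. i \<in> G \<Longrightarrow> app g (srt i) (u i) = ?v i"
      using presents_ex[OF X D_obj[OF k] fam] by blast
    have "c k \<cdot>\<^bsub>M\<^esub> g = h"
    proof (rule presents_eqI[OF X gr Mod.cmp_hom[OF g(1) c[OF k]] h])
      fix i assume i: "i \<in> G"
      show "app (c k \<cdot>\<^bsub>M\<^esub> g) (srt i) (u i) = app h (srt i) (u i)"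
        using app_cmp[OF g(1) c[OF k] u(2)[OF i] u(1)[OF i]] g(2)[OF i] c_nat[OF a(1) u(2)[OF i] w(1)[OF i]] w(2)[OF i] by simp
    qed
    then show "\<exists>j\<in>Obj J. \<exists>x\<in>on_obj (fctr_comp ?H D) j. fmap (on_arr ?H (c j)) x = h"
      using k g(1) fmap_H[OF c[OF k] g(1)] by (intro bexI[of _ k] bexI[of _ g]) (simp_all add: F_obj)
  next
    fix j x x' assume j: "j \<in> Obj J" and "x \<in> on_obj (fctr_comp ?H D) j" "x' \<in> on_obj (fctr_comp ?H D) j"
      and eq: "fmap (on_arr ?H (c j)) x = fmap (on_arr ?H (c j)) x'"
    then have x: "x \<in> hom M X (on_obj D j)" "x' \<in> hom M X (on_obj D j)" by (simp_all add: F_obj)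
    have eq': "c j \<cdot>\<^bsub>M\<^esub> x = c j \<cdot>\<^bsub>M\<^esub> x'" using eq fmap_H[OF c[OF j]] x by simp
    \<comment> \<open>Maps out of \<open>X\<close> are determined on generators, so it is enough to
      merge finitely many pairs of values.\<close>
    define P where "P = (\<lambda>g a. app (on_arr D a) (srt g) (app x (srt g) (u g)) = app (on_arr D a) (srt g) (app x' (srt g) (u g)))"
    obtain k a where a: "a \<in> hom J j k" "\<And>g. g \<in> G \<Longrightarrow> P g a"
    proof (rule filtered_common[OF filtered j fin(1), of P])
      fix g assume g: "g \<in> G"
      note xg = app_in[OF x(1) u(2)[OF g] u(1)[OF g]] app_in[OF x(2) u(2)[OF g] u(1)[OF g]]
      have "app (c j) (srt g) (app x (srt g) (u g)) = app (c j) (srt g) (app x' (srt g) (u g))"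
        using app_cmp[OF x(1) c[OF j] u(2)[OF g] u(1)[OF g]] app_cmp[OF x(2) c[OF j] u(2)[OF g] u(1)[OF g]] eq' by simp
      then show "\<exists>k. \<exists>a\<in>hom J j k. P g a"
        unfolding P_def by (rule filtered_colimit_inj[OF col u(2)[OF g] j xg])
      fix k l a b assume "P g a" "a \<in> hom J j k" "b \<in> hom J k l"
      then show "P g (b \<cdot>\<^bsub>J\<^esub> a)" using xg u(2)[OF g] by (simp add: P_def app_D_cmp)
    next
      fix k a assume "a \<in> hom J j k" "\<And>g. g \<in> G \<Longrightarrow> P g a"
      then show thesis by (rule that)
    qed
    have "on_arr D a \<cdot>\<^bsub>M\<^esub> x = on_arr D a \<cdot>\<^bsub>M\<^esub> x'"
    proof (rule presents_eqI[OF X gr Mod.cmp_hom[OF x(1) D_arr[OF a(1)]] Mod.cmp_hom[OF x(2) D_arr[OF a(1)]]])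
      fix g assume g: "g \<in> G"
      show "app (on_arr D a \<cdot>\<^bsub>M\<^esub> x) (srt g) (u g) = app (on_arr D a \<cdot>\<^bsub>M\<^esub> x') (srt g) (u g)"
        using a(2)[OF g] unfolding P_def app_cmp[OF x(1) D_arr[OF a(1)] u(2)[OF g] u(1)[OF g]]
          app_cmp[OF x(2) D_arr[OF a(1)] u(2)[OF g] u(1)[OF g]] .
    qed
    then show "\<exists>k. \<exists>a\<in>hom J j k. fmap (on_arr (fctr_comp ?H D) a) x = fmap (on_arr (fctr_comp ?H D) a) x'"
      using a(1) fmap_H[OF D_arr[OF a(1)]] x by (auto simp: F_arr intro!: exI[of _ k] bexI[of _ a])
  qed
qed

end

section \<open>Compactness of finite presentations, density of representables\<close>

context clan_models
begin

lemma presented_compact: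
  assumes "presents G srt ed X u" "graph G srt ed" "finite G" "finite ed"
  shows "compact_obj \<kappa> M X"
  unfolding compact_obj_def
proof (intro conjI allI impI)
  show "X \<in> Obj M" by (rule presentsD(1)[OF assms(1)])
  fix J :: "('u, 'u) cat" and D y c
  assume *: "small_category \<kappa> J \<and> filtered J \<and> is_functor J M D \<and> is_colimit J M D y c"
  have J: "small_category \<kappa> J" "filtered J" "is_functor J M D" and col: "is_colimit J M D y c"
    using * by - (elim conjE, assumption)+
  interpret filtered_diagram T \<kappa> Disp J D
    using J by (intro filtered_diagram.intro diagram.intro diagram_axioms.intro filtered_diagram_axioms.intro
      clan_models_axioms) (simp_all add: small_category_def)
  show "is_colimit J (set_cat UNIV) (fctr_comp (hom_functor M X) D) (on_obj (hom_functor M X) y)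
      (\<lambda>j. on_arr (hom_functor M X) (c j))"
    by (rule hom_preserves_colimit[OF assms col])
qed

text \<open>Yoneda: \<open>H \<Gamma>\<close> is the free model on one generator of sort \<Gamma>.
  With one node and no edges the graph is finite, so representables are compact.\<close>

lemma presents_H:
  assumes \<Gamma>: "\<Gamma> \<in> Obj T"
  shows "presents {()} (\<lambda>_. \<Gamma>) {} (H \<Gamma>) (\<lambda>_. ident T \<Gamma>)"
proof -
  have "\<exists>!h. h \<in> hom M (H \<Gamma>) B \<and> app h \<Gamma> (ident T \<Gamma>) = v" if B: "B \<in> Obj M" and v: "v \<in> on_obj B \<Gamma>" for B v
    using yon_hom[OF B \<Gamma> v] app_yon_ident[OF B \<Gamma> v] yon_eqI[OF _ _ \<Gamma>] by (intro ex1I[of _ "yon B \<Gamma> v"]) auto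
  then show ?thesis using H_model[OF \<Gamma>] ident_hom[OF \<Gamma>] by (auto simp: presents_def family_def H_obj \<Gamma>)
qed

lemma compact_H: "\<Gamma> \<in> Obj T \<Longrightarrow> compact_obj \<kappa> M (H \<Gamma>)"
  by (rule presented_compact[OF presents_H]) (auto simp: graph_def)

text \<open>Stated for every \<open>S\<close> containing the representables, since the compact
  0-extensions may include further models. The Yoneda maps are arrows of the comma category, so a
  cocone over it is determined by its legs at elements of \<open>A\<close>.\<close>

lemma dense_if_contains_H:
  assumes S: "S \<subseteq> Obj M" and HS: "\<And>\<Gamma>. \<Gamma> \<in> Obj T \<Longrightarrow> H \<Gamma> \<in> S"
  shows "dense_subcat M S"
  unfolding dense_subcat_def
proof (intro conjI ballI S)
  fix A assume A: "A \<in> Obj M"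
  let ?C = "comma_over M S A"
  have C_obj: "f \<in> Obj ?C \<longleftrightarrow> f \<in> hom M (nsrc f) A \<and> nsrc f \<in> S" for f
    by (auto simp: comma_over_def Let_def hom_def)
  have proj: "on_obj (comma_proj M) f = nsrc f" "on_arr (comma_proj M) (f, h, g) = h" for f h g
    by (simp_all add: comma_proj_def)
  have C_ends: "src ?C (f, h, g) = f" "trg ?C (f, h, g) = g" for f h g
    by (simp_all add: comma_over_def Let_def)
  have C_arr: "(f, h, g) \<in> Arr ?C \<longleftrightarrow> f \<in> Obj ?C \<and> g \<in> Obj ?C \<and> h \<in> hom M (nsrc f) (nsrc g) \<and> g \<cdot>\<^bsub>M\<^esub> h = f" for f h g
    by (auto simp: comma_over_def Let_def)
  have yon: "yon A \<Gamma> x \<in> Obj ?C" "nsrc (yon A \<Gamma> x) = H \<Gamma>" if "\<Gamma> \<in> Obj T" "x \<in> on_obj A \<Gamma>" for \<Gamma> x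
    using yon_hom[OF A that] HS[OF that(1)] by (auto simp: C_obj hom_def)
  have cocone: "is_cocone ?C M (comma_proj M) A (\<lambda>f. f)"
    unfolding is_cocone_def
  proof (intro conjI ballI)
    show "trg ?C a \<cdot>\<^bsub>M\<^esub> on_arr (comma_proj M) a = src ?C a" if "a \<in> Arr ?C" for a
      using that by (cases a) (simp add: C_arr C_ends proj)
  qed (auto simp: A C_obj proj)
  have "\<exists>!h. h \<in> hom M A y \<and> (\<forall>f\<in>Obj ?C. h \<cdot>\<^bsub>M\<^esub> f = d f)" if y: "is_cocone ?C M (comma_proj M) y d" for y d
  proof -
    have yM: "y \<in> Obj M" and d: "d f \<in> hom M (nsrc f) y" if "f \<in> Obj ?C" for f
      using y that by (auto simp: is_cocone_def proj)
    have yM: "y \<in> Obj M" using y by (simp add: is_cocone_def)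
    have d_nat: "d g \<cdot>\<^bsub>M\<^esub> h = d f" if "(f, h, g) \<in> Arr ?C" for f h g
      using y that unfolding is_cocone_def by (force simp: C_ends proj)
    have d_yon: "d (yon A \<Gamma> x) \<in> hom M (H \<Gamma>) y" if "\<Gamma> \<in> Obj T" "x \<in> on_obj A \<Gamma>" for \<Gamma> x
      using d[OF yon(1)[OF that]] yon(2)[OF that] by simp
    define \<phi> where "\<phi> \<Gamma> x = app (d (yon A \<Gamma> x)) \<Gamma> (ident T \<Gamma>)" for \<Gamma> x
    \<comment> \<open>The leg at an arbitrary \<open>f\<close> reduces to legs at representables:
      the Yoneda map of \<open>a\<close> is an arrow of the comma category from the Yoneda map of
      \<open>app f \<Gamma> a\<close> to \<open>f\<close>.\<close>
    have factor: "app (d f) \<Gamma> a = \<phi> \<Gamma> (app f \<Gamma> a)" if f: "f \<in> Obj ?C" and \<Gamma>: "\<Gamma> \<in> Obj T" and a: "a \<in> on_obj (nsrc f) \<Gamma>" for f \<Gamma> a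
    proof -
      have fh: "f \<in> hom M (nsrc f) A" using f by (simp add: C_obj)
      note K = hom_Obj(1)[OF fh]
      note fa = app_in[OF fh \<Gamma> a] and ya = yon_hom[OF K \<Gamma> a]
      have i: "ident T \<Gamma> \<in> on_obj (H \<Gamma>) \<Gamma>" using \<Gamma> ident_hom by (simp add: H_obj)
      have "f \<cdot>\<^bsub>M\<^esub> yon (nsrc f) \<Gamma> a = yon A \<Gamma> (app f \<Gamma> a)"
        by (rule yon_eqI[OF Mod.cmp_hom[OF ya fh] yon_hom[OF A \<Gamma> fa] \<Gamma>])
          (simp add: app_cmp[OF ya fh \<Gamma> i] app_yon_ident[OF K \<Gamma> a] app_yon_ident[OF A \<Gamma> fa])
      then have "(yon A \<Gamma> (app f \<Gamma> a), yon (nsrc f) \<Gamma> a, f) \<in> Arr ?C"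
        using yon[OF \<Gamma> fa] f ya by (simp add: C_arr)
      from d_nat[OF this] show ?thesis
        using app_cmp[OF ya d[OF f] \<Gamma> i] app_yon_ident[OF K \<Gamma> a] by (simp add: \<phi>_def)
    qed
    have \<phi>_in: "\<phi> \<Gamma> x \<in> on_obj y \<Gamma>" if "\<Gamma> \<in> Obj T" "x \<in> on_obj A \<Gamma>" for \<Gamma> x
      unfolding \<phi>_def by (rule app_ident_H_in[OF d_yon[OF that] that(1)])
    have \<phi>_nat: "\<phi> (trg T k) (act A k x) = act y k (\<phi> (src T k) x)" if k: "k \<in> Arr T" and x: "x \<in> on_obj A (src T k)" for k x
    proof -
      have kh: "k \<in> hom T (src T k) (trg T k)" using k by (simp add: hom_def)
      have k': "k \<in> on_obj (H (src T k)) (trg T k)" using kh trg_Obj[OF k] by (simp add: H_obj)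
      note o = src_Obj[OF k]
      \<comment> \<open>\<open>factor\<close> is applied to the Yoneda map of \<open>x\<close>, at
        the element \<open>k\<close> of its representable; this gives naturality of \<phi> along
        \<open>k\<close>.\<close>
      have "app (d (yon A (src T k) x)) (trg T k) k = \<phi> (trg T k) (app (yon A (src T k) x) (trg T k) k)"
        by (rule factor[OF yon(1)[OF o x] trg_Obj[OF k]]) (simp add: yon(2)[OF o x] k')
      then show ?thesis
        unfolding app_yon[OF A o x kh] app_H[OF d_yon[OF o x] o kh] by (simp add: \<phi>_def)
    qed
    let ?h = "mk_trans T A y \<phi>"
    have h: "?h \<in> hom M A y" by (rule mk_trans_hom(1)[OF A yM \<phi>_in \<phi>_nat])
    have app_h: "app ?h \<Gamma> x = \<phi> \<Gamma> x" if "\<Gamma> \<in> Obj T" "x \<in> on_obj A \<Gamma>" for \<Gamma> x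
      by (rule mk_trans_hom(2)[OF A yM \<phi>_in \<phi>_nat that])
    show ?thesis
    proof (rule ex1I[of _ ?h], intro conjI h ballI)
      fix f assume f: "f \<in> Obj ?C"
      then have fh: "f \<in> hom M (nsrc f) A" by (simp add: C_obj)
      show "?h \<cdot>\<^bsub>M\<^esub> f = d f"
        by (rule Mod_hom_eqI[OF Mod.cmp_hom[OF fh h] d[OF f]])
          (simp add: app_cmp[OF fh h] app_h app_in[OF fh] factor[OF f])
    next
      fix k assume k: "k \<in> hom M A y \<and> (\<forall>f\<in>Obj ?C. k \<cdot>\<^bsub>M\<^esub> f = d f)"
      show "k = ?h"
      proof (rule Mod_hom_eqI[OF _ h])
        fix \<Gamma> x assume x: "\<Gamma> \<in> Obj T" "x \<in> on_obj A \<Gamma>"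
        have i: "ident T \<Gamma> \<in> on_obj (H \<Gamma>) \<Gamma>" using x(1) ident_hom by (simp add: H_obj)
        have "k \<cdot>\<^bsub>M\<^esub> yon A \<Gamma> x = d (yon A \<Gamma> x)" using k yon(1)[OF x] by blast
        then show "app k \<Gamma> x = app ?h \<Gamma> x"
          using app_cmp[OF yon_hom[OF A x] conjunct1[OF k] x(1) i] app_yon_ident[OF A x] 
          by (simp add: app_h[OF x] \<phi>_def)
      qed (use k in simp)
    qed
  qed
  with cocone show "is_colimit ?C M (comma_proj M) A (\<lambda>f. f)" by (simp add: is_colimit_def)
qed

end

section \<open>Every model is a filtered colimit of finite presentations\<close>

context small_sizes
begin

lemma small_inj: assumes "inj_on f A" "f ` A \<subseteq> B" "|B| <o \<kappa>" shows "|A| <o \<kappa>"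
  using card_of_ordLeq[of A B] assms ordLeq_ordLess_trans by blast

text \<open>The index categories in the definition of local presentability live on
  \<open>'u\<close>. A directed family of sets is copied there, with \<iota> coding the objects and
  \<pi> the inclusions, recorded as pairs; \<open>ob\<close> recovers the sets.\<close>

lemma directed_category:
  fixes I :: "'x set set"
  assumes I: "|I| <o \<kappa>" "I \<noteq> {}" and Un: "\<And>F F'. F \<in> I \<Longrightarrow> F' \<in> I \<Longrightarrow> F \<union> F' \<in> I"
  obtains J :: "('u, 'u) cat" and ob where "small_category \<kappa> J" "filtered J" "bij_betw ob (Obj J) I"
    "\<And>i j. i \<in> Obj J \<Longrightarrow> j \<in> Obj J \<Longrightarrow> hom J i j \<noteq> {} \<longleftrightarrow> ob i \<subseteq> ob j"
proof -
  let ?A = "{(F, F'). F \<in> I \<and> F' \<in> I \<and> F \<subseteq> F'}"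
  have A: "|?A| <o \<kappa>" by (rule small_subset[OF _ small_Times[OF I(1) I(1)]]) auto
  obtain \<iota> :: "'x set \<Rightarrow> 'u" where \<iota>: "inj_on \<iota> I" using small_embed[OF I(1)] .
  obtain \<pi> :: "'x set \<times> 'x set \<Rightarrow> 'u" where \<pi>: "inj_on \<pi> ?A" using small_embed[OF A] .
  define ob where "ob = inv_into I \<iota>"
  define en where "en = inv_into ?A \<pi>"
  have ob: "ob (\<iota> F) = F" if "F \<in> I" for F using that \<iota> by (simp add: ob_def)
  have en: "en (\<pi> (F, F')) = (F, F')" if "F \<in> I" "F' \<in> I" "F \<subseteq> F'" for F F'
    unfolding en_def by (rule inv_into_f_f[OF \<pi>]) (use that in simp)
  define J where "J = \<lparr>Obj = \<iota> ` I, Arr = \<pi> ` ?A, src = (\<lambda>a. \<iota> (fst (en a))), trg = (\<lambda>a. \<iota> (snd (en a))),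
    ident = (\<lambda>i. \<pi> (ob i, ob i)), cmp = (\<lambda>b a. \<pi> (fst (en a), snd (en b)))\<rparr>"
  have Obj: "i \<in> Obj J \<longleftrightarrow> (\<exists>F\<in>I. i = \<iota> F)" for i by (auto simp: J_def)
  have hom: "a \<in> hom J (\<iota> F) (\<iota> F') \<longleftrightarrow> F \<subseteq> F' \<and> a = \<pi> (F, F')" if FF: "F \<in> I" "F' \<in> I" for a F F'
  proof
    assume "a \<in> hom J (\<iota> F) (\<iota> F')"
    then obtain K K' where K: "a = \<pi> (K, K')" "K \<in> I" "K' \<in> I" "K \<subseteq> K'" "\<iota> K = \<iota> F" "\<iota> K' = \<iota> F'"
      by (auto simp: hom_def J_def en)
    then show "F \<subseteq> F' \<and> a = \<pi> (F, F')" using inj_onD[OF \<iota>] FF by metis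
  qed (use FF in \<open>auto simp: hom_def J_def en\<close>)
  have J_simps: "ident J (\<iota> F) = \<pi> (F, F)" if "F \<in> I" for F using that by (simp add: J_def ob)
  have cmp: "\<pi> (F', F'') \<cdot>\<^bsub>J\<^esub> \<pi> (F, F') = \<pi> (F, F'')" 
    if "F \<in> I" "F' \<in> I" "F'' \<in> I" "F \<subseteq> F'" "F' \<subseteq> F''" for F F' F'' using that by (simp add: J_def en)
  have hom_cases: "\<exists>F F'. F \<in> I \<and> F' \<in> I \<and> F \<subseteq> F' \<and> X = \<iota> F \<and> Y = \<iota> F' \<and> a = \<pi> (F, F')" if "a \<in> hom J X Y" for a X Y
    using that by (auto simp: hom_def J_def en) blast
  have cat: "category J"
  proof
    show "src J a \<in> Obj J" "trg J a \<in> Obj J" if "a \<in> Arr J" for a using that by (auto simp: J_def en)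
    show "ident J X \<in> hom J X X" if "X \<in> Obj J" for X using that by (auto simp: Obj hom J_simps)
    show "g \<cdot>\<^bsub>J\<^esub> f \<in> hom J X Z" if f: "f \<in> hom J X Y" and g: "g \<in> hom J Y Z" for f g X Y Z
    proof -
      obtain F F' where F: "F \<in> I" "F' \<in> I" "F \<subseteq> F'" "X = \<iota> F" "Y = \<iota> F'" "f = \<pi> (F, F')" using hom_cases[OF f] by blast
      obtain F'' where F'': "F'' \<in> I" "Z = \<iota> F''" using hom_cases[OF g] by blast
      then show ?thesis using f g F by (auto simp: hom cmp)
    qed
    show "ident J Y \<cdot>\<^bsub>J\<^esub> f = f" "f \<cdot>\<^bsub>J\<^esub> ident J X = f" if f: "f \<in> hom J X Y" for f X Y
      using hom_cases[OF f] by (auto simp: J_simps cmp)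
    show "h \<cdot>\<^bsub>J\<^esub> (g \<cdot>\<^bsub>J\<^esub> f) = h \<cdot>\<^bsub>J\<^esub> g \<cdot>\<^bsub>J\<^esub> f" 
      if f: "f \<in> hom J W X" and g: "g \<in> hom J X Y" and h: "h \<in> hom J Y Z" for f g h W X Y Z
    proof -
      obtain F F' where F: "F \<in> I" "F' \<in> I" "F \<subseteq> F'" "W = \<iota> F" "X = \<iota> F'" "f = \<pi> (F, F')" using hom_cases[OF f] by blast
      obtain K K' where K: "K \<in> I" "K' \<in> I" "K \<subseteq> K'" "Y = \<iota> K" "Z = \<iota> K'" "h = \<pi> (K, K')" using hom_cases[OF h] by blast
      have "F' \<subseteq> K" "g = \<pi> (F', K)" using g F K by (auto simp: hom)
      then show ?thesis using F K by (simp add: cmp subset_trans[of F F' K] subset_trans[of F' K K'])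
    qed
  qed
  have "small_category \<kappa> J"
    using cat small_image[OF I(1), of \<iota>] small_image[OF A, of \<pi>] by (simp add: small_category_def J_def)
  moreover have "filtered J"
    unfolding filtered_def
  proof (intro conjI ballI impI cat)
    show "Obj J \<noteq> {}" using I(2) by (simp add: J_def)
    show "\<exists>k\<in>Obj J. hom J i k \<noteq> {} \<and> hom J j k \<noteq> {}" if ij: "i \<in> Obj J" "j \<in> Obj J" for i j
    proof -
      obtain F F' where F: "F \<in> I" "i = \<iota> F" "F' \<in> I" "j = \<iota> F'" using ij by (auto simp: Obj)
      then have "\<pi> (F, F \<union> F') \<in> hom J i (\<iota> (F \<union> F'))" "\<pi> (F', F \<union> F') \<in> hom J j (\<iota> (F \<union> F'))"
        using Un[OF F(1,3)] by (auto simp: hom)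
      moreover have "\<iota> (F \<union> F') \<in> Obj J" using Un[OF F(1,3)] by (auto simp: Obj)
      ultimately show ?thesis by blast
    qed
    fix a b assume "a \<in> Arr J" "b \<in> Arr J" and ab: "src J a = src J b \<and> trg J a = trg J b"
    then have h: "a \<in> hom J (src J a) (trg J a)" "b \<in> hom J (src J a) (trg J a)" by (simp_all add: hom_def)
    obtain F F' where F: "F \<in> I" "F' \<in> I" "src J a = \<iota> F" "trg J a = \<iota> F'" using hom_cases[OF h(1)] by blast
    then have "a = b" using h by (simp add: hom)
    moreover have "ident J (trg J a) \<in> hom J (trg J a) (trg J a)" using F by (simp add: hom J_simps)
    ultimately show "\<exists>d\<in>Arr J. src J d = trg J a \<and> d \<cdot>\<^bsub>J\<^esub> a = d \<cdot>\<^bsub>J\<^esub> b" by (auto simp: hom_def)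
  qed
  moreover have "bij_betw ob (Obj J) I"
    using bij_betw_inv_into[OF inj_on_imp_bij_betw[OF \<iota>]] by (simp add: J_def ob_def)
  moreover have "hom J i j \<noteq> {} \<longleftrightarrow> ob i \<subseteq> ob j" if "i \<in> Obj J" "j \<in> Obj J" for i j
    using that by (auto simp: Obj hom ob)
  ultimately show thesis by (rule that)
qed

end

lemma full_subcat_hom: "hom (full_subcat C S) X Y = (if X \<in> S \<and> Y \<in> S then hom C X Y else {})"
  by (auto simp: hom_def full_subcat_def)

lemma functor_into_full_subcat:
  assumes "category J" "is_functor J C D" "\<And>j. j \<in> Obj J \<Longrightarrow> on_obj D j \<in> S"
  shows "is_functor J (full_subcat C S) D"
proof -
  interpret category J by fact
  have "cmp (full_subcat C S) = cmp C" "ident (full_subcat C S) = ident C" "Obj (full_subcat C S) = Obj C \<inter> S"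
    by (simp_all add: full_subcat_def)
  then show ?thesis using assms(2,3) src_Obj trg_Obj by (simp add: is_functor_def full_subcat_hom)
qed

text \<open>A graph is given by its edges alone; a generator subject to no relation can be present
  through an identity loop. Finite graphs thus become finite subsets of a fixed set.\<close>

definition nodes :: "('g \<times> 'a \<times> 'g) set \<Rightarrow> 'g set" where
  "nodes E = (\<Union>(i, f, j)\<in>E. {i, j})"

lemma nodesI: "(i, f, j) \<in> E \<Longrightarrow> i \<in> nodes E" "(i, f, j) \<in> E \<Longrightarrow> j \<in> nodes E"
  by (auto simp: nodes_def)

lemma finite_nodes: "finite E \<Longrightarrow> finite (nodes E)"
  by (auto simp: nodes_def)

context clan_models
begin

text \<open>Renaming along \<nu> puts the families on the two graphs in bijection, so the same model
  presents both.\<close>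

lemma presents_transport:
  assumes \<nu>: "inj_on \<nu> (nodes E)" and srt: "\<And>i. i \<in> nodes E \<Longrightarrow> srt' (\<nu> i) = srt i"
    and P: "presents (nodes ((\<lambda>(i, f, j). (\<nu> i, f, \<nu> j)) ` E)) srt' ((\<lambda>(i, f, j). (\<nu> i, f, \<nu> j)) ` E) P v"
  shows "presents (nodes E) srt E P (v \<circ> \<nu>)"
proof -
  let ?E = "(\<lambda>(i, f, j). (\<nu> i, f, \<nu> j)) ` E"
  have N: "nodes ?E = \<nu> ` nodes E" by (auto simp: nodes_def)
  have fam: "family (nodes ?E) srt' ?E B w \<longleftrightarrow> family (nodes E) srt E B (w \<circ> \<nu>)" for B w
    by (fastforce simp: family_def N srt)
  have uni: "\<exists>!h. h \<in> hom M P B \<and> (\<forall>g\<in>nodes ?E. app h (srt' g) (v g) = w g)"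
    if "B \<in> Obj M" "family (nodes E) srt E B (w \<circ> \<nu>)" for B w
    using P that unfolding presents_def fam by blast
  show ?thesis
    unfolding presents_def
  proof (intro conjI allI impI)
    show "P \<in> Obj M" by (rule presentsD(1)[OF P])
    show "family (nodes E) srt E P (v \<circ> \<nu>)" using P by (simp add: presents_def fam)
    fix B w assume "B \<in> Obj M \<and> family (nodes E) srt E B w"
    then have B: "B \<in> Obj M" and w: "family (nodes E) srt E B w" by auto
    let ?w = "w \<circ> inv_into (nodes E) \<nu>"
    have inv: "inv_into (nodes E) \<nu> (\<nu> i) = i" if "i \<in> nodes E" for i using that \<nu> by simp
    have "family (nodes E) srt E B (?w \<circ> \<nu>)"
      using w inv nodesI[of _ _ _ E] by (fastforce simp: family_def)
    then have "\<exists>!h. h \<in> hom M P B \<and> (\<forall>g\<in>nodes ?E. app h (srt' g) (v g) = ?w g)"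
      by (rule uni[OF B])
    then show "\<exists>!h. h \<in> hom M P B \<and> (\<forall>g\<in>nodes E. app h (srt g) ((v \<circ> \<nu>) g) = w g)"
      by (simp add: N srt inv)
  qed
qed

text \<open>Drawing nodes from \<open>nat \<times> Obj T\<close>, sorted by the second component, leaves only a small set of
  finite graphs and still represents each of them up to isomorphism.\<close>

definition fin_graphs :: "((nat \<times> 'o) \<times> 'u \<times> (nat \<times> 'o)) set set" where
  "fin_graphs = {E. finite E \<and> E \<subseteq> (UNIV \<times> Obj T) \<times> Arr T \<times> (UNIV \<times> Obj T) \<and> graph (nodes E) snd E}"

definition fp_model :: "((nat \<times> 'o) \<times> 'u \<times> (nat \<times> 'o)) set \<Rightarrow> ('o, 'u, 'u set, 'u fn) fctr" where
  "fp_model E = (SOME P. \<exists>u. presents (nodes E) snd E P u)"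

lemma fp_model: "E \<in> fin_graphs \<Longrightarrow> \<exists>u. presents (nodes E) snd E (fp_model E) u"
proof -
  assume E: "E \<in> fin_graphs"
  then have "\<exists>P. \<exists>u. presents (nodes E) snd E P u"
    using presentation_exists[OF small_finite[OF finite_nodes[of E]]] by (auto simp: fin_graphs_def) metis
  then show ?thesis unfolding fp_model_def by (rule someI_ex)
qed

lemma fin_graphs_small: "|fin_graphs| <o \<kappa>"
proof (rule small_subset)
  let ?X = "((UNIV :: nat set) \<times> Obj T) \<times> Arr T \<times> ((UNIV :: nat set) \<times> Obj T)"
  show "fin_graphs \<subseteq> {E. finite E \<and> E \<subseteq> ?X}" by (auto simp: fin_graphs_def)
  show "|{E. finite E \<and> E \<subseteq> ?X}| <o \<kappa>" 
    by (intro small_Fpow small_Times small_countable small_Obj small_Arr)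
qed

lemma hom_presented_small:
  assumes P: "presents G srt ed P u" and gr: "graph G srt ed" and "finite G" and B: "B \<in> Obj M"
  shows "|hom M P B| <o \<kappa>"
proof -
  \<comment> \<open>A function on \<open>G\<close> is recorded as a finite set of triples, because
    \<open>small_Fpow\<close> bounds sets of finite subsets. The entries \<open>u g\<close> and
    \<open>srt g\<close> tell which argument a value belongs to.\<close>
  let ?f = "\<lambda>h. (\<lambda>g. (u g, srt g, app h (srt g) (u g))) ` G"
  let ?X = "u ` G \<times> Obj T \<times> (\<Union>\<Gamma>\<in>Obj T. on_obj B \<Gamma>)"
  have inj: "inj_on ?f (hom M P B)"
  proof (rule inj_onI)
    fix h k assume h: "h \<in> hom M P B" and k: "k \<in> hom M P B" and eq: "?f h = ?f k"
    show "h = k"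
    proof (rule presents_eqI[OF P gr h k])
      fix g assume "g \<in> G"
      then have "(u g, srt g, app h (srt g) (u g)) \<in> ?f k" using eq by blast
      \<comment> \<open>The triple may stem from another generator, but from one with the same
        element and sort, where \<open>k\<close> takes the same value.\<close>
      then show "app h (srt g) (u g) = app k (srt g) (u g)" by auto
    qed
  qed
  have img: "?f ` hom M P B \<subseteq> {F. finite F \<and> F \<subseteq> ?X}"
  proof (rule image_subsetI, rule CollectI, rule conjI)
    fix h assume h: "h \<in> hom M P B"
    show "finite (?f h)" using assms(3) by simp
    have "srt g \<in> Obj T \<and> app h (srt g) (u g) \<in> on_obj B (srt g)" if "g \<in> G" for g
      using app_in[OF h] presentsD(2)[OF P that] gr that by (auto simp: graph_def)
    then show "?f h \<subseteq> ?X" by blast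
  qed
  have "|{F. finite F \<and> F \<subseteq> ?X}| <o \<kappa>"
    using assms(3) by (intro small_Fpow small_Times small_Obj small_UN small_finite model_small B) auto
  then show ?thesis by (rule small_inj[OF inj img])
qed

lemma fp_models_compact: "X \<in> fp_model ` fin_graphs \<Longrightarrow> compact_obj \<kappa> M X"
  using fp_model presented_compact finite_nodes by (fastforce simp: fin_graphs_def)

lemma fp_models_small: "small_category \<kappa> (full_subcat M (fp_model ` fin_graphs))"
proof -
  let ?S = "fp_model ` fin_graphs"
  have S: "|?S| <o \<kappa>" by (rule small_image[OF fin_graphs_small])
  have SM: "X \<in> Obj M" if "X \<in> ?S" for X using fp_models_compact[OF that] by (simp add: compact_obj_def)
  have hom: "|hom M X Y| <o \<kappa>" if "X \<in> ?S" "Y \<in> ?S" for X Y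
  proof -
    obtain E where "E \<in> fin_graphs" "X = fp_model E" using \<open>X \<in> ?S\<close> by blast
    moreover from this obtain u where "presents (nodes E) snd E X u" using fp_model by blast
    ultimately show ?thesis
      using SM[OF that(2)] finite_nodes by (intro hom_presented_small) (auto simp: fin_graphs_def)
  qed
  have "Arr (full_subcat M ?S) \<subseteq> (\<Union>X\<in>?S. \<Union>Y\<in>?S. hom M X Y)"
    by (auto simp: full_subcat_def hom_def)
  then have "|Arr (full_subcat M ?S)| <o \<kappa>"
    by (rule small_subset) (intro small_UN S hom)
  moreover have "|Obj (full_subcat M ?S)| <o \<kappa>"
    by (rule small_subset[OF _ S]) (auto simp: full_subcat_def)
  ultimately show ?thesis by (simp add: small_category_def category_full_subcat[OF category_Mod])
qed

text \<open>Finite sets of edges in the category of elements of \<open>A\<close> are directed under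
  inclusion. Each presents a model from the chosen set, and a cocone over them amounts to compatible
  values at all elements, which is a map out of \<open>A\<close>.\<close>

lemma filtered_colimit_of_fp_models:
  assumes A: "A \<in> Obj M"
  obtains J :: "('u, 'u) cat" and D c where "small_category \<kappa> J" "filtered J"
    "is_functor J (full_subcat M (fp_model ` fin_graphs)) D" "is_colimit J M D A c"
proof -
  let ?S = "fp_model ` fin_graphs"
  \<comment> \<open>The edges of the category of elements of \<open>A\<close>. Nodes are pairs of an
    object and an element, with \<open>fst\<close> as sort.\<close>
  define EA where "EA = (\<lambda>(f, x). ((src T f, x), f, (trg T f, act A f x))) ` (SIGMA f:Arr T. on_obj A (src T f))"
  have EA: "((\<Gamma>, x), f, (\<Delta>, x')) \<in> EA \<longleftrightarrow> f \<in> hom T \<Gamma> \<Delta> \<and> x \<in> on_obj A \<Gamma> \<and> x' = act A f x" for \<Gamma> x f \<Delta> x'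
    by (auto simp: EA_def hom_def image_iff)
  have EA_small: "|EA| <o \<kappa>" unfolding EA_def by (intro small_image small_Sigma small_Arr model_small A src_Obj)
  define I where "I = {F. finite F \<and> F \<subseteq> EA}"
  have I_small: "|I| <o \<kappa>" unfolding I_def by (rule small_Fpow[OF EA_small])
  have I_ne: "I \<noteq> {}" by (auto simp: I_def)
  have I_Un: "F \<union> F' \<in> I" if "F \<in> I" "F' \<in> I" for F F' using that by (auto simp: I_def)
  obtain J :: "('u, 'u) cat" and ob where Jf: "small_category \<kappa> J" "filtered J" "bij_betw ob (Obj J) I" and
    J_hom: "\<And>i j. i \<in> Obj J \<Longrightarrow> j \<in> Obj J \<Longrightarrow> hom J i j \<noteq> {} \<longleftrightarrow> ob i \<subseteq> ob j"
    using directed_category[OF I_small I_ne I_Un] by metis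
  have J_cat: "category J" and J_small: "|Obj J| <o \<kappa>" using Jf(1) by (simp_all add: small_category_def)
  interpret J: category J by (rule J_cat)
  have ob: "ob j \<in> I" if "j \<in> Obj J" for j using bij_betwE[OF Jf(3)] that by blast
  have J_hom': "i \<in> Obj J \<and> j \<in> Obj J \<and> ob i \<subseteq> ob j" if "a \<in> hom J i j" for a i j
    using that J_hom[of i j] J.src_Obj[of a] J.trg_Obj[of a] by (auto simp: hom_def[of J])
  have node: "\<Gamma> \<in> Obj T \<and> x \<in> on_obj A \<Gamma>" if F: "F \<in> I" and n: "(\<Gamma>, x) \<in> nodes F" for F \<Gamma> x
  proof -
    have "x \<in> on_obj A \<Gamma> \<and> \<Gamma> \<in> Obj T \<and> x' \<in> on_obj A \<Delta> \<and> \<Delta> \<in> Obj T" 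
      if e: "((\<Gamma>, x), f, (\<Delta>, x')) \<in> F" for \<Gamma> x f \<Delta> x'
    proof -
      have "((\<Gamma>, x), f, (\<Delta>, x')) \<in> EA" using e F by (auto simp: I_def)
      then show ?thesis using act_in[OF A, of f x] src_Obj[of f] trg_Obj[of f] by (auto simp: EA hom_def)
    qed
    then show ?thesis using n unfolding nodes_def by fastforce
  qed
  have gr: "graph (nodes F) fst F" if F: "F \<in> I" for F
    unfolding graph_def
  proof (intro conjI ballI)
    show "fst g \<in> Obj T" if "g \<in> nodes F" for g using node[OF F, of "fst g" "snd g"] that by simp
    fix e assume e: "e \<in> F"
    obtain \<Gamma> x f \<Delta> x' where e': "e = ((\<Gamma>, x), f, (\<Delta>, x'))" by (metis surj_pair)
    have "e \<in> EA" using e F by (auto simp: I_def)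
    then show "case e of (i, f, j) \<Rightarrow> i \<in> nodes F \<and> j \<in> nodes F \<and> f \<in> hom T (fst i) (fst j)"
      using nodesI[of "(\<Gamma>, x)" f "(\<Delta>, x')" F] e by (simp add: e' EA)
  qed
  have "\<exists>P u. P \<in> ?S \<and> presents (nodes F) fst F P u" if F: "F \<in> I" for F
  proof -
    have "finite (nodes F)" using F finite_nodes by (auto simp: I_def)
    \<comment> \<open>Numbering the finitely many nodes moves the graph into
      \<open>nat \<times> Obj T\<close>; keeping the object as second component preserves the
      sorts.\<close>
    then obtain \<beta> :: "'o \<times> 'u \<Rightarrow> nat" where \<beta>: "inj_on \<beta> (nodes F)" using finite_imp_inj_to_nat_seg by metis
    define \<nu> where "\<nu> i = (\<beta> i, fst i)" for i
    let ?E = "(\<lambda>(i, f, j). (\<nu> i, f, \<nu> j)) ` F"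
    have \<nu>: "inj_on \<nu> (nodes F)" using \<beta> by (auto simp: \<nu>_def inj_on_def)
    have s: "snd (\<nu> i) = fst i" for i by (simp add: \<nu>_def)
    have e: "i \<in> nodes F \<and> j \<in> nodes F \<and> f \<in> hom T (fst i) (fst j) \<and> fst i \<in> Obj T \<and> fst j \<in> Obj T" if "(i, f, j) \<in> F" for i f j
      using gr[OF F] that by (fastforce simp: graph_def)
    have "nodes ?E = \<nu> ` nodes F" by (auto simp: nodes_def)
    then have "graph (nodes ?E) snd ?E"
      using e gr[OF F] by (fastforce simp: graph_def s)
    moreover have "?E \<subseteq> (UNIV \<times> Obj T) \<times> Arr T \<times> (UNIV \<times> Obj T)"
    proof
      fix y assume "y \<in> ?E"
      then obtain i f j where "(i, f, j) \<in> F" "y = (\<nu> i, f, \<nu> j)" by auto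
      then show "y \<in> (UNIV \<times> Obj T) \<times> Arr T \<times> (UNIV \<times> Obj T)" using e[of i f j] by (simp add: \<nu>_def hom_def)
    qed
    ultimately have E: "?E \<in> fin_graphs" using F by (simp add: fin_graphs_def I_def)
    then obtain v where "presents (nodes ?E) snd ?E (fp_model ?E) v" using fp_model by blast
    then have "presents (nodes F) fst F (fp_model ?E) (v \<circ> \<nu>)" by (rule presents_transport[of \<nu> F snd fst, OF \<nu> s])
    then show ?thesis using E by blast
  qed
  then obtain P u where P: "\<And>F. F \<in> I \<Longrightarrow> P F \<in> ?S" and u: "\<And>F. F \<in> I \<Longrightarrow> presents (nodes F) fst F (P F) (u F)" by metis
  have PM: "P F \<in> Obj M" if "F \<in> I" for F by (rule presentsD(1)[OF u[OF that]])
  have u_in: "u F (\<Gamma>, x) \<in> on_obj (P F) \<Gamma>" if "F \<in> I" "(\<Gamma>, x) \<in> nodes F" for F \<Gamma> x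
    using presentsD(2)[OF u[OF that(1)] that(2)] by simp
  have nodes_mono: "nodes F \<subseteq> nodes F'" if "F \<subseteq> F'" for F F' using that by (auto simp: nodes_def)
  have "\<exists>h. h \<in> hom M (P F) (P F') \<and> (\<forall>g\<in>nodes F. app h (fst g) (u F g) = u F' g)" 
    if F: "F \<in> I" "F' \<in> I" "F \<subseteq> F'" for F F'
  proof -
    have "family (nodes F) fst F (P F') (u F')"
      using u[OF F(2)] F(3) nodes_mono[OF F(3)] unfolding presents_def family_def by blast
    then show ?thesis using presents_ex[OF u[OF F(1)] PM[OF F(2)]] by blast
  qed
  then obtain hm where hm: "\<And>F F'. F \<in> I \<Longrightarrow> F' \<in> I \<Longrightarrow> F \<subseteq> F' \<Longrightarrow> hm F F' \<in> hom M (P F) (P F')"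
    and hm_u: "\<And>F F' g. F \<in> I \<Longrightarrow> F' \<in> I \<Longrightarrow> F \<subseteq> F' \<Longrightarrow> g \<in> nodes F \<Longrightarrow> app (hm F F') (fst g) (u F g) = u F' g"
    by metis
  \<comment> \<open>The transition maps are merely chosen with prescribed values on generators;
    uniqueness of maps out of a presentation makes them functorial.\<close>
  have hm_id: "hm F F = ident M (P F)" if F: "F \<in> I" for F
  proof (rule presents_eqI[OF u[OF F] gr[OF F] hm[OF F F subset_refl] Mod.ident_hom[OF PM[OF F]]])
    fix g assume g: "g \<in> nodes F"
    have "app (ident M (P F)) (fst g) (u F g) = u F g"
      by (rule app_ident) (use gr[OF F] g presentsD(2)[OF u[OF F] g] in \<open>auto simp: graph_def\<close>)
    then show "app (hm F F) (fst g) (u F g) = app (ident M (P F)) (fst g) (u F g)"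
      using hm_u[OF F F subset_refl g] by simp
  qed
  have hm_cmp: "hm F F'' = hm F' F'' \<cdot>\<^bsub>M\<^esub> hm F F'" if F: "F \<in> I" "F' \<in> I" "F'' \<in> I" "F \<subseteq> F'" "F' \<subseteq> F''" for F F' F''
  proof (rule presents_eqI[OF u[OF F(1)] gr[OF F(1)] hm[OF F(1,3)] Mod.cmp_hom[OF hm[OF F(1,2,4)] hm[OF F(2,3,5)]]])
    show FF: "F \<subseteq> F''" using F by blast
    fix g assume g: "g \<in> nodes F"
    have "g \<in> nodes F'" using g nodes_mono[OF F(4)] by blast
    then show "app (hm F F'') (fst g) (u F g) = app (hm F' F'' \<cdot>\<^bsub>M\<^esub> hm F F') (fst g) (u F g)"
      using hm_u[OF F(1,3) FF g] hm_u[OF F(1,2,4) g] hm_u[OF F(2,3,5)] 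
        app_cmp[OF hm[OF F(1,2,4)] hm[OF F(2,3,5)], of "fst g" "u F g"] gr[OF F(1)] g presentsD(2)[OF u[OF F(1)] g] 
      by (simp add: graph_def)
  qed
  define D where "D = Fctr (\<lambda>j. P (ob j)) (\<lambda>a. hm (ob (src J a)) (ob (trg J a)))"
  have D_ob: "on_obj D j = P (ob j)" for j by (simp add: D_def)
  have D_ar: "on_arr D a = hm (ob i) (ob j)" if "a \<in> hom J i j" for a i j using that by (simp add: D_def hom_def)
  have D: "is_functor J M D"
    unfolding is_functor_def
  proof (intro conjI ballI impI)
    show "on_obj D X \<in> Obj M" if "X \<in> Obj J" for X using PM[OF ob[OF that]] by (simp add: D_ob)
    show "on_arr D f \<in> hom M (on_obj D (src J f)) (on_obj D (trg J f))" if "f \<in> Arr J" for f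
    proof -
      have f: "f \<in> hom J (src J f) (trg J f)" using that by (simp add: hom_def)
      note * = J_hom'[OF f]
      show ?thesis using hm[OF ob ob, of "src J f" "trg J f"] * by (simp add: D_ar[OF f] D_ob)
    qed
    show "on_arr D (ident J X) = ident M (on_obj D X)" if "X \<in> Obj J" for X
      using D_ar[OF J.ident_hom[OF that]] hm_id[OF ob[OF that]] by (simp add: D_ob)
    show "on_arr D (g \<cdot>\<^bsub>J\<^esub> f) = on_arr D g \<cdot>\<^bsub>M\<^esub> on_arr D f" if "f \<in> Arr J" "g \<in> Arr J" "src J g = trg J f" for f g
    proof -
      have f: "f \<in> hom J (src J f) (trg J f)" and g: "g \<in> hom J (trg J f) (trg J g)" using that by (simp_all add: hom_def)
      show ?thesis
        unfolding D_ar[OF f] D_ar[OF g] D_ar[OF J.cmp_hom[OF f g]]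
        using hm_cmp[OF ob ob ob] J_hom'[OF f] J_hom'[OF g] by blast
    qed
  qed
  interpret diagram T \<kappa> Disp J D
    by (intro diagram.intro diagram_axioms.intro clan_models_axioms J_cat D J_small)
  have "family (nodes F) fst F A snd" if F: "F \<in> I" for F
    unfolding family_def
  proof (intro conjI ballI)
    show "snd g \<in> on_obj A (fst g)" if "g \<in> nodes F" for g using node[OF F, of "fst g" "snd g"] that by simp
    fix e assume e: "e \<in> F"
    obtain \<Gamma> x f \<Delta> x' where e': "e = ((\<Gamma>, x), f, (\<Delta>, x'))" by (metis surj_pair)
    have "e \<in> EA" using e F by (auto simp: I_def)
    then show "case e of (i, f, j) \<Rightarrow> act A f (snd i) = snd j" by (simp add: e' EA)
  qed
  then have "\<exists>h. h \<in> hom M (P F) A \<and> (\<forall>g\<in>nodes F. app h (fst g) (u F g) = snd g)" if "F \<in> I" for F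
    using presents_ex[OF u[OF that] A] that by blast
  then obtain cc where cc: "\<And>F. F \<in> I \<Longrightarrow> cc F \<in> hom M (P F) A"
    and cc_u: "\<And>F g. F \<in> I \<Longrightarrow> g \<in> nodes F \<Longrightarrow> app (cc F) (fst g) (u F g) = snd g" by metis
  let ?c = "\<lambda>j. cc (ob j)"
  have cc_hm: "cc F' \<cdot>\<^bsub>M\<^esub> hm F F' = cc F" if F: "F \<in> I" "F' \<in> I" "F \<subseteq> F'" for F F'
  proof (rule presents_eqI[OF u[OF F(1)] gr[OF F(1)] Mod.cmp_hom[OF hm[OF F] cc[OF F(2)]] cc[OF F(1)]])
    fix g assume g: "g \<in> nodes F"
    then have "g \<in> nodes F'" using nodes_mono[OF F(3)] by blast
    then show "app (cc F' \<cdot>\<^bsub>M\<^esub> hm F F') (fst g) (u F g) = app (cc F) (fst g) (u F g)"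
      using app_cmp[OF hm[OF F] cc[OF F(2)], of "fst g" "u F g"] gr[OF F(1)] g presentsD(2)[OF u[OF F(1)] g]
        hm_u[OF F g] cc_u[OF F(2)] cc_u[OF F(1) g] by (simp add: graph_def)
  qed
  have cocone: "is_cocone J M D A ?c"
    unfolding is_cocone_def
  proof (intro conjI ballI A)
    show "?c j \<in> hom M (on_obj D j) A" if "j \<in> Obj J" for j using cc[OF ob[OF that]] by (simp add: D_ob)
    show "?c (trg J a) \<cdot>\<^bsub>M\<^esub> on_arr D a = ?c (src J a)" if "a \<in> Arr J" for a
    proof -
      have a: "a \<in> hom J (src J a) (trg J a)" using that by (simp add: hom_def)
      show ?thesis unfolding D_ar[OF a] using cc_hm[OF ob ob] J_hom'[OF a] by blast
    qed
  qed
  have "\<exists>!h. h \<in> hom M A y \<and> (\<forall>j\<in>Obj J. h \<cdot>\<^bsub>M\<^esub> ?c j = d j)" if y: "is_cocone J M D y d" for y d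
  proof -
    have yM: "y \<in> Obj M" using y by (simp add: is_cocone_def)
    define jj where "jj = inv_into (Obj J) ob"
    have jj: "jj F \<in> Obj J" "ob (jj F) = F" if "F \<in> I" for F
      using that bij_betw_inv_into_right[OF Jf(3)] bij_betw_imp_surj_on[OF Jf(3)] inv_into_into[of F ob "Obj J"] by (auto simp: jj_def)
    have jj_ob: "jj (ob j) = j" if "j \<in> Obj J" for j using bij_betw_inv_into_left[OF Jf(3) that] by (simp add: jj_def)
    have d: "d (jj F) \<in> hom M (P F) y" if "F \<in> I" for F 
      using conjunct1[OF conjunct2[OF y[unfolded is_cocone_def]], rule_format, OF jj(1)[OF that]] 
      unfolding D_ob jj(2)[OF that] .
    define val where "val F g = app (d (jj F)) (fst g) (u F g)" for F g
    have val_mono: "val F g = val F' g" if F: "F \<in> I" "F' \<in> I" "F \<subseteq> F'" and g: "g \<in> nodes F" for F F' g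
    proof -
      obtain a where a: "a \<in> hom J (jj F) (jj F')" using J_hom[of "jj F" "jj F'"] jj F by auto
      have "d (jj F') \<cdot>\<^bsub>M\<^esub> on_arr D a = d (jj F)" using y homD[OF a] by (auto simp: is_cocone_def)
      then have "d (jj F') \<cdot>\<^bsub>M\<^esub> hm F F' = d (jj F)" using D_ar[OF a] jj F by simp
      then show ?thesis
        using app_cmp[OF hm[OF F] d[OF F(2)], of "fst g" "u F g"] gr[OF F(1)] g presentsD(2)[OF u[OF F(1)] g] hm_u[OF F g]
        by (simp add: val_def graph_def)
    qed
    \<comment> \<open>Both stages are contained in their union, so the value at a node is
      independent of the stage.\<close>
    have val_eq: "val F g = val F' g" if F: "F \<in> I" "F' \<in> I" and g: "g \<in> nodes F" "g \<in> nodes F'" for F F' g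
      using val_mono[OF F(1) I_Un[OF F] _ g(1)] val_mono[OF F(2) I_Un[OF F] _ g(2)] by simp
    \<comment> \<open>A stage in which the element \<open>x\<close> occurs as a node, by means of
      its identity loop; so every element of \<open>A\<close> is reached.\<close>
    define e where "e \<Gamma> x = {((\<Gamma>, x), ident T \<Gamma>, (\<Gamma>, x))}" for \<Gamma> and x :: 'u
    have e: "e \<Gamma> x \<in> I" "(\<Gamma>, x) \<in> nodes (e \<Gamma> x)" if "\<Gamma> \<in> Obj T" "x \<in> on_obj A \<Gamma>" for \<Gamma> x
      using that ident_hom[OF that(1)] act_ident[OF A that] by (auto simp: e_def I_def EA nodes_def)
    define \<phi> where "\<phi> \<Gamma> x = val (e \<Gamma> x) (\<Gamma>, x)" for \<Gamma> x
    have \<phi>: "\<phi> \<Gamma> x = val F (\<Gamma>, x)" if "F \<in> I" "(\<Gamma>, x) \<in> nodes F" for F \<Gamma> x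
      unfolding \<phi>_def using that node[OF that] by (intro val_eq e) auto
    have \<phi>_in: "\<phi> \<Gamma> x \<in> on_obj y \<Gamma>" if "\<Gamma> \<in> Obj T" "x \<in> on_obj A \<Gamma>" for \<Gamma> x
      using app_in[OF d[OF e(1)[OF that]] that(1) u_in[OF e[OF that]]] by (simp add: \<phi>_def val_def)
    have \<phi>_nat: "\<phi> (trg T f) (act A f x) = act y f (\<phi> (src T f) x)" if f: "f \<in> Arr T" and x: "x \<in> on_obj A (src T f)" for f x
    proof -
      \<comment> \<open>The stage made of the single edge for \<open>f\<close> and \<open>x\<close>;
        the relation it imposes is naturality of \<phi> at that element.\<close>
      let ?e = "((src T f, x), f, (trg T f, act A f x))"
      let ?F = "{?e}"
      have F: "?F \<in> I" using f x by (simp add: I_def EA hom_def)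
      have n: "(src T f, x) \<in> nodes ?F" "(trg T f, act A f x) \<in> nodes ?F" by (auto simp: nodes_def)
      have "act (P ?F) f (u ?F (src T f, x)) = u ?F (trg T f, act A f x)" 
        using presentsD(3)[OF u[OF F], of "(src T f, x)" f "(trg T f, act A f x)"] by simp
      then show ?thesis
        using app_nat[OF d[OF F] f u_in[OF F n(1)]] by (simp add: \<phi>[OF F n(1)] \<phi>[OF F n(2)] val_def)
    qed
    let ?h = "mk_trans T A y \<phi>"
    have h: "?h \<in> hom M A y" by (rule mk_trans_hom(1)[OF A yM \<phi>_in \<phi>_nat])
    have app_h: "app ?h \<Gamma> x = \<phi> \<Gamma> x" if "\<Gamma> \<in> Obj T" "x \<in> on_obj A \<Gamma>" for \<Gamma> x
      by (rule mk_trans_hom(2)[OF A yM \<phi>_in \<phi>_nat that])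
    have cc_app: "app (k \<cdot>\<^bsub>M\<^esub> cc F) (fst g) (u F g) = app k (fst g) (snd g)" 
      if k: "k \<in> hom M A y" and F: "F \<in> I" and g: "g \<in> nodes F" for k F g
      using app_cmp[OF cc[OF F] k, of "fst g" "u F g"] cc_u[OF F g] gr[OF F] g presentsD(2)[OF u[OF F] g] by (simp add: graph_def)
    show ?thesis
    proof (rule ex1I[of _ ?h], intro conjI h ballI)
      fix j assume j: "j \<in> Obj J"
      note F = ob[OF j]
      have dj: "d j \<in> hom M (P (ob j)) y" using d[OF F] jj_ob[OF j] by simp
      show "?h \<cdot>\<^bsub>M\<^esub> ?c j = d j"
      proof (rule presents_eqI[OF u[OF F] gr[OF F] Mod.cmp_hom[OF cc[OF F] h] dj])
        fix g assume g: "g \<in> nodes (ob j)"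
        have "app ?h (fst g) (snd g) = val (ob j) g"
          using app_h[of "fst g" "snd g"] \<phi>[OF F, of "fst g" "snd g"] node[OF F, of "fst g" "snd g"] g by simp
        then show "app (?h \<cdot>\<^bsub>M\<^esub> ?c j) (fst g) (u (ob j) g) = app (d j) (fst g) (u (ob j) g)"
          unfolding cc_app[OF h F g] by (simp add: val_def jj_ob[OF j])
      qed
    next
      fix k assume k: "k \<in> hom M A y \<and> (\<forall>j\<in>Obj J. k \<cdot>\<^bsub>M\<^esub> ?c j = d j)"
      show "k = ?h"
      proof (rule Mod_hom_eqI[OF _ h])
        fix \<Gamma> x assume x: "\<Gamma> \<in> Obj T" "x \<in> on_obj A \<Gamma>"
        have "k \<cdot>\<^bsub>M\<^esub> cc (e \<Gamma> x) = d (jj (e \<Gamma> x))" using k jj[OF e(1)[OF x]] by metis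
        then show "app k \<Gamma> x = app ?h \<Gamma> x"
          using cc_app[OF conjunct1[OF k] e[OF x]] app_h[OF x] by (simp add: \<phi>_def val_def)
      qed (use k in simp)
    qed
  qed
  with cocone have "is_colimit J M D A ?c" by (simp add: is_colimit_def)
  moreover have "is_functor J (full_subcat M ?S) D"
    by (rule functor_into_full_subcat[OF J_cat D]) (simp add: D_ob P ob)
  ultimately show thesis using that Jf(1,2) by blast
qed

text \<open>The generating set consists of the finitely presented models and not of the
  representables, whose filtered colimits do not give all models in general.\<close>

lemma locally_fin_presentable_Mod: "locally_fin_presentable \<kappa> M"
  unfolding locally_fin_presentable_def
proof (intro conjI category_Mod exI[of _ "fp_model ` fin_graphs"] ballI fp_models_compact fp_models_small)
  show "cocomplete \<kappa> M"
    unfolding cocomplete_def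
  proof (intro allI impI)
    fix J :: "('u, 'u) cat" and D assume *: "small_category \<kappa> J \<and> is_functor J M D"
    interpret diagram T \<kappa> Disp J D
      using * by (intro diagram.intro diagram_axioms.intro clan_models_axioms) (simp_all add: small_category_def)
    show "\<exists>x c. is_colimit J M D x c" by (rule colimit_exists)
  qed
  fix A assume "A \<in> Obj M"
  from filtered_colimit_of_fp_models[OF this]
  show "\<exists>(J :: ('u, 'u) cat) D c. small_category \<kappa> J \<and> filtered J \<and>
      is_functor J (full_subcat M (fp_model ` fin_graphs)) D \<and> is_colimit J M D A c" by metis
qed

lemma clan_algebraic_Mod: "clan_algebraic \<kappa> M (extensions \<kappa> T Disp) (full_maps \<kappa> T Disp)"
proof -
  let ?E = "extensions \<kappa> T Disp" and ?F = "full_maps \<kappa> T Disp"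
  let ?S = "compact_zero_extensions \<kappa> M ?E"
  have H: "H \<Gamma> \<in> ?S" if "\<Gamma> \<in> Obj T" for \<Gamma>
    using that compact_H zero_extension_H H_model by (simp add: compact_zero_extensions_def)
  have "hom_trans T ` Disp \<subseteq> {e \<in> ?E. src M e \<in> ?S \<and> trg M e \<in> ?S}"
  proof
    fix e assume "e \<in> hom_trans T ` Disp"
    then obtain p where p: "p \<in> Disp" "e = hom_trans T p" by blast
    then have "src M e = H (trg T p)" "trg M e = H (src T p)" using homD[OF hom_trans_hom[OF Disp_hom]] by auto
    then show "e \<in> {e \<in> ?E. src M e \<in> ?S \<and> trg M e \<in> ?S}"
      using hom_trans_extension p H src_Obj trg_Obj Disp_Arr by (simp add: subset_iff)
  qed
  then have "?F = rlp M {e \<in> ?E. src M e \<in> ?S \<and> trg M e \<in> ?S}" by (rule full_maps_eq_rlp) blast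
  moreover have "dense_subcat M ?S"
    using H by (intro dense_if_contains_H) (auto simp: compact_zero_extensions_def)
  ultimately show ?thesis
    unfolding clan_algebraic_def EF_category_def
    using locally_fin_presentable_Mod weak_factorization_system_Mod full_quotients by (metis (no_types, lifting))
qed

end

theorem theorem6p2:
  fixes \<kappa> :: "'u rel" and T :: "('o, 'u) cat" and Disp :: "'u set"
  assumes "size_bound \<kappa>"
    and "clan T \<kappa> Disp"
  shows "clan_algebraic \<kappa> (Mod \<kappa> T Disp) (extensions \<kappa> T Disp) (full_maps \<kappa> T Disp)"
proof -
  interpret clan_models T \<kappa> Disp
    using assms by (intro clan_models.intro small_sizes.intro)
  show ?thesis by (rule clan_algebraic_Mod)
qed

end
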